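(* Let $n\in\mathbb Z$, let $q,z,a,b,c$ be non-zero complex numbers with $|q|<1$, $|z|<1$, and assume there are no vanishing denominator factors. For a sign $\epsilon\in\{1,-1\}$ put $$P_\epsilon=\frac{(\frac{\epsilon\sqrt{qa}}b,\frac{\epsilon\sqrt{qa}}c,\epsilon bcz\sqrt{\frac qa};q)_\infty}{(\pm\sqrt q,\epsilon\sqrt{qa},\frac{\epsilon\sqrt{qa}}{bc},\frac{\epsilon bcz}{\sqrt{qa}};q)_\infty}\,{}_5\phi_4\!\left(\epsilon\sqrt{qa},\tfrac{\epsilon\sqrt qb}{\sqrt a},\tfrac{\epsilon\sqrt qc}{\sqrt a},\tfrac{\epsilon bcz}{\sqrt{qa}},\tfrac{\epsilon\sqrt{qa}}{bcz};-q,\pm\sqrt q,\tfrac{\epsilon\sqrt q\,bc}{\sqrt a};q,q\right),$$ $$Q_\epsilon=\frac{(\frac{\epsilon\sqrt a}b,\frac{\epsilon\sqrt a}c,\frac{\epsilon bcz}{\sqrt a};q)_\infty}{(\pm\frac1{\sqrt q},\epsilon q\sqrt a,\frac{\epsilon\sqrt a}{bc},\frac{\epsilon bcz}{\sqrt a};q)_\infty}\,{}_5\phi_4\!\left(\epsilon q\sqrt a,\tfrac{\epsilon qb}{\sqrt a},\tfrac{\epsilon qc}{\sqrt a},\tfrac{\epsilon bcz}{\sqrt a},\tfrac{\epsilon q\sqrt a}{bcz};-q,\pm q^{3/2},\tfrac{\epsilon qbc}{\sqrt a};q,q\right).$$ Then $${}_5W_4(a;b,c;q,z)=\frac{(qa,\frac{b^2c^2z^2}{qa},\frac{qa}{bc};q)_\infty}{2\,\vartheta(q^nz,q^{n+1}\frac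 a{bc};q)\,(-q,\frac{b^2c^2z^2}a,\frac{qa}b,\frac{qa}c;q)_\infty}\sum_{\epsilon=\pm1}\Big(\vartheta\big(\epsilon q^{n+\frac12}z\sqrt a,\tfrac{\epsilon q^{n+\frac12}\sqrt a}{bc};q\big)P_\epsilon+\vartheta\big(\epsilon q^{n+1}z\sqrt a,\tfrac{\epsilon q^n\sqrt a}{bc};q\big)Q_\epsilon\Big)$$ and also $${}_5W_4(a;b,c;q,z)=\frac{(qa,\frac{b^2c^2z^2}{qa},\frac{qa}{bc};q)_\infty}{2\,\vartheta(q^{n-1}\frac{bc}a,\frac{q^n}z;q)\,(-q,\frac{b^2c^2z^2}a,\frac{qa}b,\frac{qa}c;q)_\infty}\sum_{\epsilon=\pm1}\Big(\vartheta\big(\tfrac{\epsilon q^{n-\frac12}bc}{\sqrt a},\tfrac{\epsilon q^{n-\frac12}}{\sqrt a\,z};q\big)P_\epsilon+\vartheta\big(\tfrac{\epsilon q^nbc}{\sqrt a},\tfrac{\epsilon q^{n-1}}{\sqrt a\,z};q\big)Q_\epsilon\Big).$$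
   Context: Notation. $(a;q)_k=\prod_{j=0}^{k-1}(1-aq^j)$, $(a;q)_\infty=\prod_{j\ge0}(1-aq^j)$, $(a_1,\dots,a_r;q)_k=\prod_j(a_j;q)_k$ for $k\in\mathbb N_0\cup\{\infty\}$. In a list, $\pm x$ stands for the two entries $x,-x$. $\vartheta(x;q)=(x,q/x;q)_\infty$ for $x\ne0$, $\vartheta(x_1,\dots,x_k;q)=\prod_j\vartheta(x_j;q)$. ${}_{r+1}\phi_r(a_1,\dots,a_{r+1};b_1,\dots,b_r;q,z)=\sum_{k\ge0}\frac{(a_1,\dots,a_{r+1};q)_k}{(q,b_1,\dots,b_r;q)_k}z^k$ for $|z|<1$, and $${}_5W_4(a;b,c;q,z)={}_5\phi_4\!\left(a,\pm q\sqrt a,b,c;\pm\sqrt a,\tfrac{qa}b,\tfrac{qa}c;q,z\right).$$ Fix square roots $\sqrt q,\sqrt a$; $\sqrt{qa}=\sqrt q\sqrt a$, $\sqrt{q/a}=\sqrt q/\sqrt a$, and half-integer powers of $q$ are powers of $\sqrt q$. Convention "no vanishing denominator factors": every infinite $q$-shifted factorial and every theta function appearing in a denominator is non-zero, and no denominator parameter of any series lies in $\{q^{-k}:k\in\mathbb N_0\}$.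
   Formalization: In P_ε the fifth numerator parameter of the 5φ4 is taken to be ε√(qa)/(bcz) instead of the printed ε√(qa)/(bc); the printed formula omits z, so the series is not balanced and the identity fails for generic parameters. *)

theory Defs
  imports "HOL-Analysis.Analysis"
begin

definition qpoch :: "complex \<Rightarrow> complex \<Rightarrow> nat \<Rightarrow> complex" where
  "qpoch a q k = (\<Prod>j<k. 1 - a * q ^ j)"

definition qpoch_inf :: "complex \<Rightarrow> complex \<Rightarrow> complex" where
  "qpoch_inf a q = (\<Prod>j. 1 - a * q ^ j)"

definition qpochs :: "complex list \<Rightarrow> complex \<Rightarrow> nat \<Rightarrow> complex" where
  "qpochs as q k = (\<Prod>a\<leftarrow>as. qpoch a q k)"

definition qpochs_inf :: "complex list \<Rightarrow> complex \<Rightarrow> complex" where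
  "qpochs_inf as q = (\<Prod>a\<leftarrow>as. qpoch_inf a q)"

definition qtheta :: "complex \<Rightarrow> complex \<Rightarrow> complex" where
  "qtheta x q = qpochs_inf [x, q / x] q"

definition qthetas :: "complex list \<Rightarrow> complex \<Rightarrow> complex" where
  "qthetas xs q = (\<Prod>x\<leftarrow>xs. qtheta x q)"

(* Only meant for length as = length bs + 1; the general basic hypergeometric series
   carries an extra factor that is 1 in this case. *)
definition qphi :: "complex list \<Rightarrow> complex list \<Rightarrow> complex \<Rightarrow> complex \<Rightarrow> complex" where
  "qphi as bs q z = (\<Sum>k. qpochs as q k / qpochs (q # bs) q k * z ^ k)"

(* The values at which a denominator parameter makes some term of a series singular. *)
definition forbidden :: "complex \<Rightarrow> complex set" where
  "forbidden q = {1 / q ^ k | k :: nat. True}"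

(* In what follows sq and sa are the fixed square roots of q and a. Half-integer powers of q
   are powers of sq, sqrt(qa) is sq * sa, and sqrt(q/a) is sq / sa.
   The series W54 does not depend on the choice of sa. *)

definition W54 :: "complex \<Rightarrow> complex \<Rightarrow> complex \<Rightarrow> complex \<Rightarrow> complex \<Rightarrow> complex \<Rightarrow> complex" where
  "W54 a sa b c q z =
     qphi [a, q * sa, - (q * sa), b, c] [sa, - sa, q * a / b, q * a / c] q z"

definition P_term ::
  "complex \<Rightarrow> complex \<Rightarrow> complex \<Rightarrow> complex \<Rightarrow> complex \<Rightarrow> complex \<Rightarrow> complex \<Rightarrow> complex" where
  "P_term q sq sa b c z \<epsilon> =
     qpochs_inf [\<epsilon> * (sq * sa) / b, \<epsilon> * (sq * sa) / c, \<epsilon> * b * c * z * (sq / sa)] q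
     / qpochs_inf [sq, - sq, \<epsilon> * (sq * sa), \<epsilon> * (sq * sa) / (b * c),
                   \<epsilon> * b * c * z / (sq * sa)] q
     * qphi [\<epsilon> * (sq * sa), \<epsilon> * sq * b / sa, \<epsilon> * sq * c / sa,
             \<epsilon> * b * c * z / (sq * sa), \<epsilon> * (sq * sa) / (b * c * z)]
            [- q, sq, - sq, \<epsilon> * sq * b * c / sa] q q"

definition Q_term ::
  "complex \<Rightarrow> complex \<Rightarrow> complex \<Rightarrow> complex \<Rightarrow> complex \<Rightarrow> complex \<Rightarrow> complex \<Rightarrow> complex" where
  "Q_term q sq sa b c z \<epsilon> =
     qpochs_inf [\<epsilon> * sa / b, \<epsilon> * sa / c, \<epsilon> * b * c * z / sa] q
     / qpochs_inf [1 / sq, - (1 / sq), \<epsilon> * q * sa, \<epsilon> * sa / (b * c),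
                   \<epsilon> * b * c * z / sa] q
     * qphi [\<epsilon> * q * sa, \<epsilon> * q * b / sa, \<epsilon> * q * c / sa,
             \<epsilon> * b * c * z / sa, \<epsilon> * q * sa / (b * c * z)]
            [- q, sq ^ 3, - (sq ^ 3), \<epsilon> * q * b * c / sa] q q"

end

theory Submission
  imports Defs "HOL-Complex_Analysis.Complex_Analysis"
begin

text \<open>Write $p$ for the chosen square root of $q$, $\alpha$ for that of $a$, and put
$\lambda = bc/a$, $\kappa_1 = qa/b$, $\kappa_2 = qa/c$, so that
$\kappa_1\kappa_2\lambda = q^2\alpha^2$.

The integer $n$ is harmless: $\vartheta(q^nx,q^ny;q)$ differs from $\vartheta(x,y;q)$ by a factor that
depends on $n$ and on the product $xy$ only, and in each formula the arguments of every pair of theta functions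
have the same product. Hence every theta quotient can be computed at $n = 0$, and the inversion
$\vartheta(1/x;q) = -\vartheta(x;q)/x$ identifies the quotients of the second formula with those of the
first (lemmas \<open>qtheta_pair_shift\<close>, \<open>qtheta_pair_shift_inverse\<close>).

After clearing denominators one identity remains, \<open>W54_theta_identity\<close>. Its right-hand side is a
single series over the nodes $s = \epsilon\alpha p^M$ with $M \ge 1$: the series in $P_\epsilon$ runs over the
odd $M$, the series in $Q_\epsilon$ over the even $M$, and the theta prefactors containing $z$ are the values of
$\vartheta(zs;q)$ at the first node of each class. The summand at a node is a polynomial in
$w = \lambda zs/q$, called \<open>bracket\<close>, times $\vartheta(zs;q)$ times
$(\kappa_1/s,\kappa_2/s,\lambda s;q)_\infty/(s;q)_\infty$. The theorem \<open>node_expansion\<close> says that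
this series, multiplied by $\frac12(q\alpha^2;q)_\infty$, equals
$\vartheta(z;q)\,(\lambda,\kappa_1,\kappa_2;q)_\infty$ times the very-well-poised series.

Both sides of \<open>node_expansion\<close> are expanded in powers of $z$. The Jacobi triple product does this for
$\vartheta(z;q)$ and $\vartheta(zs;q)$, and the finite $q$-binomial theorem writes the bracket as a sum over
$i + j = M$. Comparing the coefficients of $z^N$ gives \<open>coefficient_identity\<close>, a statement about
a double series over $(i,j)$ on one side and a single series on the other.

For small parameters that statement follows from three summations. The \<open>moment_identity\<close>
evaluates $\sum_j\sum_\epsilon$ of $s^N(\lambda s;q)_\infty/(s;q)_\infty$ against Euler's coefficients: both
sides are expanded in powers of $\alpha$ by the $q$-binomial theorem, and the average over the two signs
removes the odd powers. Since $s^{-r}$ on one side corresponds to $q^{jr}$ on the other, Euler's expansion of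
$(\kappa_1v,\kappa_2v;q)_\infty$ can be superposed on it (\<open>superposition\<close>). Summing over $i$ along
$i + j = k$ then leaves a finite sum that \<open>q_saalschuetz\<close> evaluates.

Multiplication by $(q\alpha^2;q)_\infty$ clears the poles, and then both sides are holomorphic in the scaling
$\alpha \mapsto \alpha\tau$, $\lambda \mapsto \lambda\tau^2$ on the punctured plane. This scaling
preserves the relation $\kappa_1\kappa_2\lambda = q^2\alpha^2$, so the identity theorem carries the
coefficient identity from small $\tau$ to $\tau = 1$. All interchanges of summation, and the holomorphy, rest
on one explicit majorant (\<open>majorant_summable\<close>), whose summability again uses that relation.\<close>


section \<open>Infinite $q$-shifted factorials and the $q$-binomial theorem\<close>

lemma convergent_qpoch_inf:
  assumes "norm q < 1"
  shows "convergent_prod (\<lambda>j. 1 - a * q ^ j :: complex)"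
proof -
  have "summable (\<lambda>j. norm ((1 - a * q ^ j) - 1))"
    using assms by (simp add: norm_mult norm_power summable_geometric)
  then show ?thesis
    by (intro abs_convergent_prod_imp_convergent_prod summable_imp_abs_convergent_prod)
qed

lemma qpoch_LIMSEQ:
  assumes "norm q < 1"
  shows "(\<lambda>n. qpoch a q n) \<longlonglongrightarrow> qpoch_inf a q"
  using convergent_prod_LIMSEQ[OF convergent_qpoch_inf[OF assms, of a]]
  unfolding qpoch_def qpoch_inf_def LIMSEQ_lessThan_iff_atMost .

lemma qpoch_0 [simp]: "qpoch a q 0 = 1"
  by (simp add: qpoch_def)

lemma qpoch_zero_left [simp]: "qpoch 0 q n = 1"
  by (simp add: qpoch_def)

lemma qpoch_Suc: "qpoch a q (Suc n) = qpoch a q n * (1 - a * q ^ n)"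
  by (simp add: qpoch_def)

lemma qpoch_Suc_left: "qpoch a q (Suc n) = (1 - a) * qpoch (a * q) q n"
  by (simp add: qpoch_def prod.lessThan_Suc_shift mult.assoc del: prod.lessThan_Suc)

lemma qpoch_add: "qpoch a q (m + n) = qpoch a q m * qpoch (a * q ^ m) q n"
  by (induction n) (simp_all add: qpoch_Suc power_add mult_ac)

lemma qpoch_inf_split:
  assumes "norm q < 1"
  shows "qpoch_inf a q = qpoch a q n * qpoch_inf (a * q ^ n) q"
proof -
  have "(\<lambda>m. qpoch a q (n + m)) \<longlonglongrightarrow> qpoch_inf a q"
    using LIMSEQ_ignore_initial_segment[OF qpoch_LIMSEQ[OF assms, of a], of n]
    by (simp add: add.commute)
  moreover have "(\<lambda>m. qpoch a q (n + m)) \<longlonglongrightarrow> qpoch a q n * qpoch_inf (a * q ^ n) q"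
    unfolding qpoch_add by (intro tendsto_intros qpoch_LIMSEQ assms)
  ultimately show ?thesis by (rule LIMSEQ_unique)
qed

lemma qpoch_inf_Suc:
  assumes "norm q < 1"
  shows "qpoch_inf a q = (1 - a) * qpoch_inf (a * q) q"
  using qpoch_inf_split[OF assms, of a 1] by (simp add: qpoch_def)

lemma qpoch_inf_eq_0_iff:
  assumes "norm q < 1"
  shows "qpoch_inf a q = 0 \<longleftrightarrow> (\<exists>k. a * q ^ k = 1)"
proof
  assume "qpoch_inf a q = 0"
  then show "\<exists>k. a * q ^ k = 1"
    using prodinf_nonzero[OF convergent_qpoch_inf[OF assms, of a]]
    by (auto simp: qpoch_inf_def)
next
  assume "\<exists>k. a * q ^ k = 1"
  then obtain k where "a * q ^ k = 1" ..
  then have "qpoch a q (Suc k) = 0" by (simp add: qpoch_Suc)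
  then show "qpoch_inf a q = 0"
    using qpoch_inf_split[OF assms, of a "Suc k"] by simp
qed

lemma qpoch_inf_zero [simp]: "qpoch_inf 0 q = 1"
  by (simp add: qpoch_inf_def)

lemma qpoch_inf_nonzero:
  assumes "norm q < 1" "norm a < 1"
  shows "qpoch_inf a q \<noteq> 0"
proof
  assume "qpoch_inf a q = 0"
  then obtain k where "a * q ^ k = 1"
    using qpoch_inf_eq_0_iff[OF assms(1)] by auto
  then have "norm a * norm q ^ k = 1"
    by (metis norm_mult norm_one norm_power)
  moreover have "norm a * norm q ^ k \<le> norm a * 1"
    using assms by (intro mult_left_mono power_le_one) auto
  ultimately show False using assms by simp
qed

lemma qpoch_nonzero_of_inf:
  assumes "norm q < 1" "qpoch_inf a q \<noteq> 0"
  shows "qpoch a q n \<noteq> 0" "qpoch_inf (a * q ^ n) q \<noteq> 0"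
  using qpoch_inf_split[OF assms(1), of a n] assms(2) by auto

lemma qpoch_qq_nonzero:
  assumes "norm q < 1"
  shows "qpoch q q n \<noteq> 0" "qpoch_inf q q \<noteq> 0"
  using qpoch_inf_nonzero[OF assms assms] qpoch_nonzero_of_inf(1)[OF assms, of q n] by auto

text \<open>The homogeneous $q$-shifted factorial $u^n(a/u;q)_n$. It stays meaningful at $u = 0$, so that Euler's two
series and the $q$-binomial series become one theorem.\<close>

definition hpoch :: "complex \<Rightarrow> complex \<Rightarrow> complex \<Rightarrow> nat \<Rightarrow> complex" where
  "hpoch u a q n = (\<Prod>l<n. u - a * q ^ l)"

lemma hpoch_0 [simp]: "hpoch u a q 0 = 1"
  by (simp add: hpoch_def)

lemma hpoch_Suc: "hpoch u a q (Suc n) = hpoch u a q n * (u - a * q ^ n)"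
  by (simp add: hpoch_def)

lemma hpoch_one: "hpoch 1 a q n = qpoch a q n"
  by (simp add: hpoch_def qpoch_def)

lemma hpoch_zero: "hpoch u 0 q n = u ^ n"
  by (simp add: hpoch_def)

lemma hq_binomial_norm_summable:
  assumes q: "norm q < 1" and ux: "norm (u * x) < 1"
  shows "summable (\<lambda>n. norm (hpoch u a q n / qpoch q q n * x ^ n))"
proof -
  let ?f = "\<lambda>n. hpoch u a q n / qpoch q q n * x ^ n"
  obtain c where c: "norm (u * x) < c" "c < 1"
    using dense[OF ux] by auto
  have "(\<lambda>n. norm ((u - a * q ^ n) / (1 - q * q ^ n) * x)) \<longlonglongrightarrow> norm ((u - a * 0) / (1 - q * 0) * x)"
    using q by (intro tendsto_intros LIMSEQ_power_zero) auto
  then have "eventually (\<lambda>n. norm ((u - a * q ^ n) / (1 - q * q ^ n) * x) < c) sequentially"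
    using c by (intro order_tendstoD(2)) auto
  then obtain N where N: "\<And>n. n \<ge> N \<Longrightarrow> norm ((u - a * q ^ n) / (1 - q * q ^ n) * x) < c"
    by (auto simp: eventually_sequentially)
  have "norm (?f (Suc n)) \<le> c * norm (?f n)" if "n \<ge> N" for n
  proof -
    have "?f (Suc n) = ((u - a * q ^ n) / (1 - q * q ^ n) * x) * ?f n"
      by (simp add: hpoch_Suc qpoch_Suc mult_ac)
    then have "norm (?f (Suc n)) = norm ((u - a * q ^ n) / (1 - q * q ^ n) * x) * norm (?f n)"
      by (metis norm_mult)
    also have "\<dots> \<le> c * norm (?f n)"
      using N[OF that] by (intro mult_right_mono) auto
    finally show ?thesis .
  qed
  then show ?thesis
    using c by (intro summable_ratio_test[of c N]) auto
qed

text \<open>The sum $f$ satisfies $(1 - uy)f(y) = (1 - ay)f(qy)$; iterating this towards $f(0) = 1$ gives the product.\<close>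

theorem hq_binomial:
  assumes q: "norm q < 1" and ux: "norm (u * x) < 1"
  shows "(\<lambda>n. hpoch u a q n / qpoch q q n * x ^ n) sums (qpoch_inf (a * x) q / qpoch_inf (u * x) q)"
proof -
  define c where "c n = hpoch u a q n / qpoch q q n" for n
  have sm: "summable (\<lambda>n. c n * y ^ n)" if "norm (u * y) < 1" for y
    unfolding c_def by (intro summable_norm_cancel[OF hq_binomial_norm_summable] q that)
  have c_Suc: "c (Suc n) * (1 - q ^ Suc n) = c n * (u - a * q ^ n)" for n
  proof -
    have "1 - q * q ^ n \<noteq> 0"
      using qpoch_qq_nonzero(1)[OF q, of "Suc n"] by (simp add: qpoch_Suc)
    then show ?thesis by (simp add: c_def hpoch_Suc qpoch_Suc)
  qed
  define f where "f y = (\<Sum>n. c n * y ^ n)" for y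
  have step: "(1 - u * y) * f y = (1 - a * y) * f (q * y)" if y: "norm (u * y) < 1" for y
  proof -
    have qy: "norm (u * (q * y)) < 1"
    proof -
      have "norm (u * (q * y)) = norm q * norm (u * y)" by (simp add: norm_mult)
      also have "\<dots> \<le> 1 * norm (u * y)" using q by (intro mult_right_mono) auto
      finally show ?thesis using y by simp
    qed
    have s1: "(\<lambda>n. c n * y ^ n) sums f y" and s2: "(\<lambda>n. c n * (q * y) ^ n) sums f (q * y)"
      unfolding f_def by (intro summable_sums sm y qy)+
    have d: "(\<lambda>n. c n * (1 - q ^ n) * y ^ n) sums (f y - f (q * y))"
      using sums_diff[OF s1 s2] by (simp add: algebra_simps power_mult_distrib)
    have "(\<lambda>n. c (Suc n) * (1 - q ^ Suc n) * y ^ Suc n) sums (f y - f (q * y))"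
      using d sums_Suc_iff[of "\<lambda>n. c n * (1 - q ^ n) * y ^ n"] by simp
    moreover have "(\<lambda>n. y * (u * (c n * y ^ n) - a * (c n * (q * y) ^ n))) sums
                     (y * (u * f y - a * f (q * y)))"
      by (intro sums_mult sums_diff s1 s2)
    moreover have "c (Suc n) * (1 - q ^ Suc n) * y ^ Suc n
                     = y * (u * (c n * y ^ n) - a * (c n * (q * y) ^ n))" for n
      unfolding c_Suc by (simp add: algebra_simps power_mult_distrib)
    ultimately have "f y - f (q * y) = y * (u * f y - a * f (q * y))"
      by (metis (no_types, lifting) sums_cong sums_unique2)
    then show ?thesis by (simp add: algebra_simps)
  qed
  have uxq: "norm (u * (q ^ m * x)) < 1" for m
  proof -
    have "norm (u * (q ^ m * x)) = norm q ^ m * norm (u * x)" by (simp add: norm_mult norm_power)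
    also have "\<dots> \<le> 1 * norm (u * x)" using q by (intro mult_right_mono power_le_one) auto
    finally show ?thesis using ux by simp
  qed
  have iter: "qpoch (u * x) q m * f x = qpoch (a * x) q m * f (q ^ m * x)" for m
  proof (induction m)
    case (Suc m)
    have "qpoch (u * x) q (Suc m) * f x = (1 - u * x * q ^ m) * (qpoch (u * x) q m * f x)"
      by (simp add: qpoch_Suc)
    also have "\<dots> = qpoch (a * x) q m * ((1 - u * (q ^ m * x)) * f (q ^ m * x))"
      unfolding Suc by (simp add: mult_ac)
    also have "\<dots> = qpoch (a * x) q (Suc m) * f (q ^ Suc m * x)"
      unfolding step[OF uxq] by (simp add: qpoch_Suc mult_ac)
    finally show ?case .
  qed auto
  have f0: "f 0 = 1"
    unfolding f_def by (subst suminf_finite[of "{0}"]) (auto simp: c_def)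
  have "(\<lambda>m. f (q ^ m * x)) \<longlonglongrightarrow> f 0"
  proof (cases "x = 0")
    case False
    have "isCont f 0"
      unfolding f_def using sm[OF ux] False by (intro isCont_powser[of c x]) auto
    moreover have "(\<lambda>m. q ^ m * x) \<longlonglongrightarrow> 0"
      using tendsto_mult_left_zero[OF LIMSEQ_power_zero[OF q], of x] by simp
    ultimately show ?thesis by (rule isCont_tendsto_compose)
  qed simp
  then have "(\<lambda>m. qpoch (a * x) q m * f (q ^ m * x)) \<longlonglongrightarrow> qpoch_inf (a * x) q * 1"
    unfolding f0 by (intro tendsto_mult qpoch_LIMSEQ q)
  moreover have "(\<lambda>m. qpoch (a * x) q m * f (q ^ m * x)) \<longlonglongrightarrow> qpoch_inf (u * x) q * f x"
    unfolding iter[symmetric] by (intro tendsto_intros qpoch_LIMSEQ q)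
  ultimately have "qpoch_inf (u * x) q * f x = qpoch_inf (a * x) q * 1"
    by (rule LIMSEQ_unique[rotated])
  then have "f x = qpoch_inf (a * x) q / qpoch_inf (u * x) q"
    using qpoch_inf_nonzero[OF q ux] by (simp add: eq_divide_eq mult.commute)
  moreover have "(\<lambda>n. c n * x ^ n) sums f x"
    unfolding f_def by (intro summable_sums sm ux)
  ultimately show ?thesis by (simp add: c_def)
qed

lemma has_sum_hq_binomial:
  assumes q: "norm q < 1" and ux: "norm (u * x) < 1"
  shows "((\<lambda>n. hpoch u a q n / qpoch q q n * x ^ n) has_sum
           (qpoch_inf (a * x) q / qpoch_inf (u * x) q)) UNIV"
  by (intro norm_summable_imp_has_sum hq_binomial_norm_summable hq_binomial assms)

lemma holomorphic_qpoch_inf: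
  assumes q: "norm q < 1"
  shows "(\<lambda>x. qpoch_inf x q) holomorphic_on A"
proof (rule holomorphic_on_subset)
  let ?c = "\<lambda>n. hpoch 0 1 q n / qpoch q q n"
  have sums: "(\<lambda>n. ?c n * (x - 0) ^ n) sums qpoch_inf x q" for x
    using hq_binomial[OF q, of 0 x 1] by simp
  have "(\<lambda>x. qpoch_inf x q) holomorphic_on (\<Union>r\<in>UNIV. ball 0 r)"
  proof (rule holomorphic_on_UN_open)
    show "(\<lambda>x. qpoch_inf x q) holomorphic_on ball 0 r" for r
      by (rule power_series_holomorphic[OF sums])
  qed auto
  moreover have "(\<Union>r\<in>UNIV. ball (0::complex) r) = UNIV"
  proof (rule UNIV_eq_I[symmetric])
    show "x \<in> (\<Union>r\<in>UNIV. ball 0 r)" for x :: complex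
      by (rule UN_I[of "norm x + 1"]) auto
  qed
  ultimately show "(\<lambda>x. qpoch_inf x q) holomorphic_on UNIV"
    by metis
qed simp

section \<open>Summability and interchange of summations\<close>

lemma summable_on_times_prod:
  fixes a :: "'a \<Rightarrow> real" and b :: "'b \<Rightarrow> real"
  assumes "a summable_on A" "b summable_on B"
    and "\<And>x. x \<in> A \<Longrightarrow> a x \<ge> 0" "\<And>y. y \<in> B \<Longrightarrow> b y \<ge> 0"
  shows "(\<lambda>(x, y). a x * b y) summable_on A \<times> B"
proof (rule summable_on_SigmaI)
  show "((\<lambda>y. case (x, y) of (x, y) \<Rightarrow> a x * b y) has_sum a x * infsum b B) B" for x
    using assms by (auto intro!: has_sum_cmult_right)
  show "(\<lambda>x. a x * infsum b B) summable_on A"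
    by (intro summable_on_cmult_left assms)
qed (use assms in auto)

text \<open>Fubini's theorem in the form needed throughout: a dominating summable function supplies the common value of the
two iterated sums.\<close>

lemma has_sum_interchange:
  fixes f :: "'a \<Rightarrow> 'b \<Rightarrow> complex"
  assumes F: "F summable_on A \<times> B"
    and le: "\<And>x y. x \<in> A \<Longrightarrow> y \<in> B \<Longrightarrow> norm (f x y) \<le> F (x, y)"
    and g: "\<And>x. x \<in> A \<Longrightarrow> ((\<lambda>y. f x y) has_sum g x) B"
    and h: "\<And>y. y \<in> B \<Longrightarrow> ((\<lambda>x. f x y) has_sum h y) A"
  obtains S where "((\<lambda>(x, y). f x y) has_sum S) (A \<times> B)" "(g has_sum S) A" "(h has_sum S) B"
proof -
  have "(\<lambda>z. norm (case z of (x, y) \<Rightarrow> f x y)) summable_on A \<times> B"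
    using le by (intro Infinite_Sum.abs_summable_on_comparison_test'[OF F]) auto
  then have "(\<lambda>(x, y). f x y) summable_on A \<times> B"
    by (rule abs_summable_summable)
  then obtain S where S: "((\<lambda>(x, y). f x y) has_sum S) (A \<times> B)"
    by (auto simp: summable_on_def)
  then have S': "((\<lambda>(y, x). f x y) has_sum S) (B \<times> A)"
    by (subst (asm) has_sum_swap) (simp add: case_prod_unfold)
  have "(g has_sum S) A"
    using has_sum_SigmaD[OF S, of g] g by simp
  moreover have "(h has_sum S) B"
    using has_sum_SigmaD[OF S', of h] h by simp
  ultimately show ?thesis using S that by blast
qed

text \<open>A ratio test for Gaussian-type sequences, whose quasi-periodicity is only convenient over two steps.\<close>

lemma summable_gap2:
  fixes a :: "nat \<Rightarrow> real"
  assumes nonneg: "\<And>n. a n \<ge> 0" and r: "0 \<le> r" "r < 1"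
    and step: "\<And>n. a (n + 2) \<le> K * r ^ n * a n"
  shows "summable a"
proof -
  have "(\<lambda>n. K * r ^ n) \<longlonglongrightarrow> K * 0"
    using r by (intro tendsto_intros LIMSEQ_power_zero) auto
  then have "eventually (\<lambda>n. K * r ^ n < 1/2) sequentially"
    by (intro order_tendstoD(2)) auto
  then obtain N where N: "\<And>n. n \<ge> N \<Longrightarrow> K * r ^ n < 1/2"
    by (auto simp: eventually_sequentially)
  have half: "a (n + 2) \<le> (1/2) * a n" if "n \<ge> N" for n
    using step[of n] mult_right_mono[OF less_imp_le[OF N[OF that]] nonneg[of n]] by linarith
  \<comment> \<open>A factor $1/2$ over two steps makes the combination $a_{n+1} + c\,a_n$ with $c^2 = 1/2$ contract by $c$ in one step.\<close>
  define c where "c = sqrt (1/2)"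
  have c: "0 < c" "c < 1" "c * c = 1/2" by (auto simp: c_def)
  define d where "d n = a (Suc n) + c * a n" for n
  have d_nonneg: "d n \<ge> 0" for n using nonneg c by (simp add: d_def)
  have "norm (d (Suc n)) \<le> c * norm (d n)" if "n \<ge> N" for n
  proof -
    have "c * d n = c * a (Suc n) + (c * c) * a n"
      by (simp add: d_def algebra_simps)
    then have "d (Suc n) \<le> c * d n"
      using half[OF that] c(3) by (simp add: d_def)
    then show ?thesis using d_nonneg by simp
  qed
  then have "summable d" using c by (intro summable_ratio_test[of c N]) auto
  then have "summable (\<lambda>n. (1 / c) * d n)" by (rule summable_mult)
  then show ?thesis
  proof (rule summable_comparison_test_ev[rotated])
    have "norm (a n) \<le> (1 / c) * d n" for n
      using nonneg[of n] nonneg[of "Suc n"] c by (simp add: d_def field_simps)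
    then show "eventually (\<lambda>n. norm (a n) \<le> (1 / c) * d n) sequentially" by simp
  qed
qed

lemma summable_on_gap2:
  fixes a :: "nat \<Rightarrow> real"
  assumes "\<And>n. a n \<ge> 0" "0 \<le> r" "r < 1" "\<And>n. a (n + 2) \<le> K * r ^ n * a n"
  shows "a summable_on UNIV"
  by (intro summable_nonneg_imp_summable_on summable_gap2[of a r K] assms)

lemma summable_on_int_halves:
  fixes f :: "int \<Rightarrow> real"
  assumes "(\<lambda>n. f (int n)) summable_on UNIV" "(\<lambda>n. f (- int n)) summable_on UNIV"
  shows "f summable_on UNIV"
proof -
  have "f summable_on range int"
    using assms(1) by (subst summable_on_reindex) (auto simp: o_def)
  moreover have "f summable_on range (\<lambda>n. - int n)"
    using assms(2) by (subst summable_on_reindex) (auto simp: o_def inj_on_def)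
  ultimately have "f summable_on (range int \<union> range (\<lambda>n. - int n))"
    by (rule summable_on_union)
  also have "range int \<union> range (\<lambda>n. - int n) = UNIV"
  proof -
    have "x \<in> range int \<union> range (\<lambda>n. - int n)" for x
      by (cases x rule: int_cases2) auto
    then show ?thesis by auto
  qed
  finally show ?thesis .
qed

section \<open>The positive theta series\<close>

text \<open>The theta series with all signs positive. With $r = |p|$ it bounds $(x;q)_\infty$ in terms of $|x|$, and its quasi-periodicity turns estimates at different nodes into each other.\<close>

definition pth :: "real \<Rightarrow> real \<Rightarrow> real" where
  "pth r x = (\<Sum>\<^sub>\<infinity>N::int. r powi (N^2 - N) * x powi N)"

context
  fixes r :: real
  assumes r: "0 < r" "r < 1"
begin

lemma summable_pth:
  assumes x: "x > 0"
  shows "(\<lambda>N::int. r powi (N^2 - N) * x powi N) summable_on UNIV"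
proof (rule summable_on_int_halves)
  have *: "(\<lambda>n. r powi ((s * int n)^2 - s * int n) * x powi (s * int n)) summable_on UNIV"
    if s: "s = 1 \<or> s = -1" for s :: int
  proof (rule summable_on_gap2)
    show "0 \<le> r ^ 4" "r ^ 4 < 1"
      using r by (auto simp: power_less_one_iff)
    fix n :: nat
    show "0 \<le> r powi ((s * int n)^2 - s * int n) * x powi (s * int n)"
      using r x by simp
    have "r powi ((s * int (n+2))^2 - s * int (n+2)) * x powi (s * int (n+2))
       = r powi ((s * int n)^2 - s * int n + (4 * int n + (4 - 2 * s))) * x powi (s * int n + 2 * s)"
    proof -
      have "(s * int (n+2))^2 - s * int (n+2) = (s * int n)^2 - s * int n + (4 * int n + (4 - 2 * s))"
        using s by (auto simp: power2_eq_square algebra_simps)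
      moreover have "s * int (n+2) = s * int n + 2 * s" by (simp add: algebra_simps)
      ultimately show ?thesis by (simp only:)
    qed
    also have "\<dots> = (r powi (4 - 2 * s) * x powi (2 * s)) * r powi (4 * int n) *
        (r powi ((s * int n)^2 - s * int n) * x powi (s * int n))"
      using r x by (simp add: power_int_add)
    also have "r powi (4 * int n) = (r ^ 4) ^ n"
      by (metis power_int_mult power_int_of_nat of_nat_numeral)
    finally show "r powi ((s * int (n+2))^2 - s * int (n+2)) * x powi (s * int (n+2)) \<le>
        (r powi (4 - 2 * s) * x powi (2 * s)) * (r ^ 4) ^ n *
        (r powi ((s * int n)^2 - s * int n) * x powi (s * int n))" by simp
  qed
  show "(\<lambda>n. r powi ((int n)^2 - int n) * x powi int n) summable_on UNIV"
    using *[of 1] by simp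
  show "(\<lambda>n. r powi ((- int n)^2 - (- int n)) * x powi (- int n)) summable_on UNIV"
    using *[of "-1"] by simp
qed

lemma pth_nonneg: "x > 0 \<Longrightarrow> pth r x \<ge> 0"
  unfolding pth_def using r by (intro infsum_nonneg) simp

lemma pth_shift:
  assumes x: "x > 0"
  shows "pth r (x / r^2) = x / r^2 * pth r x"
proof -
  have "pth r (x / r^2) = (\<Sum>\<^sub>\<infinity>N::int. r powi ((N+1)^2 - (N+1)) * (x / r^2) powi (N+1))"
    unfolding pth_def
    by (rule infsum_reindex_bij_witness[of _ "\<lambda>N. N + 1" "\<lambda>N. N - 1"]) auto
  also have "\<dots> = (\<Sum>\<^sub>\<infinity>N::int. (x / r^2) * (r powi (N^2 - N) * x powi N))"
  proof (rule infsum_cong)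
    fix N :: int
    have e: "(N+1)^2 - (N+1) = (N^2 - N) + 2 * N" by (simp add: power2_eq_square algebra_simps)
    have "r powi ((N+1)^2 - (N+1)) = r powi (N^2 - N) * r powi (2 * N)"
      unfolding e by (rule power_int_add) (use r in auto)
    moreover have "(x / r^2) powi (N+1) = (x / r^2) * (x powi N / r powi (2 * N))"
    proof -
      have "r powi (2 * N) = (r^2) powi N" by (simp add: power_int_mult)
      then show ?thesis
        using r x power_int_add[of "x / r^2" N 1] by (simp add: power_int_divide_distrib mult.commute)
    qed
    ultimately show "r powi ((N+1)^2 - (N+1)) * (x / r^2) powi (N+1)
        = (x / r^2) * (r powi (N^2 - N) * x powi N)"
      using r by simp
  qed
  also have "\<dots> = x / r^2 * pth r x"
    unfolding pth_def using summable_pth[OF x] by (intro infsum_cmult_right)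
  finally show ?thesis .
qed

end

section \<open>Jacobi's triple product identity\<close>

text \<open>The square root $p$ of $q$ is carried along because the nodes are spaced by powers of $p$; with it the Gaussian
$q^{N(N-1)/2}$ becomes $p^{N^2-N}$, free of division by two.\<close>

locale nome =
  fixes p q :: complex
  assumes p: "p \<noteq> 0" "norm p < 1" and q_eq: "q = p ^ 2"
begin

lemma q: "q \<noteq> 0" "norm q < 1"
  using p by (auto simp: q_eq norm_power power_less_one_iff)

lemma q_pow: "q ^ n = p ^ (2 * n)" "q ^ n = p powi (2 * int n)"
proof -
  show "q ^ n = p ^ (2 * n)" by (simp add: q_eq power_mult)
  then show "q ^ n = p powi (2 * int n)"
    by (metis power_int_of_nat of_nat_mult of_nat_numeral)
qed

lemma q_powi: "q powi N = p powi (2 * N)"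
  by (simp add: q_eq power_int_mult)

lemma powi_add: "p powi m * p powi n = p powi (m + n)" "q powi m * q powi n = q powi (m + n)"
  using p q by (simp_all add: power_int_add)

lemma hpoch_0_1: "hpoch 0 1 q m = (-1) ^ m * p powi ((int m)^2 - int m)"
proof (induction m)
  case (Suc m)
  have "p powi ((int m)^2 - int m) * p powi (2 * int m) = p powi ((int (Suc m))^2 - int (Suc m))"
    unfolding powi_add
    by (rule arg_cong[of _ _ "\<lambda>e. p powi e"]) (simp add: power2_eq_square algebra_simps)
  then show ?case using Suc by (simp only: hpoch_Suc q_pow(2)) simp
qed auto

lemma euler: "((\<lambda>n. hpoch 0 1 q n / qpoch q q n * x ^ n) has_sum qpoch_inf x q) UNIV"
  using has_sum_hq_binomial[OF q(2), of 0 x 1] by simp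

lemma euler_recip:
  assumes "norm x < 1"
  shows "((\<lambda>n. x ^ n / qpoch q q n) has_sum (1 / qpoch_inf x q)) UNIV"
  using has_sum_hq_binomial[OF q(2), of 1 x 0] assms by (simp add: hpoch_zero)

text \<open>The vanishing for negative $e$ truncates bilateral sums to unilateral ones.\<close>

lemma qpoch_inf_q_powi:
  "qpoch_inf (q powi (1 + e)) q = (if e < 0 then 0 else qpoch_inf q q / qpoch q q (nat e))"
proof (cases "e < 0")
  case True
  have "q powi (1 + e) * q powi int (nat (- e - 1)) = q powi ((1 + e) + int (nat (- e - 1)))"
    by (rule powi_add)
  also have "(1 + e) + int (nat (- e - 1)) = 0" using True by simp
  finally have "q powi (1 + e) * q ^ nat (- e - 1) = 1"
    by (simp only: power_int_of_nat power_int_0_right)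
  then have "\<exists>k. q powi (1 + e) * q ^ k = 1" by blast
  then show ?thesis using True qpoch_inf_eq_0_iff[OF q(2)] by auto
next
  case False
  then obtain n where n: "e = int n" by (metis nonneg_int_cases not_less)
  have "q powi (1 + e) = q * q ^ n" using q by (simp add: n power_int_add)
  then show ?thesis using qpoch_inf_split[OF q(2), of q n] qpoch_qq_nonzero(1)[OF q(2), of n]
    by (simp add: n field_simps)
qed

lemma summable_norm_theta:
  assumes "x \<noteq> 0"
  shows "(\<lambda>N::int. norm ((-1) powi N * p powi (N^2 - N) * x powi N)) summable_on UNIV"
  using summable_pth[of "norm p" "norm x"] p assms by (simp add: norm_mult norm_power_int)

lemma qtheta_eq: "qtheta x q = qpoch_inf x q * qpoch_inf (q / x) q"
  by (simp add: qtheta_def qpochs_inf_def)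

lemma qtheta_q_mult:
  assumes x: "x \<noteq> 0"
  shows "qtheta (q * x) q = - qtheta x q / x"
proof (cases "x = 1")
  case True
  have "qpoch_inf 1 q = 0" using qpoch_inf_eq_0_iff[OF q(2), of 1] by (auto intro: exI[of _ 0])
  then show ?thesis using True q by (simp add: qtheta_eq)
next
  case False
  have "qpoch_inf x q = (1 - x) * qpoch_inf (q * x) q"
    using qpoch_inf_Suc[OF q(2), of x] by (simp add: mult.commute)
  moreover have "qpoch_inf (q / (q * x)) q = (1 - 1 / x) * qpoch_inf (q / x) q"
    using qpoch_inf_Suc[OF q(2), of "1 / x"] q by simp
  ultimately show ?thesis using x
    by (simp add: qtheta_eq) (simp add: field_simps)
qed

text \<open>Multiply the bilateral series by Euler's expansion of $1/(q/x;q)_\infty$ and collect equal powers of $x$: the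
coefficient of $x^n$ contains $(q^{1+n};q)_\infty$, so only $n \ge 0$ survives and Euler's series for
$(x;q)_\infty$ appears. This works for $|x| > |q|$; quasi-periodicity reaches all other $x$.\<close>

theorem jacobi_triple_product:
  assumes x: "x \<noteq> 0"
  shows "((\<lambda>N::int. (-1) powi N * p powi (N^2 - N) * x powi N) has_sum
           (qpoch_inf q q * qtheta x q)) UNIV"
proof -
  let ?t = "\<lambda>x (N::int). (-1) powi N * p powi (N^2 - N) * x powi N :: complex"
  have base: "(?t x has_sum (qpoch_inf q q * qtheta x q)) UNIV" if x: "x \<noteq> 0" "norm (q / x) < 1" for x
  proof -
    have smx: "(\<lambda>n. norm ((q / x) ^ n / qpoch q q n)) summable_on UNIV"
      using hq_binomial_norm_summable[OF q(2), of 1 "q / x" 0] x(2)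
      by (intro summable_nonneg_imp_summable_on) (auto simp: hpoch_zero)
    define f where "f n m = ?t x (n + int m) * ((q / x) ^ m / qpoch q q m)" for n :: int and m :: nat
    define F where "F = (\<lambda>(n, m). norm (f n m))"
    have prod: "(\<lambda>(N, m). norm (?t x N) * norm ((q / x) ^ m / qpoch q q m)) summable_on UNIV \<times> UNIV"
      by (rule summable_on_times_prod[OF summable_norm_theta[OF x(1)] smx]) auto
    have F: "F summable_on UNIV \<times> UNIV"
    proof -
      have "F summable_on UNIV \<times> UNIV \<longleftrightarrow>
         (\<lambda>(N, m). norm (?t x N) * norm ((q / x) ^ m / qpoch q q m)) summable_on UNIV \<times> UNIV"
        by (rule summable_on_reindex_bij_witness[of _ "\<lambda>(N, m). (N - int m, m)" "\<lambda>(n, m). (n + int m, m)"])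
           (auto simp: F_def f_def norm_mult norm_divide)
      then show ?thesis using prod by blast
    qed
    have inner: "((\<lambda>m. f n m) has_sum (?t x n * qpoch_inf (q powi (1 + n)) q)) UNIV" for n
    proof -
      have "f n m = ?t x n * (hpoch 0 1 q m / qpoch q q m * (q powi (1 + n)) ^ m)" for m
      proof -
        have e: "(n + int m)^2 - (n + int m) + 2 * int m
              = n^2 - n + ((int m)^2 - int m) + 2 * (1 + n) * int m"
          by (simp add: power2_eq_square algebra_simps)
        have pp: "p powi ((n + int m)^2 - (n + int m)) * q ^ m
            = p powi (n^2 - n) * p powi ((int m)^2 - int m) * (q powi (1 + n)) ^ m"
        proof -
          have "p powi ((n + int m)^2 - (n + int m)) * q ^ m
              = p powi ((n + int m)^2 - (n + int m) + 2 * int m)"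
            unfolding q_pow(2) by (rule powi_add)
          moreover have "(q powi (1 + n)) ^ m = p powi (2 * (1 + n) * int m)"
            unfolding q_powi by (metis power_int_mult power_int_of_nat)
          ultimately show ?thesis unfolding e by (simp only: powi_add)
        qed
        have "f n m = (-1) powi n * (-1) ^ m * (p powi ((n + int m)^2 - (n + int m)) * q ^ m) * x powi n / qpoch q q m"
          unfolding f_def using x by (simp add: power_int_add power_divide field_simps)
        also have "\<dots> = ?t x n * (hpoch 0 1 q m / qpoch q q m * (q powi (1 + n)) ^ m)"
          unfolding pp hpoch_0_1 by simp
        finally show ?thesis .
      qed
      then show ?thesis using has_sum_cmult_right[OF euler[of "q powi (1 + n)"], of "?t x n"] by simp
    qed
    have "(\<lambda>z. case z of (n, m) \<Rightarrow> f n m) summable_on UNIV \<times> UNIV"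
    proof (rule abs_summable_summable)
      show "(\<lambda>z. norm (case z of (n, m) \<Rightarrow> f n m)) summable_on UNIV \<times> UNIV"
        using F by (simp add: F_def case_prod_unfold)
    qed
    then obtain S where S: "((\<lambda>(n, m). f n m) has_sum S) (UNIV \<times> UNIV)"
      by (auto simp: summable_on_def)
    have S1: "((\<lambda>n. ?t x n * qpoch_inf (q powi (1 + n)) q) has_sum S) UNIV"
      using has_sum_SigmaD[OF S, of "\<lambda>n. ?t x n * qpoch_inf (q powi (1 + n)) q"] inner by simp
    have "((\<lambda>n. ?t x n * qpoch_inf (q powi (1 + n)) q) has_sum S) UNIV \<longleftrightarrow>
          ((\<lambda>n. ?t x (int n) * (qpoch_inf q q / qpoch q q n)) has_sum S) UNIV"
    proof -
      have "((\<lambda>n. ?t x n * qpoch_inf (q powi (1 + n)) q) has_sum S) UNIV \<longleftrightarrow>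
            ((\<lambda>n. ?t x n * qpoch_inf (q powi (1 + n)) q) has_sum S) {0..}"
        by (rule has_sum_cong_neutral) (auto simp: qpoch_inf_q_powi)
      also have "\<dots> \<longleftrightarrow> ((\<lambda>n. ?t x (int n) * (qpoch_inf q q / qpoch q q n)) has_sum S) UNIV"
        by (rule has_sum_reindex_bij_witness[of _ int nat]) (auto simp: qpoch_inf_q_powi)
      finally show ?thesis .
    qed
    with S1 have S2: "((\<lambda>n. ?t x (int n) * (qpoch_inf q q / qpoch q q n)) has_sum S) UNIV" by blast
    have "((\<lambda>n. qpoch_inf q q * (hpoch 0 1 q n / qpoch q q n * x ^ n)) has_sum
            (qpoch_inf q q * qpoch_inf x q)) UNIV"
      by (intro has_sum_cmult_right euler)
    then have S_eq: "S = qpoch_inf q q * qpoch_inf x q"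
      using has_sum_unique[OF S2] by (simp add: hpoch_0_1 mult_ac)
    obtain T where T: "(?t x has_sum T) UNIV"
      using abs_summable_summable[OF summable_norm_theta[OF x(1)]] by (auto simp: summable_on_def)
    have "((\<lambda>(m, N). f (N - int m) m) has_sum S) (UNIV \<times> UNIV)"
    proof -
      have "((\<lambda>(n, m). f n m) has_sum S) (UNIV \<times> UNIV) \<longleftrightarrow>
            ((\<lambda>(m, N). f (N - int m) m) has_sum S) (UNIV \<times> UNIV)"
        by (rule has_sum_reindex_bij_witness[of _ "\<lambda>(m, N). (N - int m, m)" "\<lambda>(n, m). (m, n + int m)"])
           auto
      then show ?thesis using S by blast
    qed
    then have "((\<lambda>m. T * ((q / x) ^ m / qpoch q q m)) has_sum S) UNIV"
    proof (rule has_sum_SigmaD)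
      show "((\<lambda>N. case (m, N) of (m, N) \<Rightarrow> f (N - int m) m) has_sum
              T * ((q / x) ^ m / qpoch q q m)) UNIV" for m
        using has_sum_cmult_left[OF T, of "(q / x) ^ m / qpoch q q m"] by (simp add: f_def)
    qed
    moreover have "((\<lambda>m. T * ((q / x) ^ m / qpoch q q m)) has_sum (T * (1 / qpoch_inf (q / x) q))) UNIV"
      by (intro has_sum_cmult_right euler_recip x)
    ultimately have "T * (1 / qpoch_inf (q / x) q) = qpoch_inf q q * qpoch_inf x q"
      unfolding S_eq using has_sum_unique by blast
    then have "T = qpoch_inf q q * qtheta x q"
      using qpoch_inf_nonzero[OF q(2) x(2)] by (simp add: qtheta_eq field_simps)
    then show ?thesis using T by simp
  qed
  have shift: "(?t (q * x) has_sum (qpoch_inf q q * qtheta (q * x) q)) UNIV"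
    if x: "x \<noteq> 0" and J: "(?t x has_sum (qpoch_inf q q * qtheta x q)) UNIV" for x
  proof -
    have "((\<lambda>N. (- 1 / x) * ?t x N) has_sum ((- 1 / x) * (qpoch_inf q q * qtheta x q))) UNIV"
      by (intro has_sum_cmult_right J)
    moreover have "((\<lambda>N. (- 1 / x) * ?t x N) has_sum ((- 1 / x) * (qpoch_inf q q * qtheta x q))) UNIV
       \<longleftrightarrow> (?t (q * x) has_sum (qpoch_inf q q * qtheta (q * x) q)) UNIV"
    proof (rule has_sum_reindex_bij_witness[of _ "\<lambda>N. N + 1" "\<lambda>N. N - 1"])
      fix N :: int
      have e: "N^2 - N = ((N - 1)^2 - (N - 1)) + 2 * (N - 1)"
        by (simp add: power2_eq_square algebra_simps)
      have "p powi (N^2 - N) = p powi ((N - 1)^2 - (N - 1)) * q powi (N - 1)"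
        unfolding q_powi powi_add by (simp only: e[symmetric])
      moreover have "(-1) powi N = - ((-1) powi (N - 1) :: complex)" "x powi N = x * x powi (N - 1)"
        using x power_int_add[of "-1::complex" 1 "N - 1"] power_int_add[of x 1 "N - 1"] by auto
      ultimately show "?t (q * x) (N - 1) = (- 1 / x) * ?t x N"
        using x by (simp add: power_int_mult_distrib)
    qed (use qtheta_q_mult[OF x] in auto)
    ultimately show ?thesis by blast
  qed
  have all: "(?t (q ^ n * y) has_sum (qpoch_inf q q * qtheta (q ^ n * y) q)) UNIV"
    if y: "y \<noteq> 0" "norm (q / y) < 1" for n y
  proof (induction n)
    case 0
    then show ?case using base[OF y] by simp
  next
    case (Suc n)
    have "q ^ n * y \<noteq> 0" using q y by simp
    from shift[OF this Suc] show ?case by (simp add: mult_ac)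
  qed
  have "(\<lambda>n. norm q * norm q ^ n) \<longlonglongrightarrow> norm q * 0"
    using q by (intro tendsto_intros LIMSEQ_power_zero) auto
  then have "eventually (\<lambda>n. norm q * norm q ^ n < norm x) sequentially"
    using x by (intro order_tendstoD(2)) auto
  then obtain n where n: "norm q * norm q ^ n < norm x"
    by (auto simp: eventually_sequentially)
  have "norm (q / (x / q ^ n)) < 1"
    using n x q by (simp add: norm_divide norm_mult norm_power field_simps)
  then show ?thesis using all[of "x / q ^ n" n] x q by simp
qed

section \<open>The $q$-Saalschuetz sum\<close>

lemma one_minus_q_pow_nonzero: "1 - q * q ^ n \<noteq> 0"
  using qpoch_qq_nonzero(1)[OF q(2), of "Suc n"] by (simp add: qpoch_Suc)

text \<open>Here $\lambda^j(q/\lambda;q)_j$ has been written as a homogeneous factorial, and the balancing condition ties $e$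
to the other parameters. The induction step compares the sum for $(a, e)$ at $k + 1$ with the one for $(aq, eq)$ at
$k$, for which the factor $aq^k$ is the same.\<close>

theorem q_saalschuetz:
  assumes "d \<noteq> 0" "lam \<noteq> 0" "qpoch d q k \<noteq> 0" "qpoch e q k \<noteq> 0" "e * d * lam = q^2 * a"
  shows "(\<Sum>j\<le>k. lam ^ (k - j) * hpoch 0 1 q (k - j) * hpoch lam q q j * qpoch (a * q ^ k) q j
            / (qpoch q q (k - j) * qpoch q q j * qpoch d q j * qpoch e q j))
       = hpoch 0 1 q k * q ^ k * qpoch (q * a / d) q k * qpoch (lam * d / q) q k
            / (qpoch q q k * qpoch d q k * qpoch e q k)"
  using assms
proof (induction k arbitrary: a e)
  case (Suc k)
  define a1 where "a1 = a * q"
  define e1 where "e1 = e * q"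
  define A where "A = a * q ^ Suc k"
  have A1: "A = a1 * q ^ k" by (simp add: A_def a1_def)
  define f0 where "f0 j = lam ^ (k - j) * hpoch 0 1 q (k - j) * hpoch lam q q j * qpoch A q j
            / (qpoch q q (k - j) * qpoch q q j * qpoch d q j * qpoch e1 q j)" for j
  define f1 where "f1 j = lam ^ (Suc k - j) * hpoch 0 1 q (Suc k - j) * hpoch lam q q j * qpoch A q j
            / (qpoch q q (Suc k - j) * qpoch q q j * qpoch d q j * qpoch e q j)" for j
  define X where "X = (1 - q * q ^ k) * (1 - d * q ^ k) * (1 - e)"
  define Y where "Y = - (q * q ^ k) * (1 - q * a / d) * (1 - lam * d / q * q ^ k)"
  \<comment> \<open>The telescoping certificate: the combination of the two summands prescribed by the recurrence is a difference of consecutive values of $G$.\<close>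
  define G where "G j = - f0 j * q ^ (k - j) * (lam - q * q ^ j) * (1 - A * q ^ j)" for j
  have ed: "a = e * d * lam / q^2" using Suc.prems(5) q by (simp add: field_simps)
  have dk: "qpoch d q k \<noteq> 0" "1 - d * q ^ k \<noteq> 0" using Suc.prems(3) by (auto simp: qpoch_Suc)
  have ek: "1 - e \<noteq> 0" "qpoch e1 q k \<noteq> 0"
    using Suc.prems(4) by (auto simp: qpoch_Suc_left e1_def)
  have dj: "1 - d * q ^ j \<noteq> 0" if "j \<le> k" for j
    using dk that by (cases "j = k") (auto simp: qpoch_def)
  have ej: "1 - e1 * q ^ j \<noteq> 0" if "j < k" for j
    using ek(2) that unfolding qpoch_def by auto
  have f1_Suc: "f1 (Suc j) = f0 j * (lam - q * q ^ j) * (1 - A * q ^ j)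
      / ((1 - q * q ^ j) * (1 - d * q ^ j) * (1 - e))" for j
    unfolding f1_def f0_def qpoch_Suc_left[of e] e1_def[symmetric]
    by (simp add: qpoch_Suc hpoch_Suc mult_ac)
  have f0_Suc: "f0 (Suc j) * (- lam * q ^ (k - Suc j)) * (1 - q * q ^ j) * (1 - d * q ^ j) * (1 - e1 * q ^ j)
      = f0 j * (1 - q * q ^ (k - Suc j)) * (lam - q * q ^ j) * (1 - A * q ^ j)" if "j < k" for j
  proof -
    define m where "m = k - Suc j"
    have m: "k - j = Suc m" "k - Suc j = m" using that by (simp_all add: m_def)
    define T where "T = lam ^ m * hpoch 0 1 q m * hpoch lam q q j * qpoch A q j
        / (qpoch q q m * qpoch q q j * qpoch d q j * qpoch e1 q j)"
    have fS: "f0 (Suc j) = T * ((lam - q * q ^ j) * (1 - A * q ^ j)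
        / ((1 - q * q ^ j) * (1 - d * q ^ j) * (1 - e1 * q ^ j)))"
      unfolding f0_def m T_def qpoch_Suc hpoch_Suc by (simp add: mult_ac)
    have f0T: "f0 j = T * ((- lam * q ^ m) / (1 - q * q ^ m))"
      unfolding f0_def m T_def qpoch_Suc hpoch_Suc by (simp add: mult_ac)
    have cancel: "x1 * u * c1 * c2 * c3 = x0 * v * w1 * w2"
      if "x1 = T * ((w1 * w2) / (c1 * c2 * c3))" "x0 = T * (u / v)" "c1 \<noteq> 0" "c2 \<noteq> 0" "c3 \<noteq> 0" "v \<noteq> 0"
      for x0 x1 u v w1 w2 c1 c2 c3 :: complex
      using that by simp
    show ?thesis unfolding m
      by (rule cancel[OF fS f0T one_minus_q_pow_nonzero dj[OF less_imp_le[OF that]] ej[OF that]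
            one_minus_q_pow_nonzero])
  qed
  have step: "X * f1 (Suc j) = Y * f0 (Suc j) + G (Suc j) - G j" if "j < k" for j
  proof -
    define m where "m = k - Suc j"
    define J where "J = q ^ j"
    define M where "M = q ^ m"
    have k: "k = Suc (j + m)" using that by (simp add: m_def)
    have kj: "k - j = Suc m" "k - Suc j = m" by (auto simp: k)
    have qk: "q ^ k = q * J * M" by (simp add: k J_def M_def power_add)
    have nz: "J \<noteq> 0" "M \<noteq> 0" "1 - q * J \<noteq> 0" "1 - d * J \<noteq> 0" "1 - e1 * J \<noteq> 0"
      using q one_minus_q_pow_nonzero[of j] dj[of j] ej[of j] that by (auto simp: J_def M_def)
    define t where "t = f0 j * (lam - q * J) * (1 - A * J)"
    define D where "D = (1 - q * J) * (1 - d * J) * (1 - e1 * J)"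
    have D: "D \<noteq> 0" using nz by (simp add: D_def)
    have f0S: "f0 (Suc j) * (- lam * M) * D = t * (1 - q * M)"
      using f0_Suc[OF that] by (simp add: kj J_def[symmetric] M_def[symmetric] t_def D_def mult_ac)
    have X1: "X * f1 (Suc j) * D = t * ((1 - q * q ^ k) * (1 - d * q ^ k) * (1 - e1 * J))"
      unfolding f1_Suc X_def D_def t_def J_def[symmetric] using nz ek by simp
    have G1: "G (Suc j) = - f0 (Suc j) * M * (lam - q * (q * J)) * (1 - A * (q * J))"
      by (simp add: G_def kj J_def M_def)
    have G0: "G j = - t * (q * M)"
      by (simp add: G_def kj J_def M_def t_def)
    have poly: "lam * M * ((1 - q * q ^ k) * (1 - d * q ^ k) * (1 - e1 * J))
       = - (1 - q * M) * (Y - M * (lam - q * (q * J)) * (1 - A * (q * J))) + lam * M * (q * M) * D"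
    proof -
      have Aeq: "A = e * d * lam * J * M"
        unfolding A_def ed using q by (simp add: qk power2_eq_square)
      have Yeq: "Y = - q * J * M * (q - e * lam) * (1 - lam * d * J * M)"
        unfolding Y_def ed qk using q Suc.prems(1) by (simp add: power2_eq_square field_simps)
      show ?thesis unfolding Aeq Yeq D_def e1_def qk by algebra
    qed
    have "lam * M * (X * f1 (Suc j) * D) = t * (lam * M * ((1 - q * q ^ k) * (1 - d * q ^ k) * (1 - e1 * J)))"
      unfolding X1 by simp
    also have "\<dots> = - (t * (1 - q * M)) * (Y - M * (lam - q * (q * J)) * (1 - A * (q * J)))
                      + t * (lam * M * (q * M) * D)"
      unfolding poly by (simp add: algebra_simps)
    also have "\<dots> = lam * M * ((Y * f0 (Suc j) + G (Suc j) - G j) * D)"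
      unfolding f0S[symmetric] G1 G0 by (simp add: algebra_simps)
    finally show ?thesis using D nz Suc.prems(2) by simp
  qed
  have first: "X * f1 0 = Y * f0 0 + G 0"
  proof -
    have *: "f1 0 * (1 - q * q ^ k) = f0 0 * (- lam * q ^ k)"
      using one_minus_q_pow_nonzero[of k] by (simp add: f1_def f0_def qpoch_Suc hpoch_Suc)
    have "X * f1 0 = (f1 0 * (1 - q * q ^ k)) * ((1 - d * q ^ k) * (1 - e))"
      by (simp add: X_def mult_ac)
    also have "\<dots> = f0 0 * (- lam * q ^ k) * ((1 - d * q ^ k) * (1 - e))"
      unfolding * ..
    also have "\<dots> = Y * f0 0 + G 0"
      unfolding Y_def G_def A_def ed using q Suc.prems(1)
      by (simp add: power2_eq_square field_simps)
    finally show ?thesis .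
  qed
  have last: "X * f1 (Suc k) = - G k"
    unfolding f1_Suc G_def X_def using one_minus_q_pow_nonzero[of k] dk ek by simp
  have "X * (\<Sum>j\<le>Suc k. f1 j) = X * f1 0 + (\<Sum>j<k. X * f1 (Suc j)) + X * f1 (Suc k)"
    by (simp add: sum.atMost_shift sum_distrib_left algebra_simps)
  also have "(\<Sum>j<k. X * f1 (Suc j)) = (\<Sum>j<k. Y * f0 (Suc j)) + (\<Sum>j<k. G (Suc j) - G j)"
    by (simp add: step sum.distrib[symmetric] algebra_simps)
  also have "(\<Sum>j<k. G (Suc j) - G j) = G k - G 0" by (rule sum_lessThan_telescope)
  also have "X * f1 0 + ((\<Sum>j<k. Y * f0 (Suc j)) + (G k - G 0)) + X * f1 (Suc k)
      = Y * (f0 0 + (\<Sum>j<k. f0 (Suc j)))"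
    unfolding first last by (simp add: sum_distrib_left algebra_simps)
  also have "f0 0 + (\<Sum>j<k. f0 (Suc j)) = (\<Sum>j\<le>k. f0 j)"
    by (simp add: sum.atMost_shift)
  also have "(\<Sum>j\<le>k. f0 j) = hpoch 0 1 q k * q ^ k * qpoch (q * a1 / d) q k * qpoch (lam * d / q) q k
            / (qpoch q q k * qpoch d q k * qpoch e1 q k)"
  proof -
    have "e1 * d * lam = q^2 * a1" using Suc.prems(5) by (simp add: e1_def a1_def mult_ac)
    from Suc.IH[OF Suc.prems(1,2) dk(1) ek(2) this] show ?thesis
      unfolding f0_def A1 .
  qed
  finally have rec: "X * (\<Sum>j\<le>Suc k. f1 j) = Y * (hpoch 0 1 q k * q ^ k * qpoch (q * a1 / d) q k *
     qpoch (lam * d / q) q k / (qpoch q q k * qpoch d q k * qpoch e1 q k))" .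
  have X0: "X \<noteq> 0" using one_minus_q_pow_nonzero[of k] dk ek by (simp add: X_def)
  then have "(\<Sum>j\<le>Suc k. f1 j) = Y * (hpoch 0 1 q k * q ^ k * qpoch (q * a1 / d) q k *
     qpoch (lam * d / q) q k / (qpoch q q k * qpoch d q k * qpoch e1 q k)) / X"
    unfolding nonzero_eq_divide_eq[OF X0] by (subst mult.commute) (rule rec)
  also have "\<dots> = hpoch 0 1 q (Suc k) * q ^ Suc k * qpoch (q * a / d) q (Suc k) * qpoch (lam * d / q) q (Suc k)
            / (qpoch q q (Suc k) * qpoch d q (Suc k) * qpoch e q (Suc k))"
  proof -
    have "qpoch (q * a / d) q (Suc k) = (1 - q * a / d) * qpoch (q * a1 / d) q k"
      by (simp add: qpoch_Suc_left a1_def mult_ac)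
    then show ?thesis
      unfolding qpoch_Suc_left[of e] e1_def[symmetric]
      by (simp only: X_def Y_def hpoch_Suc qpoch_Suc[of q] qpoch_Suc[of d] qpoch_Suc[of "lam * d / q"])
         (simp add: mult_ac)
  qed
  finally show ?case unfolding f1_def A_def .
qed simp

lemma norm_q_powi_antimono:
  assumes "m \<le> n"
  shows "norm (q powi n) \<le> norm (q powi m)"
proof -
  have "q powi n = q powi m * q ^ nat (n - m)"
    using powi_add(2)[of m "n - m"] assms by (simp add: power_int_def)
  moreover have "norm (q ^ nat (n - m)) \<le> 1"
    using q by (simp add: norm_power power_le_one)
  ultimately show ?thesis
    by (simp add: norm_mult mult_left_le)
qed

section \<open>A moment identity over the nodes\<close>

text \<open>On the left, $(\lambda s;q)_\infty/(s;q)_\infty$ is expanded in powers $s^n$; the mean over the signs keeps even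
$N + n = 2e$, and Euler's series sums over $j$ to $(q^{1+e};q)_\infty$, which vanishes unless $e \ge 0$. On the
right, $1/(\sigma^2q^{2j};q)_\infty$ is expanded in powers $\sigma^{2e}$ and the sum over $j$ is a $q$-binomial
series. The coefficients of $\sigma^{2e}$ agree.\<close>

theorem moment_identity:
  fixes N :: int
  assumes sg: "\<sigma> \<noteq> 0" "norm \<sigma> < 1" and lam: "norm (lam * q powi (- N)) < 1"
  obtains S where
    "((\<lambda>j. hpoch 0 1 q j / qpoch q q j * q ^ j * (1/2) *
        (\<Sum>\<epsilon>\<in>{1,-1}. (\<epsilon> * \<sigma> * p ^ j) powi N *
           (qpoch_inf (lam * (\<epsilon> * \<sigma> * p ^ j)) q / qpoch_inf (\<epsilon> * \<sigma> * p ^ j) q))) has_sum S) UNIV"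
    "((\<lambda>j. qpoch_inf lam q * (hpoch lam q q j / qpoch q q j * (q powi (- N)) ^ j)
        / qpoch_inf (\<sigma>^2 * q ^ (2 * j)) q) has_sum S) UNIV"
proof -
  define w where "w j = hpoch 0 1 q j / qpoch q q j * q ^ j" for j
  define c where "c n = qpoch lam q n / qpoch q q n" for n
  define par where "par n = (if even (N + int n) then 1 else 0 :: complex)" for n
  have pj: "norm (p ^ j) \<le> 1" for j using p by (simp add: norm_power power_le_one)
  have x1: "norm (\<sigma> * p ^ j) < 1" for j
  proof -
    have "norm \<sigma> * norm (p ^ j) \<le> norm \<sigma> * 1" using pj by (intro mult_left_mono) auto
    then show ?thesis unfolding norm_mult using sg by linarith
  qed
  have x0: "\<sigma> * p ^ j \<noteq> 0" for j using sg p by simp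

  \<comment> \<open>Left-hand side: expand the quotient of infinite products in powers of the node; the two
      signs cancel the odd powers, and Euler's series then performs the sum over the nodes.\<close>
  define f where "f j n = w j * ((\<sigma> * p ^ j) powi (N + int n) * (c n * par n))" for j n
  define L where "L j = w j * (1/2) *
        (\<Sum>\<epsilon>\<in>{1,-1}. (\<epsilon> * \<sigma> * p ^ j) powi N *
           (qpoch_inf (lam * (\<epsilon> * \<sigma> * p ^ j)) q / qpoch_inf (\<epsilon> * \<sigma> * p ^ j) q))" for j
  have fL: "((\<lambda>n. f j n) has_sum L j) UNIV" for j
  proof -
    define x where "x = \<sigma> * p ^ j"
    have "((\<lambda>n. c n * y ^ n) has_sum (qpoch_inf (lam * y) q / qpoch_inf y q)) UNIV" if "norm y < 1" for y
      using has_sum_hq_binomial[OF q(2), of 1 y lam] that by (simp add: hpoch_one c_def)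
    from this[of x] this[of "- x"]
    have "((\<lambda>n. w j * (1/2) * (x powi N * (c n * x ^ n) + (- x) powi N * (c n * (- x) ^ n))) has_sum
        w j * (1/2) * (x powi N * (qpoch_inf (lam * x) q / qpoch_inf x q)
           + (- x) powi N * (qpoch_inf (lam * (- x)) q / qpoch_inf (- x) q))) UNIV"
      using x1[of j] by (intro has_sum_cmult_right has_sum_add) (simp_all add: x_def)
    moreover have "w j * (1/2) * (x powi N * (c n * x ^ n) + (- x) powi N * (c n * (- x) ^ n)) = f j n" for n
    proof -
      have "y powi N * (c n * y ^ n) = y powi (N + int n) * c n" if "y \<noteq> 0" for y :: complex
        using that by (simp add: power_int_add)
      from this[of x] this[of "- x"] show ?thesis
        using x0[of j] by (simp add: f_def par_def x_def[symmetric] power_int_minus_left)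
    qed
    ultimately show ?thesis by (simp add: L_def x_def)
  qed
  define h where "h n = \<sigma> powi (N + int n) * c n * par n * qpoch_inf (q * p powi (N + int n)) q" for n
  have fh: "((\<lambda>j. f j n) has_sum h n) UNIV" for n
  proof -
    have "((\<lambda>j. \<sigma> powi (N + int n) * c n * par n *
         (hpoch 0 1 q j / qpoch q q j * (q * p powi (N + int n)) ^ j)) has_sum h n) UNIV"
      unfolding h_def by (intro has_sum_cmult_right euler)
    moreover have "\<sigma> powi (N + int n) * c n * par n *
         (hpoch 0 1 q j / qpoch q q j * (q * p powi (N + int n)) ^ j) = f j n" for j
    proof -
      have "(p ^ j) powi (N + int n) = (p powi (N + int n)) ^ j"
        by (metis power_int_mult power_int_of_nat mult.commute)
      then show ?thesis
        by (simp add: f_def w_def power_int_mult_distrib power_mult_distrib)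
    qed
    ultimately show ?thesis by simp
  qed
  have sA: "(\<lambda>j. norm (hpoch 0 1 q j / qpoch q q j * (q * p powi N) ^ j)) summable_on UNIV"
    using hq_binomial_norm_summable[OF q(2), of 0 "q * p powi N" 1]
    by (intro summable_nonneg_imp_summable_on) auto
  have sB: "(\<lambda>n. norm (\<sigma> powi N) * norm (c n * \<sigma> ^ n)) summable_on UNIV"
    using hq_binomial_norm_summable[OF q(2), of 1 \<sigma> lam] sg
    by (intro summable_on_cmult_right summable_nonneg_imp_summable_on) (auto simp: hpoch_one c_def)
  obtain S1 where S1: "(L has_sum S1) UNIV" "(h has_sum S1) UNIV"
  proof (rule has_sum_interchange[of _ UNIV UNIV f L h])
    show "(\<lambda>(j, n). norm (hpoch 0 1 q j / qpoch q q j * (q * p powi N) ^ j) *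
              (norm (\<sigma> powi N) * norm (c n * \<sigma> ^ n))) summable_on UNIV \<times> UNIV"
      by (rule summable_on_times_prod[OF sA sB]) auto
    fix j n
    have "(\<sigma> * p ^ j) powi (N + int n) = \<sigma> powi N * \<sigma> ^ n * (p powi N) ^ j * (p ^ j) ^ n"
    proof -
      have "(p ^ j) powi N = (p powi N) ^ j"
        by (metis power_int_mult power_int_of_nat mult.commute)
      then show ?thesis
        using x0[of j] by (simp add: power_int_add power_int_mult_distrib power_mult_distrib)
    qed
    then have "f j n = (hpoch 0 1 q j / qpoch q q j * (q * p powi N) ^ j) *
        (\<sigma> powi N * (c n * \<sigma> ^ n)) * ((p ^ j) ^ n * par n)"
      by (simp add: f_def w_def power_mult_distrib)
    moreover have "norm ((p ^ j) ^ n * par n) \<le> 1"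
      using pj[of j] by (simp add: norm_power par_def power_le_one)
    ultimately show "norm (f j n) \<le> (case (j, n) of (j, n) \<Rightarrow>
        norm (hpoch 0 1 q j / qpoch q q j * (q * p powi N) ^ j) *
              (norm (\<sigma> powi N) * norm (c n * \<sigma> ^ n)))"
      by (simp only: norm_mult[of _ "(p ^ j) ^ n * par n"] norm_mult[of "\<sigma> powi N"]
            norm_mult[of "hpoch 0 1 q j / qpoch q q j * (q * p powi N) ^ j"] prod.case)
         (rule mult_left_le, auto)
  qed (use fL fh in auto)

  \<comment> \<open>Right-hand side: expand the remaining factor by Euler's series; the $q$-binomial theorem
      sums over the nodes.\<close>
  define f2 where "f2 j e = qpoch_inf lam q * (hpoch lam q q j / qpoch q q j * (q powi (- N)) ^ j)
        * ((\<sigma>^2 * q ^ (2 * j)) ^ e / qpoch q q e)" for j e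
  define R where "R j = qpoch_inf lam q * (hpoch lam q q j / qpoch q q j * (q powi (- N)) ^ j)
        / qpoch_inf (\<sigma>^2 * q ^ (2 * j)) q" for j
  have s2: "norm (\<sigma>^2) < 1" using sg by (simp add: norm_power power_less_one_iff)
  have q2j: "norm (q ^ (2 * j)) \<le> 1" for j using q by (simp add: norm_power power_le_one)
  have f2R: "((\<lambda>e. f2 j e) has_sum R j) UNIV" for j
  proof -
    have "norm (\<sigma>^2) * norm (q ^ (2 * j)) \<le> norm (\<sigma>^2) * 1"
      using q2j by (intro mult_left_mono) auto
    then have "norm (\<sigma>^2 * q ^ (2 * j)) < 1" unfolding norm_mult using s2 by linarith
    from has_sum_cmult_right[OF euler_recip[OF this],
        of "qpoch_inf lam q * (hpoch lam q q j / qpoch q q j * (q powi (- N)) ^ j)"]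
    show ?thesis by (simp add: f2_def R_def)
  qed
  define h2 where "h2 e = qpoch_inf lam q * (\<sigma>^2) ^ e / qpoch q q e *
       (qpoch_inf (q * q powi (2 * int e - N)) q / qpoch_inf (lam * q powi (2 * int e - N)) q)" for e
  have lame: "norm (lam * q powi (2 * int e - N)) < 1" for e
  proof -
    have "norm lam * norm (q powi (2 * int e - N)) \<le> norm lam * norm (q powi (- N))"
      by (intro mult_left_mono norm_q_powi_antimono) auto
    then show ?thesis using lam unfolding norm_mult by linarith
  qed
  have f2h: "((\<lambda>j. f2 j e) has_sum h2 e) UNIV" for e
  proof -
    have "((\<lambda>j. qpoch_inf lam q * (\<sigma>^2) ^ e / qpoch q q e *
        (hpoch lam q q j / qpoch q q j * (q powi (2 * int e - N)) ^ j)) has_sum h2 e) UNIV"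
      unfolding h2_def by (intro has_sum_cmult_right has_sum_hq_binomial q lame)
    moreover have "qpoch_inf lam q * (\<sigma>^2) ^ e / qpoch q q e *
        (hpoch lam q q j / qpoch q q j * (q powi (2 * int e - N)) ^ j) = f2 j e" for j
    proof -
      have "q powi (2 * int e - N) = q powi (- N) * q ^ (2 * e)"
        using powi_add(2)[of "- N" "int (2 * e)"] by (simp del: power_int_of_nat add: power_int_of_nat[symmetric])
      moreover have "(q ^ (2 * e)) ^ j = (q ^ (2 * j)) ^ e"
        by (simp add: power_mult[symmetric] mult_ac)
      ultimately show ?thesis by (simp add: f2_def power_mult_distrib mult_ac)
    qed
    ultimately show ?thesis by simp
  qed
  have sA2: "(\<lambda>j. norm (qpoch_inf lam q) * norm (hpoch lam q q j / qpoch q q j * (q powi (- N)) ^ j)) summable_on UNIV"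
    using hq_binomial_norm_summable[OF q(2), of lam "q powi (- N)" q] lam
    by (intro summable_on_cmult_right summable_nonneg_imp_summable_on) auto
  have sB2: "(\<lambda>e. norm ((\<sigma>^2) ^ e / qpoch q q e)) summable_on UNIV"
    using hq_binomial_norm_summable[OF q(2), of 1 "\<sigma>^2" 0] s2
    by (intro summable_nonneg_imp_summable_on) (auto simp: hpoch_zero)
  obtain S2 where S2: "(R has_sum S2) UNIV" "(h2 has_sum S2) UNIV"
  proof (rule has_sum_interchange[of _ UNIV UNIV f2 R h2])
    show "(\<lambda>(j, e). norm (qpoch_inf lam q) * norm (hpoch lam q q j / qpoch q q j * (q powi (- N)) ^ j) *
              norm ((\<sigma>^2) ^ e / qpoch q q e)) summable_on UNIV \<times> UNIV"
      by (rule summable_on_times_prod[OF sA2 sB2]) auto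
    fix j e
    define y where "y = qpoch_inf lam q * (hpoch lam q q j / qpoch q q j * (q powi (- N)) ^ j)
          * ((\<sigma>^2) ^ e / qpoch q q e)"
    have "f2 j e = y * (q ^ (2 * j)) ^ e"
      by (simp add: f2_def y_def power_mult_distrib)
    moreover have "norm ((q ^ (2 * j)) ^ e) \<le> 1"
      using q2j[of j] by (simp only: norm_power[of _ e]) (rule power_le_one, auto)
    ultimately have "norm (f2 j e) \<le> norm y"
      by (simp only: norm_mult) (rule mult_left_le, auto)
    then show "norm (f2 j e) \<le> (case (j, e) of (j, e) \<Rightarrow>
        norm (qpoch_inf lam q) * norm (hpoch lam q q j / qpoch q q j * (q powi (- N)) ^ j) *
              norm ((\<sigma>^2) ^ e / qpoch q q e))"
      by (simp only: y_def norm_mult[of _ "(\<sigma>^2) ^ e / qpoch q q e"] norm_mult[of "qpoch_inf lam q"] prod.case)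
  qed (use f2R f2h in auto)

  \<comment> \<open>The two resulting series agree term by term.\<close>
  have "(h has_sum S1) UNIV \<longleftrightarrow> (h has_sum S1) {n. even (N + int n) \<and> N + int n \<ge> 0}"
  proof (rule has_sum_cong_neutral)
    fix n assume "n \<in> UNIV - {n. even (N + int n) \<and> N + int n \<ge> 0}"
    then have neg: "odd (N + int n) \<or> N + int n < 0" by (simp only: Diff_iff mem_Collect_eq not_le de_Morgan_conj UNIV_I simp_thms)
    show "h n = 0"
    proof (cases "odd (N + int n)")
      case False
      then have 2: "even (N + int n)" "N + int n < 0" using neg by blast+
      then obtain e where e: "N + int n = 2 * e" by blast
      have "q * p powi (N + int n) = q powi (1 + e)"
        unfolding e q_powi[symmetric] using powi_add(2)[of 1 e] by simp
      moreover have "e < 0" using 2 e by auto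
      ultimately show ?thesis by (simp add: h_def qpoch_inf_q_powi)
    qed (simp add: h_def par_def)
  qed auto
  also have "\<dots> \<longleftrightarrow> (h2 has_sum S1) {e. 2 * int e \<ge> N}"
  proof (rule has_sum_reindex_bij_witness[of _ "\<lambda>e. nat (2 * int e - N)" "\<lambda>n. nat ((N + int n) div 2)"])
    fix n assume "n \<in> {n. even (N + int n) \<and> N + int n \<ge> 0}"
    then have "even (N + int n)" "N + int n \<ge> 0" by auto
    then obtain e where e: "N + int n = 2 * e" "e \<ge> 0" by (elim evenE) auto
    define m where "m = nat e"
    have m: "N + int n = 2 * int m" "2 * int m - N = int n" using e by (auto simp: m_def)
    have qp: "q * p powi (N + int n) = q powi (1 + int m)"
      unfolding m(1) q_powi[symmetric] using powi_add(2)[of 1 "int m"] by simp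
    have qn: "q * q powi (int n) = q powi (1 + int n)"
      using powi_add(2)[of 1 "int n"] by simp
    have "h n = (\<sigma>^2) ^ m * c n * (qpoch_inf q q / qpoch q q m)"
    proof -
      have "\<sigma> powi (N + int n) = (\<sigma>^2) ^ m" unfolding m(1) by (simp add: power_int_mult)
      moreover have "par n = 1" unfolding par_def m(1) by simp
      ultimately show ?thesis unfolding h_def qp qpoch_inf_q_powi by simp
    qed
    also have "\<dots> = h2 m"
    proof -
      have nz: "qpoch_inf (lam * q ^ n) q \<noteq> 0"
        using qpoch_inf_nonzero[OF q(2) lame[of m]] by (simp add: m(2))
      have "h2 m = qpoch_inf lam q * (\<sigma>^2) ^ m / qpoch q q m *
             ((qpoch_inf q q / qpoch q q n) / qpoch_inf (lam * q ^ n) q)"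
        unfolding h2_def m(2) qn qpoch_inf_q_powi by simp
      then show ?thesis
        using nz qpoch_inf_split[OF q(2), of lam n] by (simp add: c_def mult_ac)
    qed
    finally show "h2 (nat ((N + int n) div 2)) = h n" using m(1) by simp
  next
    fix n assume "n \<in> {n. even (N + int n) \<and> N + int n \<ge> 0}"
    then show "nat (2 * int (nat ((N + int n) div 2)) - N) = n"
      and "nat ((N + int n) div 2) \<in> {e. 2 * int e \<ge> N}" by auto
  next
    fix e assume "e \<in> {e. 2 * int e \<ge> N}"
    then have *: "N + int (nat (2 * int e - N)) = 2 * int e" by simp
    show "nat ((N + int (nat (2 * int e - N))) div 2) = e"
      and "nat (2 * int e - N) \<in> {n. even (N + int n) \<and> N + int n \<ge> 0}" unfolding mem_Collect_eq * by auto
  qed simp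
  also have "\<dots> \<longleftrightarrow> (h2 has_sum S1) UNIV"
  proof (rule has_sum_cong_neutral)
    fix e assume "e \<in> UNIV - {e. 2 * int e \<ge> N}"
    then have "2 * int e - N < 0" by auto
    moreover have "q * q powi (2 * int e - N) = q powi (1 + (2 * int e - N))"
      using powi_add(2)[of 1 "2 * int e - N"] by simp
    ultimately show "h2 e = 0" by (simp add: h2_def qpoch_inf_q_powi)
  qed auto
  finally have "S1 = S2" using S1(2) S2(2) has_sum_unique by blast
  then show ?thesis
    using that[of S1] S1(1) S2(1) unfolding L_def R_def w_def by simp
qed

end

section \<open>A summable majorant\<close>

lemma has_sum_times_prod:
  fixes f :: "'a \<Rightarrow> complex" and g :: "'b \<Rightarrow> complex"
  assumes f: "(f has_sum a) A" and g: "(g has_sum b) B"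
    and nf: "(\<lambda>x. norm (f x)) summable_on A" and ng: "(\<lambda>y. norm (g y)) summable_on B"
  shows "((\<lambda>(x, y). f x * g y) has_sum (a * b)) (A \<times> B)"
proof (rule has_sum_SigmaI)
  show "((\<lambda>y. case (x, y) of (x, y) \<Rightarrow> f x * g y) has_sum f x * b) B" for x
    using g by (auto intro!: has_sum_cmult_right)
  show "((\<lambda>x. f x * b) has_sum a * b) A"
    by (intro has_sum_cmult_left f)
  show "(\<lambda>(x, y). f x * g y) summable_on A \<times> B"
  proof (rule abs_summable_summable)
    have "(\<lambda>(x, y). norm (f x) * norm (g y)) summable_on A \<times> B"
      by (rule summable_on_times_prod[OF nf ng]) auto
    then show "(\<lambda>z. norm (case z of (x, y) \<Rightarrow> f x * g y)) summable_on A \<times> B"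
      by (simp add: norm_mult case_prod_unfold)
  qed
qed

lemma has_sum_antidiagonal:
  fixes f :: "nat \<times> nat \<Rightarrow> complex"
  assumes "(f has_sum S) (UNIV \<times> UNIV)"
  shows "((\<lambda>k. \<Sum>j\<le>k. f (k - j, j)) has_sum S) UNIV"
proof -
  have "(f has_sum S) (UNIV \<times> UNIV) \<longleftrightarrow> ((\<lambda>(k, j). f (k - j, j)) has_sum S) (SIGMA k:UNIV. {..k})"
    by (rule has_sum_reindex_bij_witness[of _ "\<lambda>(k, j). (k - j, j)" "\<lambda>(i, j). (i + j, j)"]) auto
  with assms have "((\<lambda>(k, j). f (k - j, j)) has_sum S) (SIGMA k:UNIV. {..k})" by blast
  then show ?thesis
    by (rule has_sum_SigmaD) (auto intro!: has_sum_finiteI)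
qed

lemma pth_shift_up:
  assumes "0 < r" "r < 1" "x > 0"
  shows "pth r (x * r^2) = pth r x / x"
  using pth_shift[OF assms(1,2), of "x * r^2"] assms by (simp add: field_simps)

text \<open>The sum over $N$ of the function \<open>majorant\<close> below, evaluated by the theta series. In this form the
dependence on $(i,j)$ is quasi-periodic.\<close>

definition majorant_NS :: "real \<Rightarrow> real \<Rightarrow> real \<Rightarrow> real \<Rightarrow> real \<Rightarrow> nat \<times> nat \<Rightarrow> real" where
  "majorant_NS r k1 k2 L A = (\<lambda>(i, j).
     pth r (A * r ^ j / r ^ i) * (L ^ i * r powi ((int i)^2 - int i)) * (r powi ((int j)^2 + int j))
       * (1 + r ^ (2 * i) / r ^ (2 * j)) * pth r (k1 / r ^ (i + j)) * pth r (k2 / r ^ (i + j)))"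

text \<open>With $r = |p|$, $k_l = |\kappa_l/\alpha|$, $L = |\lambda|$ and $A = |\alpha|$ this bounds, up to a constant, the
contribution of the pair $(i,j)$ to the $N$-th Laurent coefficient: the two theta series bound
$(\kappa_1/s,\kappa_2/s;q)_\infty$ at a node of modulus $Ar^{i+j}$.\<close>

definition majorant :: "real \<Rightarrow> real \<Rightarrow> real \<Rightarrow> real \<Rightarrow> real \<Rightarrow> int \<Rightarrow> nat \<times> nat \<Rightarrow> real" where
  "majorant r k1 k2 L A N = (\<lambda>(i, j).
     r powi (N^2 - N) * (L ^ i * r powi ((int i)^2 - int i - 2 * N * int i)) * (r powi ((int j)^2 + int j))
       * (1 + r ^ (2 * i) / r ^ (2 * j)) * (A * r ^ (i + j)) powi N
       * pth r (k1 / r ^ (i + j)) * pth r (k2 / r ^ (i + j)))"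

context
  fixes r k1 k2 L A :: real
  assumes r: "0 < r" "r < 1" and pos: "k1 > 0" "k2 > 0" "L > 0" "A > 0"
begin

lemma r_powi_int_diff: "r powi (m + n) = r powi m * r powi n"
  using r by (simp add: power_int_add)

lemma majorant_NS_nonneg: "majorant_NS r k1 k2 L A z \<ge> 0"
  using r pos unfolding majorant_NS_def
  by (auto simp: case_prod_unfold intro!: mult_nonneg_nonneg add_nonneg_nonneg divide_nonneg_nonneg pth_nonneg)

lemma majorant_nonneg: "majorant r k1 k2 L A N z \<ge> 0"
  using r pos unfolding majorant_def
  by (auto simp: case_prod_unfold intro!: mult_nonneg_nonneg add_nonneg_nonneg divide_nonneg_nonneg pth_nonneg)

text \<open>Moving diagonally costs only a constant factor: the Gaussian gain in $i$ and $j$ exactly balances the growth of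
the two theta series. This borderline balance is the reason for the hypothesis on $k_1k_2L$ in the summability
theorem.\<close>

lemma majorant_NS_diag:
  "majorant_NS r k1 k2 L A (Suc i, Suc j) = k1 * k2 * L / r^2 * majorant_NS r k1 k2 L A (i, j)"
proof -
  have e1: "r powi ((int (Suc i))^2 - int (Suc i)) = r powi ((int i)^2 - int i) * r ^ (2 * i)"
  proof -
    have "(int (Suc i))^2 - int (Suc i) = ((int i)^2 - int i) + int (2 * i)"
      by (simp add: power2_eq_square algebra_simps)
    then show ?thesis by (simp only: r_powi_int_diff[of _ "int (2 * i)"] power_int_of_nat)
  qed
  have e2: "r powi ((int (Suc j))^2 + int (Suc j)) = r powi ((int j)^2 + int j) * r ^ (2 * j + 2)"
  proof -
    have "(int (Suc j))^2 + int (Suc j) = ((int j)^2 + int j) + int (2 * j + 2)"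
      by (simp add: power2_eq_square algebra_simps)
    then show ?thesis by (simp only: r_powi_int_diff[of _ "int (2 * j + 2)"] power_int_of_nat)
  qed
  have sh: "pth r (k / r ^ (Suc i + Suc j)) = k / r ^ (i + j) / r^2 * pth r (k / r ^ (i + j))" if "k > 0" for k
    using pth_shift[OF r, of "k / r ^ (i + j)"] r that by (simp add: power2_eq_square mult_ac)
  have a: "A * r ^ Suc j / r ^ Suc i = A * r ^ j / r ^ i"
          "r ^ (2 * Suc i) / r ^ (2 * Suc j) = r ^ (2 * i) / r ^ (2 * j)"
    using r by simp_all
  have "r ^ (2 * i) * r ^ (2 * j + 2) = r^2 * (r ^ (i + j) * r ^ (i + j))"
    by (simp only: power_add[symmetric]) (rule arg_cong[of _ _ "\<lambda>e. r ^ e"], simp)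
  moreover have "u * (v * v) / (v * v * (u * u)) = 1 / u" if "u \<noteq> 0" "v \<noteq> 0" for u v :: real
    using that by simp
  from this[of "r^2" "r ^ (i + j)"]
  have "r^2 * (r ^ (i + j) * r ^ (i + j)) / (r ^ (i + j) * r ^ (i + j) * (r^2 * r^2)) = 1 / r^2"
    using r by simp
  ultimately have pw: "r ^ (2 * i) * r ^ (2 * j + 2) / (r ^ (i + j) * r ^ (i + j) * (r^2 * r^2)) = 1 / r^2"
    by (simp only:)
  have "majorant_NS r k1 k2 L A (Suc i, Suc j) = k1 * k2 * L *
      (r ^ (2 * i) * r ^ (2 * j + 2) / (r ^ (i + j) * r ^ (i + j) * (r^2 * r^2))) * majorant_NS r k1 k2 L A (i, j)"
    unfolding majorant_NS_def prod.case e1 e2 sh[OF pos(1)] sh[OF pos(2)] a by (simp add: mult_ac)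
  then show ?thesis unfolding pw by simp
qed

lemma majorant_NS_diag_iter:
  "majorant_NS r k1 k2 L A (m + i, m + j) = (k1 * k2 * L / r^2) ^ m * majorant_NS r k1 k2 L A (i, j)"
  by (induction m) (simp_all add: majorant_NS_diag)

text \<open>Away from the diagonal the decay is Gaussian, so along the two boundary rows the two-step ratio test applies.\<close>

lemma majorant_NS_left: "(\<lambda>d. majorant_NS r k1 k2 L A (d, 0)) summable_on UNIV"
proof (rule summable_on_gap2[OF _ less_imp_le[OF r(1)] r(2)])
  fix d :: nat
  show "0 \<le> majorant_NS r k1 k2 L A (d, 0)" by (rule majorant_NS_nonneg)
  have e: "r powi ((int (d + 2))^2 - int (d + 2)) = r powi ((int d)^2 - int d) * r ^ (4 * d + 2)"
  proof -
    have "(int (d + 2))^2 - int (d + 2) = ((int d)^2 - int d) + int (4 * d + 2)"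
      by (simp add: power2_eq_square algebra_simps)
    then show ?thesis by (simp only: r_powi_int_diff[of _ "int (4 * d + 2)"] power_int_of_nat)
  qed
  have sh: "pth r (k / r ^ (d + 2)) = k / r ^ d / r^2 * pth r (k / r ^ d)" if "k > 0" for k
    using pth_shift[OF r, of "k / r ^ d"] r that unfolding power_add by simp
  have "r ^ (2 * (d + 2)) \<le> r ^ (2 * d)" using r by (intro power_decreasing) auto
  then have le: "1 + r ^ (2 * (d + 2)) \<le> 1 + r ^ (2 * d)" by simp
  define W where "W = L ^ d * r powi ((int d)^2 - int d) * pth r (A / r ^ d) * pth r (k1 / r ^ d) * pth r (k2 / r ^ d)"
  have W: "W \<ge> 0" unfolding W_def using r pos by (auto intro!: mult_nonneg_nonneg pth_nonneg)
  define C where "C = A * k1 * k2 * L^2 / (r^2 * r^2 * r^2)"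
  define B where "B = 1 + r ^ (2 * (d + 2))"
  have "majorant_NS r k1 k2 L A (d + 2, 0)
     = pth r (A / r ^ (d + 2)) * (L ^ d * L^2 * (r powi ((int d)^2 - int d) * r ^ (4 * d + 2)))
         * B * pth r (k1 / r ^ (d + 2)) * pth r (k2 / r ^ (d + 2))"
    unfolding majorant_NS_def prod.case e power_add[of L]
    by (simp add: B_def)
  also have "\<dots> = C * (r ^ (4 * d + 2) / (r ^ d * r ^ d * r ^ d)) * W * B"
    unfolding sh[OF pos(1)] sh[OF pos(2)] sh[OF pos(4)] by (simp add: W_def C_def mult_ac)
  also have "r ^ (4 * d + 2) = r^2 * r ^ d * (r ^ d * r ^ d * r ^ d)"
    by (simp only: power_add[symmetric]) (rule arg_cong[of _ _ "\<lambda>e. r ^ e"], simp)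
  also have "r^2 * r ^ d * (r ^ d * r ^ d * r ^ d) / (r ^ d * r ^ d * r ^ d) = r^2 * r ^ d"
    using r by simp
  also have "C * (r^2 * r ^ d) * W * B \<le> C * (r^2 * r ^ d) * W * (1 + r ^ (2 * d))"
    unfolding B_def C_def using r pos W by (intro mult_left_mono le) auto
  also have "\<dots> = (C * r^2) * r ^ d * majorant_NS r k1 k2 L A (d, 0)"
    by (simp add: majorant_NS_def W_def mult_ac)
  finally show "majorant_NS r k1 k2 L A (d + 2, 0)
     \<le> (C * r^2) * r ^ d * majorant_NS r k1 k2 L A (d, 0)" .
qed

lemma majorant_NS_right: "(\<lambda>d. majorant_NS r k1 k2 L A (0, d)) summable_on UNIV"
proof (rule summable_on_gap2[OF _ less_imp_le[OF r(1)] r(2)])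
  fix d :: nat
  show "0 \<le> majorant_NS r k1 k2 L A (0, d)" by (rule majorant_NS_nonneg)
  have e: "r powi ((int (d + 2))^2 + int (d + 2)) = r powi ((int d)^2 + int d) * r ^ (4 * d + 6)"
  proof -
    have "(int (d + 2))^2 + int (d + 2) = ((int d)^2 + int d) + int (4 * d + 6)"
      by (simp add: power2_eq_square algebra_simps)
    then show ?thesis by (simp only: r_powi_int_diff[of _ "int (4 * d + 6)"] power_int_of_nat)
  qed
  have sh: "pth r (k / r ^ (d + 2)) = k / r ^ d / r^2 * pth r (k / r ^ d)" if "k > 0" for k
    using pth_shift[OF r, of "k / r ^ d"] r that unfolding power_add by simp
  have shA: "pth r (A * r ^ (d + 2)) = pth r (A * r ^ d) / (A * r ^ d)"
    using pth_shift_up[OF r, of "A * r ^ d"] r pos unfolding power_add by (simp add: mult.assoc)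
  have le: "1 + 1 / r ^ (2 * (d + 2)) \<le> (1 / r^4) * (1 + 1 / r ^ (2 * d))"
  proof -
    have "r^4 \<le> 1" using r by (simp add: power_le_one)
    then have "1 \<le> 1 / r^4" using r by simp
    moreover have "r ^ (2 * (d + 2)) = r^4 * r ^ (2 * d)"
      by (simp only: power_add[symmetric]) (rule arg_cong[of _ _ "\<lambda>e. r ^ e"], simp)
    ultimately show ?thesis by (simp only: distrib_left times_divide_times_eq mult_1 mult_1_right)
  qed
  define W where "W = r powi ((int d)^2 + int d) * pth r (A * r ^ d) * pth r (k1 / r ^ d) * pth r (k2 / r ^ d)"
  have W: "W \<ge> 0" unfolding W_def using r pos by (auto intro!: mult_nonneg_nonneg pth_nonneg)
  define C where "C = k1 * k2 / A / (r^2 * r^2)"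
  define B where "B = 1 + 1 / r ^ (2 * (d + 2))"
  have "majorant_NS r k1 k2 L A (0, d + 2)
     = pth r (A * r ^ (d + 2)) * (r powi ((int d)^2 + int d) * r ^ (4 * d + 6))
         * B * pth r (k1 / r ^ (d + 2)) * pth r (k2 / r ^ (d + 2))"
    unfolding majorant_NS_def prod.case e
    by (simp add: B_def)
  also have "\<dots> = C * (r ^ (4 * d + 6) / (r ^ d * r ^ d * r ^ d)) * W * B"
    unfolding sh[OF pos(1)] sh[OF pos(2)] shA by (simp add: W_def C_def mult_ac)
  also have "r ^ (4 * d + 6) = r^6 * r ^ d * (r ^ d * r ^ d * r ^ d)"
    by (simp only: power_add[symmetric]) (rule arg_cong[of _ _ "\<lambda>e. r ^ e"], simp)
  also have "r^6 * r ^ d * (r ^ d * r ^ d * r ^ d) / (r ^ d * r ^ d * r ^ d) = r^6 * r ^ d"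
    using r by simp
  also have "C * (r^6 * r ^ d) * W * B \<le> C * (r^6 * r ^ d) * W * ((1 / r^4) * (1 + 1 / r ^ (2 * d)))"
    unfolding B_def C_def using r pos W by (intro mult_left_mono le) auto
  also have "\<dots> = (C * r^6 / r^4) * r ^ d * majorant_NS r k1 k2 L A (0, d)"
    by (simp add: majorant_NS_def W_def mult_ac)
  finally show "majorant_NS r k1 k2 L A (0, d + 2)
     \<le> (C * r^6 / r^4) * r ^ d * majorant_NS r k1 k2 L A (0, d)" .
qed

lemma majorant_NS_summable:
  assumes "k1 * k2 * L < r^2"
  shows "majorant_NS r k1 k2 L A summable_on UNIV"
proof -
  define c where "c = k1 * k2 * L / r^2"
  have c: "0 \<le> c" "c < 1" using assms r pos by (auto simp: c_def field_simps)
  have gc: "(\<lambda>m. c ^ m) summable_on UNIV"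
    using c by (intro summable_nonneg_imp_summable_on summable_geometric) auto
  have s1: "(\<lambda>(m, d). c ^ m * majorant_NS r k1 k2 L A (d, 0)) summable_on UNIV \<times> UNIV"
    by (rule summable_on_times_prod[OF gc majorant_NS_left]) (use c majorant_NS_nonneg in auto)
  have s2: "(\<lambda>(m, d). c ^ m * majorant_NS r k1 k2 L A (0, d)) summable_on UNIV \<times> UNIV"
    by (rule summable_on_times_prod[OF gc majorant_NS_right]) (use c majorant_NS_nonneg in auto)
  have "(\<lambda>(m, d). c ^ m * majorant_NS r k1 k2 L A (d, 0)) summable_on UNIV \<times> UNIV \<longleftrightarrow>
     majorant_NS r k1 k2 L A summable_on {(i, j). j \<le> i}"
  proof (rule summable_on_reindex_bij_witness[of _ "\<lambda>(i, j). (j, i - j)" "\<lambda>(m, d). (m + d, m)"])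
    fix z :: "nat \<times> nat"
    show "majorant_NS r k1 k2 L A (case z of (m, d) \<Rightarrow> (m + d, m)) =
          (case z of (m, d) \<Rightarrow> c ^ m * majorant_NS r k1 k2 L A (d, 0))"
      using majorant_NS_diag_iter[of "fst z" "snd z" 0] by (simp add: case_prod_unfold c_def)
  qed auto
  moreover have "(\<lambda>(m, d). c ^ m * majorant_NS r k1 k2 L A (0, d)) summable_on UNIV \<times> UNIV \<longleftrightarrow>
     majorant_NS r k1 k2 L A summable_on {(i, j). i \<le> j}"
  proof (rule summable_on_reindex_bij_witness[of _ "\<lambda>(i, j). (i, j - i)" "\<lambda>(m, d). (m, m + d)"])
    fix z :: "nat \<times> nat"
    show "majorant_NS r k1 k2 L A (case z of (m, d) \<Rightarrow> (m, m + d)) =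
          (case z of (m, d) \<Rightarrow> c ^ m * majorant_NS r k1 k2 L A (0, d))"
      using majorant_NS_diag_iter[of "fst z" 0 "snd z"] by (simp add: case_prod_unfold c_def)
  qed auto
  ultimately have "majorant_NS r k1 k2 L A summable_on ({(i, j). j \<le> i} \<union> {(i, j). i \<le> j})"
    using s1 s2 by (intro summable_on_union) auto
  also have "{(i, j). j \<le> i} \<union> {(i, j). i \<le> j} = (UNIV :: (nat \<times> nat) set)" by auto
  finally show ?thesis .
qed

lemma majorant_has_sum:
  "((\<lambda>N. majorant r k1 k2 L A N z) has_sum majorant_NS r k1 k2 L A z) UNIV"
proof -
  obtain i j where z: "z = (i, j)" by (cases z)
  let ?c = "L ^ i * r powi ((int i)^2 - int i) * (r powi ((int j)^2 + int j))
       * (1 + r ^ (2 * i) / r ^ (2 * j)) * pth r (k1 / r ^ (i + j)) * pth r (k2 / r ^ (i + j))"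
  have x: "A * r ^ j / r ^ i > 0" using pos r by simp
  have "((\<lambda>N. ?c * (r powi (N^2 - N) * (A * r ^ j / r ^ i) powi N)) has_sum (?c * pth r (A * r ^ j / r ^ i))) UNIV"
    unfolding pth_def by (intro has_sum_cmult_right has_sum_infsum summable_pth r x)
  moreover have "?c * (r powi (N^2 - N) * (A * r ^ j / r ^ i) powi N) = majorant r k1 k2 L A N z" for N
  proof -
    have "r powi ((int i)^2 - int i - 2 * N * int i) = r powi ((int i)^2 - int i) * r powi (- (2 * N * int i))"
      using r_powi_int_diff[of "(int i)^2 - int i" "- (2 * N * int i)"] by simp
    moreover have "(A * r ^ (i + j)) powi N = (A * r ^ j / r ^ i) powi N * r powi (2 * N * int i)"
    proof -
      have "r powi (2 * N * int i) = (r ^ (2 * i)) powi N"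
      proof -
        have "2 * N * int i = int (2 * i) * N" by simp
        then show ?thesis by (simp only: power_int_mult power_int_of_nat)
      qed
      then have "(A * r ^ j / r ^ i) powi N * r powi (2 * N * int i) = (A * r ^ j / r ^ i * r ^ (2 * i)) powi N"
        by (simp only: power_int_mult_distrib)
      also have "A * r ^ j / r ^ i * r ^ (2 * i) = A * r ^ (i + j)"
        using r by (simp add: power_add mult_2)
      finally show ?thesis by simp
    qed
    moreover have "r powi (- (2 * N * int i)) * r powi (2 * N * int i) = 1"
      using r by (simp add: power_int_minus)
    ultimately show ?thesis unfolding majorant_def z prod.case by (simp add: mult_ac)
  qed
  moreover have "?c * pth r (A * r ^ j / r ^ i) = majorant_NS r k1 k2 L A z"
    by (simp add: majorant_NS_def z mult_ac)
  ultimately show ?thesis by simp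
qed

text \<open>Every pair is a diagonal translate of a boundary pair, so the double sum is a geometric series times two boundary
sums.\<close>

theorem majorant_summable:
  assumes "k1 * k2 * L < r^2"
  shows "(\<lambda>(z, N). majorant r k1 k2 L A N z) summable_on UNIV \<times> UNIV"
proof (rule summable_on_SigmaI)
  show "((\<lambda>N. case (z, N) of (z, N) \<Rightarrow> majorant r k1 k2 L A N z) has_sum majorant_NS r k1 k2 L A z) UNIV" for z
    using majorant_has_sum by simp
qed (use majorant_NS_summable[OF assms] majorant_nonneg in auto)

corollary majorant_summable_fixed:
  assumes "k1 * k2 * L < r^2"
  shows "majorant r k1 k2 L A N summable_on UNIV"
proof -
  have "(\<lambda>(N, z). majorant r k1 k2 L A N z) summable_on UNIV \<times> UNIV"
    using majorant_summable[OF assms]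
      summable_on_swap[of "\<lambda>(z, N). majorant r k1 k2 L A N z" UNIV UNIV]
    by (simp add: case_prod_unfold)
  from summable_on_SigmaD1[OF this, of N] show ?thesis by simp
qed

end

section \<open>Bounds for the contribution of a node\<close>

lemma sum_signs: "(\<Sum>\<epsilon>\<in>{1, -1 :: complex}. f \<epsilon>) = f 1 + f (-1)"
  by simp

lemma bounded_on_disc:
  assumes "continuous_on (cball 0 r) (f :: complex \<Rightarrow> complex)"
  obtains D where "D > 0" "\<And>x. norm x \<le> r \<Longrightarrow> norm (f x) \<le> D"
proof -
  have "bounded (f ` cball 0 r)"
    by (intro compact_imp_bounded compact_continuous_image assms compact_cball)
  then obtain D where D: "D > 0" "\<forall>y\<in>f ` cball 0 r. norm y \<le> D"
    unfolding bounded_pos by auto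
  show ?thesis by (rule that[of D]) (use D in auto)
qed

lemma qpoch_inf_bounded_on_disc:
  assumes "norm q < 1"
  obtains D where "D > 0" "\<And>x. norm x \<le> r \<Longrightarrow> norm (qpoch_inf x q) \<le> D"
  using bounded_on_disc[OF holomorphic_on_imp_continuous_on[OF holomorphic_qpoch_inf[OF assms]]]
  by metis

lemma qpoch_inf_recip_bounded_on_disc:
  assumes "norm q < 1" "r < 1"
  obtains D where "D > 0" "\<And>x. norm x \<le> r \<Longrightarrow> norm (1 / qpoch_inf x q) \<le> D"
proof -
  have "continuous_on (cball 0 r) (\<lambda>x. 1 / qpoch_inf x q)"
    using assms qpoch_inf_nonzero[OF assms(1)]
    by (intro continuous_intros holomorphic_on_imp_continuous_on[OF holomorphic_qpoch_inf]) auto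
  from bounded_on_disc[OF this] show ?thesis using that by metis
qed

context nome
begin

abbreviation rho :: real where "rho \<equiv> norm p"

lemma rho: "0 < rho" "rho < 1"
  using p by auto

text \<open>The coefficients $(-1)^nq^{n(n-1)/2}/(q;q)_n$ of Euler's series for $(x;q)_\infty$.\<close>

definition eul :: "nat \<Rightarrow> complex" where
  "eul n = hpoch 0 1 q n / qpoch q q n"

lemma has_sum_eul: "((\<lambda>n. eul n * x ^ n) has_sum qpoch_inf x q) UNIV"
  unfolding eul_def by (rule euler)

lemma summable_norm_eul: "(\<lambda>n. norm (eul n * x ^ n)) summable_on UNIV"
  using hq_binomial_norm_summable[OF q(2), of 0 x 1]
  by (intro summable_nonneg_imp_summable_on) (auto simp: eul_def)

lemma eul_bound_exists: "\<exists>C>0. \<forall>n. norm (eul n) \<le> C * rho powi ((int n)^2 - int n)"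
proof -
  have "(\<lambda>n. 1 / qpoch q q n) \<longlonglongrightarrow> 1 / qpoch_inf q q"
    by (intro tendsto_intros qpoch_LIMSEQ q qpoch_qq_nonzero)
  then have "Bseq (\<lambda>n. 1 / qpoch q q n)" by (intro convergent_imp_Bseq convergentI)
  then obtain C where C: "C > 0" "\<And>n. norm (1 / qpoch q q n) \<le> C"
    by (auto simp: Bseq_def)
  have "norm (eul n) \<le> C * rho powi ((int n)^2 - int n)" for n
  proof -
    have "eul n = (1 / qpoch q q n) * ((-1) ^ n * p powi ((int n)^2 - int n))"
      by (simp add: eul_def hpoch_0_1)
    then have "norm (eul n) = norm (1 / qpoch q q n) * rho powi ((int n)^2 - int n)"
      by (simp only: norm_mult norm_power_int norm_power) simp
    also have "\<dots> \<le> C * rho powi ((int n)^2 - int n)"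
      by (intro mult_right_mono C) auto
    finally show ?thesis .
  qed
  with C show ?thesis by blast
qed

definition eul_const :: real where
  "eul_const = (SOME C. C > 0 \<and> (\<forall>n. norm (eul n) \<le> C * rho powi ((int n)^2 - int n)))"

lemma eul_const: "eul_const > 0" "norm (eul n) \<le> eul_const * rho powi ((int n)^2 - int n)"
  using someI_ex[OF eul_bound_exists] unfolding eul_const_def by blast+

lemma infsum_norm_eul_le:
  assumes x: "x \<noteq> 0"
  shows "(\<Sum>\<^sub>\<infinity>n. norm (eul n * x ^ n)) \<le> eul_const * pth rho (norm x)"
proof -
  let ?t = "\<lambda>N::int. rho powi (N^2 - N) * norm x powi N"
  have sm: "?t summable_on UNIV" using summable_pth[OF rho, of "norm x"] x by simp
  then have sm0: "?t summable_on {0..}" by (rule summable_on_subset) auto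
  have eq: "((\<lambda>n. ?t (int n)) has_sum infsum ?t {0..}) UNIV"
  proof -
    have "((\<lambda>n. ?t (int n)) has_sum infsum ?t {0..}) UNIV \<longleftrightarrow> (?t has_sum infsum ?t {0..}) {0..}"
      by (rule has_sum_reindex_bij_witness[of _ nat int]) auto
    then show ?thesis using sm0 by simp
  qed
  have "(\<Sum>\<^sub>\<infinity>n. norm (eul n * x ^ n)) \<le> (\<Sum>\<^sub>\<infinity>n. eul_const * ?t (int n))"
  proof (rule infsum_mono)
    show "(\<lambda>n. eul_const * ?t (int n)) summable_on UNIV"
      using eq by (intro summable_on_cmult_right) (auto simp: summable_on_def)
    show "norm (eul n * x ^ n) \<le> eul_const * ?t (int n)" for n
      using mult_right_mono[OF eul_const(2)[of n], of "norm x ^ n"] by (simp add: norm_mult norm_power)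
  qed (rule summable_norm_eul)
  also have "\<dots> = eul_const * infsum ?t {0..}"
    using has_sum_cmult_right[OF eq, of eul_const] by (simp add: infsumI)
  also have "\<dots> \<le> eul_const * pth rho (norm x)"
    unfolding pth_def
    by (intro mult_left_mono infsum_mono2 sm sm0) (use eul_const(1) in \<open>auto simp: less_imp_le\<close>)
  finally show ?thesis .
qed

lemma norm_qpoch_inf_le:
  assumes "x \<noteq> 0"
  shows "norm (qpoch_inf x q) \<le> eul_const * pth rho (norm x)"
proof -
  have "norm (qpoch_inf x q) \<le> (\<Sum>\<^sub>\<infinity>n. norm (eul n * x ^ n))"
    using norm_infsum_bound[OF summable_norm_eul[of x]] infsumI[OF has_sum_eul[of x]] by simp
  also have "\<dots> \<le> eul_const * pth rho (norm x)" by (rule infsum_norm_eul_le[OF assms])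
  finally show ?thesis .
qed

lemma norm_eul_q_le: "norm (eul j * q ^ j) \<le> eul_const * rho powi ((int j)^2 + int j)"
proof -
  have "norm (eul j * q ^ j) \<le> eul_const * rho powi ((int j)^2 - int j) * rho ^ (2 * j)"
    using eul_const(2)[of j] by (simp add: norm_mult q_pow(1) norm_power mult_right_mono)
  also have "rho ^ (2 * j) = rho powi (2 * int j)"
    by (metis power_int_of_nat of_nat_mult of_nat_numeral)
  also have "eul_const * rho powi ((int j)^2 - int j) * rho powi (2 * int j)
     = eul_const * rho powi (((int j)^2 - int j) + 2 * int j)"
    using rho by (subst power_int_add) auto
  also have "((int j)^2 - int j) + 2 * int j = (int j)^2 + int j" by simp
  finally show ?thesis .
qed

lemma norm_one_minus_le: "norm (1 - q ^ i / q ^ j) \<le> 1 + rho ^ (2 * i) / rho ^ (2 * j)"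
  using norm_triangle_ineq4[of 1 "q ^ i / q ^ j"]
  by (simp add: norm_divide norm_power q_pow(1))

text \<open>The part of the contribution of $(i,j)$ at the node $s$ that is superposed from powers of $s$; the remaining
factor is \<open>ratio\<close>. The factor $1 - q^{i-j}$ removes the diagonal, in particular the pair $(0,0)$, whose
nodes $\pm\alpha$ would be poles that the factor $(q\alpha^2;q)_\infty$ cannot cancel.\<close>

definition nd :: "complex \<Rightarrow> complex \<Rightarrow> int \<Rightarrow> nat \<Rightarrow> nat \<Rightarrow> complex \<Rightarrow> complex" where
  "nd \<kappa>1 \<kappa>2 N i j s = (1 - q ^ i / q ^ j) * s powi N * qpoch_inf (\<kappa>1 / s) q * qpoch_inf (\<kappa>2 / s) q"

definition ratio :: "complex \<Rightarrow> complex \<Rightarrow> complex" where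
  "ratio lam s = qpoch_inf (lam * s) q / qpoch_inf s q"

text \<open>The parameter relation makes the left-hand side equal to $|p|^4$.\<close>

lemma majorant_condition:
  assumes "\<alpha> \<noteq> 0" "\<kappa>1 * \<kappa>2 * lam = q^2 * \<alpha>^2"
  shows "norm \<kappa>1 / norm \<alpha> * (norm \<kappa>2 / norm \<alpha>) * norm lam < rho^2"
proof -
  have "norm \<kappa>1 * norm \<kappa>2 * norm lam = rho^4 * norm \<alpha>^2"
    using arg_cong[OF assms(2), of norm] by (simp add: norm_mult norm_power q_eq)
  then have "norm \<kappa>1 / norm \<alpha> * (norm \<kappa>2 / norm \<alpha>) * norm lam = rho^4"
    using assms(1) by (simp add: power2_eq_square field_simps)
  also have "\<dots> < rho^2" using rho by (intro power_strict_decreasing) auto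
  finally show ?thesis .
qed

lemma norm_node: "\<epsilon> \<in> {1, -1} \<Longrightarrow> norm (\<epsilon> * (\<alpha> * p ^ n)) = norm \<alpha> * rho ^ n" for \<epsilon> :: complex
  by (auto simp: norm_mult norm_power)

lemma norm_coeff_le:
  "norm (lam ^ i * eul i * (q powi (- N)) ^ i) \<le>
     eul_const * (norm lam ^ i * rho powi ((int i)^2 - int i - 2 * N * int i))"
proof -
  have "norm ((q powi (- N)) ^ i) = rho powi (- (2 * N * int i))"
  proof -
    have "(q powi (- N)) ^ i = p powi (2 * (- N) * int i)"
      unfolding q_powi by (simp only: power_int_mult power_int_of_nat)
    then show ?thesis by (simp add: norm_power_int)
  qed
  then have "norm (lam ^ i * eul i * (q powi (- N)) ^ i) = norm lam ^ i * norm (eul i) * rho powi (- (2 * N * int i))"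
    by (simp only: norm_mult norm_power)
  also have "\<dots> \<le> norm lam ^ i * (eul_const * rho powi ((int i)^2 - int i)) * rho powi (- (2 * N * int i))"
    by (intro mult_right_mono mult_left_mono eul_const) auto
  also have "rho powi ((int i)^2 - int i - 2 * N * int i) = rho powi ((int i)^2 - int i) * rho powi (- (2 * N * int i))"
    using power_int_add[of rho "(int i)^2 - int i" "- (2 * N * int i)"] rho by simp
  ultimately show ?thesis by (simp add: mult_ac)
qed

section \<open>The coefficient identity in a small domain\<close>

text \<open>At a node, $s^2 = \alpha^2q^{i+j}$, hence $q^{i-j} = \alpha^2q^{2i}/s^2$. The factor $1 - q^{i-j}$ therefore
combines the moments of order $N - r$ and $N - r - 2$, and on the right it becomes the very-well-poised factor.\<close>

lemma moment_identity':
  fixes N :: int and r i :: nat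
  assumes al: "\<alpha> \<noteq> 0" "norm \<alpha> < 1" and lam: "norm (lam * q powi (- N)) < 1"
  obtains S where
    "((\<lambda>j. eul j * q ^ j * (1/2) * (\<Sum>\<epsilon>\<in>{1,-1}. (1 - q ^ i / q ^ j) *
        (\<epsilon> * (\<alpha> * p ^ (i + j))) powi (N - int r) * ratio lam (\<epsilon> * (\<alpha> * p ^ (i + j))))) has_sum S) UNIV"
    "((\<lambda>j. qpoch_inf lam q * (hpoch lam q q j / qpoch q q j * (q powi (- N)) ^ j)
        / qpoch_inf (\<alpha>^2 * q ^ i * q ^ (2 * j)) q * (1 - \<alpha>^2 * q ^ (2 * i) * q ^ (2 * j)) * (q ^ j) ^ r) has_sum S) UNIV"
proof -
  define \<sigma> where "\<sigma> = \<alpha> * p ^ i"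
  have "norm \<alpha> * norm (p ^ i) \<le> norm \<alpha> * 1"
    using p by (intro mult_left_mono) (auto simp: norm_power power_le_one)
  then have sg: "norm \<sigma> < 1"
    unfolding \<sigma>_def norm_mult using al by linarith
  moreover have "\<sigma> \<noteq> 0" using al p by (simp add: \<sigma>_def)
  ultimately have sg: "\<sigma> \<noteq> 0" "norm \<sigma> < 1" by auto
  have sg2: "\<sigma>^2 = \<alpha>^2 * q ^ i" by (simp add: \<sigma>_def power_mult_distrib q_pow(1) flip: power_mult) (simp add: mult.commute)
  have lam': "norm (lam * q powi (- (N - int m))) < 1" for m
  proof -
    have "norm lam * norm (q powi (- (N - int m))) \<le> norm lam * norm (q powi (- N))"
      by (intro mult_left_mono norm_q_powi_antimono) auto
    then show ?thesis using lam unfolding norm_mult by linarith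
  qed
  obtain S1 where S1:
    "((\<lambda>j. hpoch 0 1 q j / qpoch q q j * q ^ j * (1/2) *
        (\<Sum>\<epsilon>\<in>{1,-1}. (\<epsilon> * \<sigma> * p ^ j) powi (N - int r) *
           (qpoch_inf (lam * (\<epsilon> * \<sigma> * p ^ j)) q / qpoch_inf (\<epsilon> * \<sigma> * p ^ j) q))) has_sum S1) UNIV"
    "((\<lambda>j. qpoch_inf lam q * (hpoch lam q q j / qpoch q q j * (q powi (- (N - int r))) ^ j)
        / qpoch_inf (\<sigma>^2 * q ^ (2 * j)) q) has_sum S1) UNIV"
    by (rule moment_identity[OF sg lam'[of r]])
  obtain S2 where S2:
    "((\<lambda>j. hpoch 0 1 q j / qpoch q q j * q ^ j * (1/2) *
        (\<Sum>\<epsilon>\<in>{1,-1}. (\<epsilon> * \<sigma> * p ^ j) powi (N - int (r + 2)) *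
           (qpoch_inf (lam * (\<epsilon> * \<sigma> * p ^ j)) q / qpoch_inf (\<epsilon> * \<sigma> * p ^ j) q))) has_sum S2) UNIV"
    "((\<lambda>j. qpoch_inf lam q * (hpoch lam q q j / qpoch q q j * (q powi (- (N - int (r + 2)))) ^ j)
        / qpoch_inf (\<sigma>^2 * q ^ (2 * j)) q) has_sum S2) UNIV"
    by (rule moment_identity[OF sg lam'[of "r + 2"]])
  define k where "k = \<sigma>^2 * q ^ i"
  show ?thesis
  proof (rule that[of "S1 + (- k) * S2"])
    have node: "\<epsilon> * (\<alpha> * p ^ (i + j)) = \<epsilon> * \<sigma> * p ^ j" for \<epsilon> j
      by (simp add: \<sigma>_def power_add mult_ac)
    have pw: "k * x powi (N - int (r + 2)) = q ^ i / q ^ j * x powi (N - int r)"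
      if "x = \<epsilon> * \<sigma> * p ^ j" "\<epsilon> \<in> {1,-1}" for x \<epsilon> j
    proof -
      have x0: "x \<noteq> 0" using that sg p by auto
      have "x^2 = \<sigma>^2 * q ^ j"
        using that by (auto simp: power_mult_distrib q_pow(1) simp flip: power_mult) (simp_all add: mult.commute)
      then have "k = q ^ i / q ^ j * x^2" using q by (simp add: k_def)
      moreover have "x^2 * x powi (N - int (r + 2)) = x powi (N - int r)"
        using x0 power_int_add[of x 2 "N - int (r + 2)"] by simp
      ultimately show ?thesis by (metis mult.assoc)
    qed
    have "(1 - q ^ i / q ^ j) * x powi (N - int r) * y
        = x powi (N - int r) * y + (- k) * (x powi (N - int (r + 2)) * y)"
      if "x = \<epsilon> * \<sigma> * p ^ j" "\<epsilon> \<in> {1,-1}" for x \<epsilon> j y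
    proof -
      have "(1 - q ^ i / q ^ j) * x powi (N - int r) * y
         = x powi (N - int r) * y - (q ^ i / q ^ j * x powi (N - int r)) * y"
        by (simp only: left_diff_distrib mult_1)
      also have "\<dots> = x powi (N - int r) * y + (- k) * (x powi (N - int (r + 2)) * y)"
        unfolding pw[OF that, symmetric] by simp
      finally show ?thesis .
    qed
    from this[OF refl, of 1] this[OF refl, of "-1"]
    have "eul j * q ^ j * (1/2) * (\<Sum>\<epsilon>\<in>{1,-1}. (1 - q ^ i / q ^ j) *
        (\<epsilon> * (\<alpha> * p ^ (i + j))) powi (N - int r) * ratio lam (\<epsilon> * (\<alpha> * p ^ (i + j))))
      = hpoch 0 1 q j / qpoch q q j * q ^ j * (1/2) *
        (\<Sum>\<epsilon>\<in>{1,-1}. (\<epsilon> * \<sigma> * p ^ j) powi (N - int r) *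
           (qpoch_inf (lam * (\<epsilon> * \<sigma> * p ^ j)) q / qpoch_inf (\<epsilon> * \<sigma> * p ^ j) q))
      + (- k) * (hpoch 0 1 q j / qpoch q q j * q ^ j * (1/2) *
        (\<Sum>\<epsilon>\<in>{1,-1}. (\<epsilon> * \<sigma> * p ^ j) powi (N - int (r + 2)) *
           (qpoch_inf (lam * (\<epsilon> * \<sigma> * p ^ j)) q / qpoch_inf (\<epsilon> * \<sigma> * p ^ j) q)))" for j
      unfolding node sum_signs ratio_def eul_def by (simp only: insert_iff simp_thms) (simp add: algebra_simps)
    then show "((\<lambda>j. eul j * q ^ j * (1/2) * (\<Sum>\<epsilon>\<in>{1,-1}. (1 - q ^ i / q ^ j) *
        (\<epsilon> * (\<alpha> * p ^ (i + j))) powi (N - int r) * ratio lam (\<epsilon> * (\<alpha> * p ^ (i + j)))))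
          has_sum (S1 + (- k) * S2)) UNIV"
      using has_sum_add[OF S1(1) has_sum_cmult_right[OF S2(1), of "- k"]] by (simp only:)
    have "qpoch_inf lam q * (hpoch lam q q j / qpoch q q j * (q powi (- N)) ^ j)
        / qpoch_inf (\<alpha>^2 * q ^ i * q ^ (2 * j)) q * (1 - \<alpha>^2 * q ^ (2 * i) * q ^ (2 * j)) * (q ^ j) ^ r
      = qpoch_inf lam q * (hpoch lam q q j / qpoch q q j * (q powi (- (N - int r))) ^ j)
        / qpoch_inf (\<sigma>^2 * q ^ (2 * j)) q
      + (- k) * (qpoch_inf lam q * (hpoch lam q q j / qpoch q q j * (q powi (- (N - int (r + 2)))) ^ j)
        / qpoch_inf (\<sigma>^2 * q ^ (2 * j)) q)" for j
    proof -
      have e: "(q powi (- (N - int m))) ^ j = (q powi (- N)) ^ j * (q ^ j) ^ m" for m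
      proof -
        have "q powi (- (N - int m)) = q powi (- N) * q ^ m"
          using powi_add(2)[of "- N" "int m"] by simp
        then show ?thesis by (simp add: power_mult_distrib mult.commute flip: power_mult)
      qed
      have kk: "k = \<alpha>^2 * q ^ (2 * i)" by (simp add: k_def sg2 mult_2 power_add)
      have jj: "(q ^ j) ^ (r + 2) = (q ^ j) ^ r * q ^ (2 * j)"
        by (simp add: power_add mult_2 power2_eq_square)
      have "X * (H * P) / D * (1 - K * Q) * R = X * (H * (P * R)) / D + (- K) * (X * (H * (P * (R * Q))) / D)"
        for X H P D K Q R :: complex
        by (cases "D = 0") (simp_all add: field_simps)
      then show ?thesis unfolding e jj kk sg2 by blast
    qed
    then show "((\<lambda>j. qpoch_inf lam q * (hpoch lam q q j / qpoch q q j * (q powi (- N)) ^ j)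
        / qpoch_inf (\<alpha>^2 * q ^ i * q ^ (2 * j)) q * (1 - \<alpha>^2 * q ^ (2 * i) * q ^ (2 * j)) * (q ^ j) ^ r)
          has_sum (S1 + (- k) * S2)) UNIV"
      using has_sum_add[OF S1(2) has_sum_cmult_right[OF S2(2), of "- k"]] by (simp only:)
  qed
qed

text \<open>Fixing $N$ and $i$ in the majorant gives the dominating series for the interchange in \<open>superposition\<close>.\<close>

lemma summable_majorant_slice:
  assumes "\<alpha> \<noteq> 0" "\<kappa>1 \<noteq> 0" "\<kappa>2 \<noteq> 0" "lam \<noteq> 0" "\<kappa>1 * \<kappa>2 * lam = q^2 * \<alpha>^2"
  shows "(\<lambda>j. rho powi ((int j)^2 + int j) * ((1 + rho ^ (2 * i) / rho ^ (2 * j)) * (norm \<alpha> * rho ^ (i + j)) powi N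
      * pth rho (norm \<kappa>1 / norm \<alpha> / rho ^ (i + j)) * pth rho (norm \<kappa>2 / norm \<alpha> / rho ^ (i + j)))) summable_on UNIV"
proof -
  define M where "M = majorant rho (norm \<kappa>1 / norm \<alpha>) (norm \<kappa>2 / norm \<alpha>) (norm lam) (norm \<alpha>) N"
  have "M summable_on UNIV \<times> UNIV"
    unfolding M_def using majorant_summable_fixed[OF rho _ _ _ _ majorant_condition[OF assms(1,5)], of "norm \<alpha>" N] assms
    by simp
  then have sl: "(\<lambda>j. M (i, j)) summable_on UNIV"
    using summable_on_SigmaD1[of "\<lambda>i j. M (i, j)" UNIV "\<lambda>_. UNIV" i] by (simp add: case_prod_unfold)
  define c where "c = rho powi (N^2 - N) * (norm lam ^ i * rho powi ((int i)^2 - int i - 2 * N * int i))"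
  have c: "c \<noteq> 0" using assms p by (simp add: c_def)
  have "(\<lambda>j. (1 / c) * M (i, j)) summable_on UNIV"
    by (intro summable_on_cmult_right sl)
  moreover have "(1 / c) * M (i, j) = rho powi ((int j)^2 + int j) * ((1 + rho ^ (2 * i) / rho ^ (2 * j)) * (norm \<alpha> * rho ^ (i + j)) powi N
      * pth rho (norm \<kappa>1 / norm \<alpha> / rho ^ (i + j)) * pth rho (norm \<kappa>2 / norm \<alpha> / rho ^ (i + j)))" for j
  proof -
    have "M (i, j) = c * (rho powi ((int j)^2 + int j) * ((1 + rho ^ (2 * i) / rho ^ (2 * j)) * (norm \<alpha> * rho ^ (i + j)) powi N
      * pth rho (norm \<kappa>1 / norm \<alpha> / rho ^ (i + j)) * pth rho (norm \<kappa>2 / norm \<alpha> / rho ^ (i + j))))"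
      unfolding M_def majorant_def prod.case c_def by (simp only: mult_ac)
    then show ?thesis using c by simp
  qed
  ultimately show ?thesis by simp
qed

text \<open>Replacing $s^N$ by $s^{N-r}$ on the left multiplies the $j$-th term on the right by $q^{jr}$. Both
$(\kappa_1v,\kappa_2v;q)_\infty$ at $v = 1/s$ and at $v = q^j$ are therefore the same linear combination of moment
identities, with Euler's coefficients.\<close>

lemma superposition:
  fixes N :: int and i :: nat
  assumes al: "\<alpha> \<noteq> 0" "norm \<alpha> < 1" and lam: "lam \<noteq> 0" "norm (lam * q powi (- N)) < 1"
    and ka: "\<kappa>1 \<noteq> 0" "\<kappa>2 \<noteq> 0" "\<kappa>1 * \<kappa>2 * lam = q^2 * \<alpha>^2"
  obtains S where
    "((\<lambda>j. eul j * q ^ j * (1/2) * (\<Sum>\<epsilon>\<in>{1,-1}. nd \<kappa>1 \<kappa>2 N i j (\<epsilon> * (\<alpha> * p ^ (i + j)))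
         * ratio lam (\<epsilon> * (\<alpha> * p ^ (i + j))))) has_sum S) UNIV"
    "((\<lambda>j. qpoch_inf lam q * (hpoch lam q q j / qpoch q q j * (q powi (- N)) ^ j)
        / qpoch_inf (\<alpha>^2 * q ^ i * q ^ (2 * j)) q * (1 - \<alpha>^2 * q ^ (2 * i) * q ^ (2 * j))
        * (qpoch_inf (\<kappa>1 * q ^ j) q * qpoch_inf (\<kappa>2 * q ^ j) q)) has_sum S) UNIV"
proof -
  define s where "s \<epsilon> j = \<epsilon> * (\<alpha> * p ^ (i + j))" for \<epsilon> j
  define A where "A r j = eul j * q ^ j * (1/2) * (\<Sum>\<epsilon>\<in>{1,-1}. (1 - q ^ i / q ^ j) *
        s \<epsilon> j powi (N - int r) * ratio lam (s \<epsilon> j))" for r j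
  define T where "T j = qpoch_inf lam q * (hpoch lam q q j / qpoch q q j * (q powi (- N)) ^ j)
        / qpoch_inf (\<alpha>^2 * q ^ i * q ^ (2 * j)) q * (1 - \<alpha>^2 * q ^ (2 * i) * q ^ (2 * j))" for j
  have "\<exists>S. (A r has_sum S) UNIV \<and> ((\<lambda>j. T j * (q ^ j) ^ r) has_sum S) UNIV" for r
    unfolding A_def s_def T_def by (rule moment_identity'[OF al lam(2), of i r]) blast
  then obtain S where S: "\<And>r. (A r has_sum S r) UNIV" "\<And>r. ((\<lambda>j. T j * (q ^ j) ^ r) has_sum S r) UNIV"
    by metis
  define e where "e = (\<lambda>(m, n). eul m * \<kappa>1 ^ m * (eul n * \<kappa>2 ^ n))"
  have eprod: "((\<lambda>(m, n). (eul m * x ^ m) * (eul n * y ^ n)) has_sum (qpoch_inf x q * qpoch_inf y q)) (UNIV \<times> UNIV)" for x y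
    by (intro has_sum_times_prod has_sum_eul summable_norm_eul)
  have s0: "s \<epsilon> j \<noteq> 0" if "\<epsilon> \<in> {1,-1}" for \<epsilon> j using that al p by (auto simp: s_def)
  have norm_s: "norm (s \<epsilon> j) = norm \<alpha> * rho ^ (i + j)" if "\<epsilon> \<in> {1,-1}" for \<epsilon> j
    unfolding s_def by (rule norm_node[OF that])
  have s_le: "norm (s \<epsilon> j) \<le> norm \<alpha>" if "\<epsilon> \<in> {1,-1}" for \<epsilon> j
    unfolding norm_s[OF that] using rho by (intro mult_left_le) (auto intro: power_le_one)
  obtain D1 where D1: "D1 > 0" "\<And>x. norm x \<le> norm lam * norm \<alpha> \<Longrightarrow> norm (qpoch_inf x q) \<le> D1"
    using qpoch_inf_bounded_on_disc[OF q(2)] by metis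
  obtain D2 where D2: "D2 > 0" "\<And>x. norm x \<le> norm \<alpha> \<Longrightarrow> norm (1 / qpoch_inf x q) \<le> D2"
    using qpoch_inf_recip_bounded_on_disc[OF q(2) al(2)] by metis
  have ratio_le: "norm (ratio lam (s \<epsilon> j)) \<le> D1 * D2" if "\<epsilon> \<in> {1,-1}" for \<epsilon> j
  proof -
    have a: "ratio lam (s \<epsilon> j) = qpoch_inf (lam * s \<epsilon> j) q * (1 / qpoch_inf (s \<epsilon> j) q)"
      by (simp add: ratio_def)
    have b: "norm (lam * s \<epsilon> j) \<le> norm lam * norm \<alpha>"
      using s_le[OF that] by (simp add: norm_mult mult_left_mono)
    show ?thesis
      unfolding a norm_mult[of "qpoch_inf _ _"]
      by (intro mult_mono D1(2) D2(2) b s_le that) (use D1 in auto)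
  qed

  define f where "f j z = e z * A (fst z + snd z) j" for j z
  define g where "g j = eul j * q ^ j * (1/2) * (\<Sum>\<epsilon>\<in>{1,-1}. nd \<kappa>1 \<kappa>2 N i j (s \<epsilon> j) * ratio lam (s \<epsilon> j))" for j
  define h where "h z = e z * S (fst z + snd z)" for z
  have fg: "((\<lambda>z. f j z) has_sum g j) (UNIV \<times> UNIV)" for j
  proof -
    have "((\<lambda>z. e z * ((1 - q ^ i / q ^ j) * s \<epsilon> j powi (N - int (fst z + snd z)) * ratio lam (s \<epsilon> j)))
            has_sum (nd \<kappa>1 \<kappa>2 N i j (s \<epsilon> j) * ratio lam (s \<epsilon> j))) (UNIV \<times> UNIV)"
      if eps: "\<epsilon> \<in> {1,-1}" for \<epsilon>
    proof -
      define x where "x = s \<epsilon> j"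
      have x: "x \<noteq> 0" unfolding x_def by (rule s0[OF eps])
      have 1: "((\<lambda>z. ((1 - q ^ i / q ^ j) * x powi N * ratio lam x) *
               (case z of (m, n) \<Rightarrow> (eul m * (\<kappa>1 / x) ^ m) * (eul n * (\<kappa>2 / x) ^ n)))
            has_sum ((1 - q ^ i / q ^ j) * x powi N * ratio lam x * (qpoch_inf (\<kappa>1 / x) q * qpoch_inf (\<kappa>2 / x) q))) (UNIV \<times> UNIV)"
        by (intro has_sum_cmult_right eprod)
      have 2: "((1 - q ^ i / q ^ j) * x powi N * ratio lam x) *
               (case z of (m, n) \<Rightarrow> (eul m * (\<kappa>1 / x) ^ m) * (eul n * (\<kappa>2 / x) ^ n))
          = e z * ((1 - q ^ i / q ^ j) * x powi (N - int (fst z + snd z)) * ratio lam x)" for z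
        using x by (cases z) (simp add: e_def power_int_diff power_int_add power_add power_divide mult_ac)
      have 3: "(1 - q ^ i / q ^ j) * x powi N * ratio lam x * (qpoch_inf (\<kappa>1 / x) q * qpoch_inf (\<kappa>2 / x) q)
          = nd \<kappa>1 \<kappa>2 N i j x * ratio lam x"
        by (simp add: nd_def mult_ac)
      show ?thesis using 1 unfolding 2 3 unfolding x_def .
    qed
    from has_sum_cmult_right[OF has_sum_add[OF this[of 1] this[of "-1"]], of "eul j * q ^ j * (1/2)"]
    have sum2: "((\<lambda>z. eul j * q ^ j * (1/2) *
        (e z * ((1 - q ^ i / q ^ j) * s 1 j powi (N - int (fst z + snd z)) * ratio lam (s 1 j)) +
         e z * ((1 - q ^ i / q ^ j) * s (- 1) j powi (N - int (fst z + snd z)) * ratio lam (s (- 1) j))))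
       has_sum eul j * q ^ j * (1/2) * (nd \<kappa>1 \<kappa>2 N i j (s 1 j) * ratio lam (s 1 j) +
         nd \<kappa>1 \<kappa>2 N i j (s (- 1) j) * ratio lam (s (- 1) j))) (UNIV \<times> UNIV)"
      by blast
    have comm: "E * (a * X + a * Y) = a * (E * (X + Y))" for E a X Y :: complex
      by (simp add: algebra_simps)
    show ?thesis using sum2 unfolding f_def g_def A_def sum_signs comm .
  qed
  have fh: "((\<lambda>j. f j z) has_sum h z) UNIV" for z
    unfolding f_def h_def by (intro has_sum_cmult_right S)
  define B where "B j = norm (eul j * q ^ j) * ((1 + rho ^ (2 * i) / rho ^ (2 * j)) * (norm \<alpha> * rho ^ (i + j)) powi N)" for j
  define F where "F = (\<lambda>(j, z). (D1 * D2) * B j * (case z of (m, n) \<Rightarrow>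
       norm (eul m * (\<kappa>1 / s 1 j) ^ m) * norm (eul n * (\<kappa>2 / s 1 j) ^ n)))"
  have B0: "B j \<ge> 0" for j
    unfolding B_def using rho by (intro mult_nonneg_nonneg add_nonneg_nonneg) auto
  obtain S1 where S1: "(g has_sum S1) UNIV" "(h has_sum S1) (UNIV \<times> UNIV)"
  proof (rule has_sum_interchange[of F UNIV "UNIV \<times> UNIV" f g h])
    define I where "I \<kappa> j = (\<Sum>\<^sub>\<infinity>n. norm (eul n * (\<kappa> / s 1 j) ^ n))" for \<kappa> j
    have inner: "((\<lambda>z. F (j, z)) has_sum ((D1 * D2) * B j * (I \<kappa>1 j * I \<kappa>2 j))) (UNIV \<times> UNIV)" for j
    proof -
      have "((\<lambda>z. case z of (m, n) \<Rightarrow> norm (eul m * (\<kappa>1 / s 1 j) ^ m) * norm (eul n * (\<kappa>2 / s 1 j) ^ n))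
          has_sum (I \<kappa>1 j * I \<kappa>2 j)) (UNIV \<times> UNIV)"
      proof (rule has_sum_SigmaI)
        show "((\<lambda>y. case (x, y) of (m, n) \<Rightarrow> norm (eul m * (\<kappa>1 / s 1 j) ^ m) * norm (eul n * (\<kappa>2 / s 1 j) ^ n))
           has_sum norm (eul x * (\<kappa>1 / s 1 j) ^ x) * I \<kappa>2 j) UNIV" for x
          unfolding I_def prod.case by (intro has_sum_cmult_right has_sum_infsum summable_norm_eul)
        show "((\<lambda>x. norm (eul x * (\<kappa>1 / s 1 j) ^ x) * I \<kappa>2 j) has_sum I \<kappa>1 j * I \<kappa>2 j) UNIV"
          unfolding I_def[of \<kappa>1] by (intro has_sum_cmult_left has_sum_infsum summable_norm_eul)
        show "(\<lambda>(m, n). norm (eul m * (\<kappa>1 / s 1 j) ^ m) * norm (eul n * (\<kappa>2 / s 1 j) ^ n)) summable_on UNIV \<times> UNIV"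
          by (rule summable_on_times_prod[OF summable_norm_eul summable_norm_eul]) auto
      qed
      then show ?thesis unfolding F_def prod.case by (rule has_sum_cmult_right)
    qed
    show "F summable_on UNIV \<times> (UNIV \<times> UNIV)"
    proof (rule summable_on_SigmaI[OF inner])
      show "(\<lambda>j. (D1 * D2) * B j * (I \<kappa>1 j * I \<kappa>2 j)) summable_on UNIV"
      proof (rule summable_on_comparison_test)
        let ?m = "\<lambda>j. rho powi ((int j)^2 + int j) * ((1 + rho ^ (2 * i) / rho ^ (2 * j)) * (norm \<alpha> * rho ^ (i + j)) powi N
          * pth rho (norm \<kappa>1 / norm \<alpha> / rho ^ (i + j)) * pth rho (norm \<kappa>2 / norm \<alpha> / rho ^ (i + j)))"
        show "(\<lambda>j. (D1 * D2 * eul_const^3) * ?m j) summable_on UNIV"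
          by (intro summable_on_cmult_right summable_majorant_slice[OF al(1) ka(1,2) lam(1) ka(3)])
        have I0: "I \<kappa> j \<ge> 0" for \<kappa> j unfolding I_def by (intro infsum_nonneg) auto
        show "0 \<le> (D1 * D2) * B j * (I \<kappa>1 j * I \<kappa>2 j)" for j
          using D1 D2 B0 I0 by simp
        have I_le: "I \<kappa> j \<le> eul_const * pth rho (norm \<kappa> / norm \<alpha> / rho ^ (i + j))" if "\<kappa> \<noteq> 0" for \<kappa> j
          using infsum_norm_eul_le[of "\<kappa> / s 1 j"] that s0[of 1 j] norm_s[of 1 j]
          by (simp add: I_def norm_divide)
        have pth0: "0 \<le> pth rho (norm \<kappa> / norm \<alpha> / rho ^ (i + j))" if "\<kappa> \<noteq> 0" for \<kappa> :: complex and j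
          using that al rho by (intro pth_nonneg) auto
        have "(D1 * D2) * B j * (I \<kappa>1 j * I \<kappa>2 j) \<le>
           (D1 * D2) * ((eul_const * rho powi ((int j)^2 + int j)) * ((1 + rho ^ (2 * i) / rho ^ (2 * j)) * (norm \<alpha> * rho ^ (i + j)) powi N))
           * ((eul_const * pth rho (norm \<kappa>1 / norm \<alpha> / rho ^ (i + j))) * (eul_const * pth rho (norm \<kappa>2 / norm \<alpha> / rho ^ (i + j))))" for j
          unfolding B_def using D1 D2 eul_const(1) rho
          by (intro mult_mono norm_eul_q_le I_le ka order_refl mult_nonneg_nonneg I0 pth0 add_nonneg_nonneg) auto
        then show "(D1 * D2) * B j * (I \<kappa>1 j * I \<kappa>2 j) \<le> (D1 * D2 * eul_const^3) * ?m j" for j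
          by (simp add: power3_eq_cube mult_ac)
      qed
    qed (use D1 D2 B0 in \<open>auto simp: F_def\<close>)
    fix j and z :: "nat \<times> nat"
    obtain m n where z: "z = (m, n)" by (cases z)
    define x where "x = norm \<alpha> * rho ^ (i + j)"
    have x: "x > 0" using al rho by (simp add: x_def)
    define Y where "Y = (1 + rho ^ (2 * i) / rho ^ (2 * j)) * x powi (N - int (m + n)) * (D1 * D2)"
    define t where "t \<epsilon> = (1 - q ^ i / q ^ j) * s \<epsilon> j powi (N - int (m + n)) * ratio lam (s \<epsilon> j)" for \<epsilon>
    have t_le: "norm (t \<epsilon>) \<le> Y" if "\<epsilon> \<in> {1,-1}" for \<epsilon>
      unfolding t_def Y_def norm_mult norm_power_int norm_s[OF that] x_def[symmetric] using x rho D1 D2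
      by (intro mult_mono norm_one_minus_le ratio_le that order_refl mult_nonneg_nonneg) auto
    have tri: "norm (t 1 + t (-1)) \<le> 2 * Y"
      using norm_triangle_ineq[of "t 1" "t (-1)"] t_le[of 1] t_le[of "-1"] by simp
    have "norm (A (m + n) j) = norm (eul j * q ^ j * (1/2)) * norm (t 1 + t (-1))"
      unfolding A_def sum_signs t_def norm_mult ..
    also have "\<dots> \<le> norm (eul j * q ^ j * (1/2)) * (2 * Y)"
      by (intro mult_left_mono tri) auto
    also have "\<dots> = norm (eul j * q ^ j) * Y"
      by (simp add: norm_mult)
    finally have "norm (f j z) \<le> norm (e z) * (norm (eul j * q ^ j) * Y)"
      unfolding f_def z norm_mult[of "e _"] fst_conv snd_conv by (intro mult_left_mono) auto
    also have "\<dots> = F (j, z)"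
    proof -
      have "x powi (N - int (m + n)) = x powi N / (x ^ m * x ^ n)"
        using x by (simp add: power_int_diff power_int_add)
      moreover have "norm (s 1 j) = x" unfolding x_def by (rule norm_s) simp
      ultimately show ?thesis
        by (simp add: F_def B_def Y_def z e_def x_def[symmetric] norm_mult norm_divide norm_power power_divide)
    qed
    finally show "norm (f j z) \<le> F (j, z)" .
  qed (use fg fh in auto)

  define f2 where "f2 j z = e z * (T j * (q ^ j) ^ (fst z + snd z))" for j z
  define g2 where "g2 j = T j * (qpoch_inf (\<kappa>1 * q ^ j) q * qpoch_inf (\<kappa>2 * q ^ j) q)" for j
  have f2g: "((\<lambda>z. f2 j z) has_sum g2 j) (UNIV \<times> UNIV)" for j
  proof -
    have "f2 j z = T j * (case z of (m, n) \<Rightarrow> (eul m * (\<kappa>1 * q ^ j) ^ m) * (eul n * (\<kappa>2 * q ^ j) ^ n))" for z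
      by (cases z) (simp add: f2_def e_def power_mult_distrib power_add mult_ac)
    then show ?thesis unfolding g2_def using has_sum_cmult_right[OF eprod] by simp
  qed
  have f2h: "((\<lambda>j. f2 j z) has_sum h z) UNIV" for z
    unfolding f2_def h_def by (intro has_sum_cmult_right S)
  define F2 where "F2 = (\<lambda>(j, z). norm (T j) * (case z of (m, n) \<Rightarrow> norm (eul m * \<kappa>1 ^ m) * norm (eul n * \<kappa>2 ^ n)))"
  have al2: "norm (\<alpha>^2) < 1" using al by (simp add: norm_power power_less_one_iff)
  obtain D3 where D3: "D3 > 0" "\<And>x. norm x \<le> norm (\<alpha>^2) \<Longrightarrow> norm (1 / qpoch_inf x q) \<le> D3"
    using qpoch_inf_recip_bounded_on_disc[OF q(2) al2] by metis
  have Tsum: "(\<lambda>j. norm (T j)) summable_on UNIV"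
  proof (rule summable_on_comparison_test)
    let ?t = "\<lambda>j. norm (hpoch lam q q j / qpoch q q j * (q powi (- N)) ^ j)"
    show "(\<lambda>j. (norm (qpoch_inf lam q) * D3 * 2) * ?t j) summable_on UNIV"
      using hq_binomial_norm_summable[OF q(2) lam(2), of q]
      by (intro summable_on_cmult_right summable_nonneg_imp_summable_on) auto
    show "norm (T j) \<le> (norm (qpoch_inf lam q) * D3 * 2) * ?t j" for j
    proof -
      have qn: "norm (q ^ m) \<le> 1" for m using q by (simp add: norm_power power_le_one)
      have a: "norm (\<alpha>^2 * q ^ m * q ^ n) \<le> norm (\<alpha>^2)" for m n
      proof -
        have "norm (\<alpha>^2 * q ^ m * q ^ n) = norm (\<alpha>^2) * norm (q ^ (m + n))"
          by (simp add: norm_mult power_add)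
        also have "\<dots> \<le> norm (\<alpha>^2)" using qn by (intro mult_left_le) auto
        finally show ?thesis .
      qed
      have b: "norm (1 - \<alpha>^2 * q ^ (2 * i) * q ^ (2 * j)) \<le> 2"
        using norm_triangle_ineq4[of 1 "\<alpha>^2 * q ^ (2 * i) * q ^ (2 * j)"] a[of "2 * i" "2 * j"] al2
        by simp
      have "T j = qpoch_inf lam q * (1 / qpoch_inf (\<alpha>^2 * q ^ i * q ^ (2 * j)) q) *
          (1 - \<alpha>^2 * q ^ (2 * i) * q ^ (2 * j)) * (hpoch lam q q j / qpoch q q j * (q powi (- N)) ^ j)"
        by (simp add: T_def mult_ac)
      then have "norm (T j) = norm (qpoch_inf lam q) * norm (1 / qpoch_inf (\<alpha>^2 * q ^ i * q ^ (2 * j)) q) *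
          norm (1 - \<alpha>^2 * q ^ (2 * i) * q ^ (2 * j)) * ?t j"
        by (simp only: norm_mult)
      also have "\<dots> \<le> norm (qpoch_inf lam q) * D3 * 2 * ?t j"
        using D3 by (intro mult_mono mult_nonneg_nonneg order_refl D3(2) a b) auto
      finally show ?thesis .
    qed
  qed auto
  obtain S2 where S2: "(g2 has_sum S2) UNIV" "(h has_sum S2) (UNIV \<times> UNIV)"
  proof (rule has_sum_interchange[of F2 UNIV "UNIV \<times> UNIV" f2 g2 h])
    show "F2 summable_on UNIV \<times> (UNIV \<times> UNIV)"
      unfolding F2_def
      using summable_on_times_prod[OF Tsum summable_on_times_prod[OF summable_norm_eul[of \<kappa>1] summable_norm_eul[of \<kappa>2]]]
      by (auto simp: case_prod_unfold)
    fix j and z :: "nat \<times> nat"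
    have "norm (f2 j z) = F2 (j, z) * norm ((q ^ j) ^ (fst z + snd z))"
      by (cases z) (simp add: f2_def F2_def e_def norm_mult)
    also have "\<dots> \<le> F2 (j, z)"
      using q by (intro mult_left_le) (auto simp: F2_def norm_power case_prod_unfold intro!: power_le_one)
    finally show "norm (f2 j z) \<le> F2 (j, z)" .
  qed (use f2g f2h in auto)
  have "S1 = S2" using S1(2) S2(2) has_sum_unique by blast
  then show ?thesis
    using that[of S1] S1(1) S2(1) unfolding g_def g2_def T_def s_def by simp
qed

end

section \<open>Clearing the poles at the nodes\<close>

text \<open>Weierstrass's theorem for sums over arbitrary index sets, with locally uniform dominated convergence.\<close>

lemma holomorphic_on_infsum:
  fixes f :: "'a \<Rightarrow> complex \<Rightarrow> complex"
  assumes A: "open A" and hol: "\<And>i. f i holomorphic_on A"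
    and loc: "\<And>x. x \<in> A \<Longrightarrow> \<exists>d>0. \<exists>M. cball x d \<subseteq> A \<and> M summable_on UNIV \<and> (\<forall>i. \<forall>y\<in>cball x d. norm (f i y) \<le> M i)"
  shows "(\<lambda>y. \<Sum>\<^sub>\<infinity>i. f i y) holomorphic_on A"
  unfolding holomorphic_on_open[OF A]
proof
  fix x assume "x \<in> A"
  then obtain d M where d: "d > 0" "cball x d \<subseteq> A" "M summable_on UNIV"
    "\<And>i y. y \<in> cball x d \<Longrightarrow> norm (f i y) \<le> M i"
    using loc by metis
  have ul: "uniform_limit (cball x d) (\<lambda>X y. \<Sum>i\<in>X. f i y) (\<lambda>y. \<Sum>\<^sub>\<infinity>i. f i y) (finite_subsets_at_top UNIV)"
    by (rule Weierstrass_m_test_general[of UNIV _ f M]) (use d in auto)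
  have "(\<lambda>y. \<Sum>\<^sub>\<infinity>i. f i y) holomorphic_on ball x d"
  proof (rule holomorphic_uniform_limit[OF _ ul])
    show "\<forall>\<^sub>F X in finite_subsets_at_top UNIV. continuous_on (cball x d) (\<lambda>y. \<Sum>i\<in>X. f i y) \<and>
        (\<lambda>y. \<Sum>i\<in>X. f i y) holomorphic_on ball x d"
    proof (intro always_eventually allI conjI)
      fix X
      have "f i holomorphic_on cball x d" for i using holomorphic_on_subset[OF hol d(2)] .
      then have h: "(\<lambda>y. \<Sum>i\<in>X. f i y) holomorphic_on cball x d" by (intro holomorphic_intros)
      then show "continuous_on (cball x d) (\<lambda>y. \<Sum>i\<in>X. f i y)" by (rule holomorphic_on_imp_continuous_on)
      show "(\<lambda>y. \<Sum>i\<in>X. f i y) holomorphic_on ball x d"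
        using h ball_subset_cball by (rule holomorphic_on_subset)
    qed
  qed (auto simp: finite_subsets_at_top_neq_bot)
  then show "\<exists>f'. ((\<lambda>y. \<Sum>\<^sub>\<infinity>i. f i y) has_field_derivative f') (at x)"
    using d(1) by (auto simp: holomorphic_on_open)
qed

lemma norm_qpoch_le:
  assumes "norm p < 1" "norm x \<le> R"
  shows "norm (qpoch x p n) \<le> exp (R / (1 - norm p))"
proof -
  have R: "R \<ge> 0" using assms(2) norm_ge_zero[of x] by linarith
  have "norm (qpoch x p n) = (\<Prod>j<n. norm (1 - x * p ^ j))"
    by (simp add: qpoch_def prod_norm)
  also have "\<dots> \<le> (\<Prod>j<n. exp (R * norm p ^ j))"
  proof (intro prod_mono conjI)
    fix j
    have "norm (1 - x * p ^ j) \<le> 1 + norm (x * p ^ j)"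
      using norm_triangle_ineq4[of 1 "x * p ^ j"] by simp
    also have "norm (x * p ^ j) \<le> R * norm p ^ j"
      using assms by (simp add: norm_mult norm_power mult_right_mono)
    also have "1 + R * norm p ^ j \<le> exp (R * norm p ^ j)" by (rule exp_ge_add_one_self)
    finally show "norm (1 - x * p ^ j) \<le> exp (R * norm p ^ j)" by simp
  qed auto
  also have "\<dots> = exp (\<Sum>j<n. R * norm p ^ j)" by (simp add: exp_sum)
  also have "\<dots> \<le> exp (R / (1 - norm p))"
  proof -
    have "(\<Sum>j<n. R * norm p ^ j) = R * (\<Sum>j<n. norm p ^ j)" by (simp add: sum_distrib_left)
    also have "(\<Sum>j<n. norm p ^ j) \<le> (\<Sum>j. norm p ^ j)"
      using assms by (intro sum_le_suminf summable_geometric) auto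
    also have "(\<Sum>j. norm p ^ j) = 1 / (1 - norm p)" using assms by (intro suminf_geometric) auto
    finally show ?thesis using R by (simp add: mult_left_mono)
  qed
  finally show ?thesis .
qed

context nome
begin

lemma qpoch_inf_base_p: "qpoch_inf x p = qpoch_inf x q * qpoch_inf (x * p) q"
proof -
  have "qpoch x p (2 * n) = qpoch x q n * qpoch (x * p) q n" for n
    by (induction n) (simp_all add: qpoch_Suc q_pow(1) mult_ac)
  moreover have "(\<lambda>n. qpoch x p (2 * n)) \<longlonglongrightarrow> qpoch_inf x p"
    using LIMSEQ_subseq_LIMSEQ[OF qpoch_LIMSEQ[OF p(2), of x], of "\<lambda>n. 2 * n"]
    by (simp add: strict_mono_def o_def)
  moreover have "(\<lambda>n. qpoch x q n * qpoch (x * p) q n) \<longlonglongrightarrow> qpoch_inf x q * qpoch_inf (x * p) q"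
    by (intro tendsto_mult qpoch_LIMSEQ q)
  ultimately show ?thesis using LIMSEQ_unique by simp
qed

lemma qpoch_inf_square: "qpoch_inf (x^2) q = qpoch_inf x p * qpoch_inf (- x) p"
proof -
  have "qpoch (x^2) q n = qpoch x p n * qpoch (- x) p n" for n
  proof (induction n)
    case (Suc n)
    have "1 - x^2 * q ^ n = (1 - x * p ^ n) * (1 - (- x) * p ^ n)"
      unfolding q_pow(1) mult_2 power_add by (simp add: power2_eq_square algebra_simps)
    then show ?case using Suc by (simp add: qpoch_Suc)
  qed simp
  moreover have "(\<lambda>n. qpoch (x^2) q n) \<longlonglongrightarrow> qpoch_inf (x^2) q"
    by (intro qpoch_LIMSEQ q)
  moreover have "(\<lambda>n. qpoch x p n * qpoch (- x) p n) \<longlonglongrightarrow> qpoch_inf x p * qpoch_inf (- x) p"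
    by (intro tendsto_mult qpoch_LIMSEQ p)
  ultimately show ?thesis using LIMSEQ_unique by simp
qed

text \<open>The quotient of $(q\alpha^2;q)_\infty$ by $(s;q)_\infty$ at the node $s = \epsilon\alpha p^M$, $M \ge 1$, written as
an entire function of $\alpha$: with $x = \epsilon p\alpha$ one has $(x^2;q)_\infty = (x,-x;p)_\infty$, and
$(x;p)_\infty$ contains $(s;q)_\infty$ as a factor.\<close>

definition cofactor :: "complex \<Rightarrow> complex \<Rightarrow> nat \<Rightarrow> complex" where
  "cofactor \<epsilon> \<alpha> M = qpoch_inf (- \<epsilon> * p * \<alpha>) p * qpoch (\<epsilon> * p * \<alpha>) p (M - 1)
     * qpoch_inf (\<epsilon> * \<alpha> * p ^ Suc M) q"

lemma cofactor:
  assumes "\<epsilon> \<in> {1, -1}" "M \<ge> 1"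
  shows "cofactor \<epsilon> \<alpha> M * qpoch_inf (\<epsilon> * (\<alpha> * p ^ M)) q = qpoch_inf (q * \<alpha>^2) q"
proof -
  define x where "x = \<epsilon> * p * \<alpha>"
  have "qpoch_inf (q * \<alpha>^2) q = qpoch_inf (x^2) q"
    using assms by (auto simp: x_def q_eq power_mult_distrib)
  also have "\<dots> = qpoch_inf x p * qpoch_inf (- x) p" by (rule qpoch_inf_square)
  also have "qpoch_inf x p = qpoch x p (M - 1) * qpoch_inf (x * p ^ (M - 1)) p"
    by (rule qpoch_inf_split[OF p(2)])
  also have "x * p ^ (M - 1) = \<epsilon> * (\<alpha> * p ^ M)"
    using assms(2) by (cases M) (auto simp: x_def)
  also have "qpoch_inf (\<epsilon> * (\<alpha> * p ^ M)) p
      = qpoch_inf (\<epsilon> * (\<alpha> * p ^ M)) q * qpoch_inf (\<epsilon> * \<alpha> * p ^ Suc M) q"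
    unfolding qpoch_inf_base_p by (simp add: mult_ac)
  finally show ?thesis unfolding cofactor_def x_def by (simp add: mult_ac)
qed

lemma cofactor_bounded:
  obtains D where "D > 0" "\<And>\<epsilon> \<alpha> M. \<epsilon> \<in> {1, -1} \<Longrightarrow> norm \<alpha> \<le> R \<Longrightarrow> norm (cofactor \<epsilon> \<alpha> M) \<le> D"
proof -
  obtain D1 where D1: "D1 > 0" "\<And>x. norm x \<le> R \<Longrightarrow> norm (qpoch_inf x p) \<le> D1"
    using qpoch_inf_bounded_on_disc[OF p(2)] by metis
  obtain D2 where D2: "D2 > 0" "\<And>x. norm x \<le> R \<Longrightarrow> norm (qpoch_inf x q) \<le> D2"
    using qpoch_inf_bounded_on_disc[OF q(2)] by metis
  show ?thesis
  proof (rule that[of "D1 * exp (R / (1 - norm p)) * D2"])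
    fix \<epsilon> \<alpha> :: complex and M assume eps: "\<epsilon> \<in> {1, -1}" and al: "norm \<alpha> \<le> R"
    have R: "R \<ge> 0" using al norm_ge_zero[of \<alpha>] by linarith
    have a: "norm (\<epsilon> * p * \<alpha>) \<le> R"
    proof -
      have "norm (\<epsilon> * p * \<alpha>) = norm p * norm \<alpha>" using eps by (auto simp: norm_mult)
      also have "\<dots> \<le> 1 * norm \<alpha>" using p by (intro mult_right_mono) auto
      finally show ?thesis using al by simp
    qed
    have b: "norm (\<epsilon> * \<alpha> * p ^ Suc M) \<le> R"
    proof -
      have "norm (\<epsilon> * \<alpha> * p ^ Suc M) = norm \<alpha> * norm p ^ Suc M"
        using eps by (auto simp: norm_mult norm_power)
      also have "\<dots> \<le> norm \<alpha> * 1" using p by (intro mult_left_mono power_le_one) auto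
      finally show ?thesis using al by simp
    qed
    have c: "norm (- \<epsilon> * p * \<alpha>) \<le> R" using a by simp
    show "norm (cofactor \<epsilon> \<alpha> M) \<le> D1 * exp (R / (1 - norm p)) * D2"
      unfolding cofactor_def norm_mult[of _ "qpoch_inf _ q"] norm_mult[of "qpoch_inf _ p"]
      using D1(1) D2(1)
      by (intro mult_mono D1(2) D2(2) norm_qpoch_le p a b c mult_nonneg_nonneg) auto
  qed (use D1 D2 in auto)
qed

text \<open>Unlike \<open>norm_qpoch_inf_le\<close> this is monotone in the bound for $|x|$, as uniform estimates need.\<close>

lemma norm_qpoch_inf_le':
  assumes "norm x \<le> X" "X > 0"
  shows "norm (qpoch_inf x q) \<le> eul_const * pth rho X"
proof -
  have "norm (qpoch_inf x q) \<le> (\<Sum>\<^sub>\<infinity>n. norm (eul n * x ^ n))"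
    using norm_infsum_bound[OF summable_norm_eul[of x]] infsumI[OF has_sum_eul[of x]] by simp
  also have "\<dots> \<le> (\<Sum>\<^sub>\<infinity>n. norm (eul n * of_real X ^ n))"
    using assms by (intro infsum_mono summable_norm_eul) (auto simp: norm_mult norm_power intro!: mult_left_mono power_mono)
  also have "\<dots> \<le> eul_const * pth rho X"
    using infsum_norm_eul_le[of "of_real X"] assms by simp
  finally show ?thesis .
qed

text \<open>The contribution of $(i,j)$ to the $N$-th Laurent coefficient in $z$. As a function of $\alpha$ it has poles; its
product with $(q\alpha^2;q)_\infty$ is \<open>node_entire\<close>, which has none on the punctured plane.\<close>

definition node_pole :: "complex \<Rightarrow> complex \<Rightarrow> complex \<Rightarrow> complex \<Rightarrow> int \<Rightarrow> nat \<times> nat \<Rightarrow> complex" where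
  "node_pole lam \<kappa>1 \<kappa>2 \<alpha> N = (\<lambda>(i, j). lam ^ i * eul i * (q powi (- N)) ^ i * (eul j * q ^ j * (1/2) *
     (\<Sum>\<epsilon>\<in>{1,-1}. nd \<kappa>1 \<kappa>2 N i j (\<epsilon> * (\<alpha> * p ^ (i + j))) * ratio lam (\<epsilon> * (\<alpha> * p ^ (i + j))))))"

definition node_entire :: "complex \<Rightarrow> complex \<Rightarrow> complex \<Rightarrow> complex \<Rightarrow> int \<Rightarrow> nat \<times> nat \<Rightarrow> complex" where
  "node_entire lam \<kappa>1 \<kappa>2 \<alpha> N = (\<lambda>(i, j). lam ^ i * eul i * (q powi (- N)) ^ i * (eul j * q ^ j * (1/2) *
     (\<Sum>\<epsilon>\<in>{1,-1}. nd \<kappa>1 \<kappa>2 N i j (\<epsilon> * (\<alpha> * p ^ (i + j))) *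
        (qpoch_inf (lam * (\<epsilon> * (\<alpha> * p ^ (i + j)))) q * cofactor \<epsilon> \<alpha> (i + j)))))"

lemma nd_diag: "nd \<kappa>1 \<kappa>2 N i i s = 0"
  using q by (simp add: nd_def)

lemma node_entire_eq:
  assumes "qpoch_inf (q * \<alpha>^2) q \<noteq> 0"
  shows "node_entire lam \<kappa>1 \<kappa>2 \<alpha> N z = qpoch_inf (q * \<alpha>^2) q * node_pole lam \<kappa>1 \<kappa>2 \<alpha> N z"
proof -
  obtain i j where z: "z = (i, j)" by (cases z)
  show ?thesis
  proof (cases "i + j \<ge> 1")
    case False
    then have "i = 0" "j = 0" by auto
    then show ?thesis by (simp add: z node_entire_def node_pole_def nd_diag)
  next
    case True
    have c: "qpoch_inf x q * cofactor \<epsilon> \<alpha> (i + j) = qpoch_inf (q * \<alpha>^2) q * (qpoch_inf x q / qpoch_inf (\<epsilon> * (\<alpha> * p ^ (i + j))) q)"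
      if eps: "\<epsilon> \<in> {1, -1}" for x \<epsilon>
    proof -
      have "qpoch_inf (\<epsilon> * (\<alpha> * p ^ (i + j))) q \<noteq> 0"
        using cofactor[OF eps True, of \<alpha>] assms by auto
      then show ?thesis using cofactor[OF eps True, of \<alpha>] by (simp add: field_simps)
    qed
    show ?thesis
      unfolding z node_entire_def node_pole_def prod.case sum_signs ratio_def
      by (simp only: c insert_iff simp_thms) (simp add: algebra_simps)
  qed
qed

text \<open>The estimate is uniform on an annulus in $\alpha$: the lower radius $A_1$ enters because $1/\alpha$ occurs in
$\kappa_l/s$, and the power of $|\alpha|/A_1$ accounts for the factor $s^N$, which may grow or decay.\<close>

lemma node_entire_bounded:
  assumes A1: "A1 > 0" and ka: "\<kappa>1 \<noteq> 0" "\<kappa>2 \<noteq> 0"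
  obtains C where "C > 0" "\<And>\<alpha> lam N i j. A1 \<le> norm \<alpha> \<Longrightarrow> norm \<alpha> \<le> A2 \<Longrightarrow> norm lam \<le> L \<Longrightarrow>
     rho powi (N^2 - N) * norm (node_entire lam \<kappa>1 \<kappa>2 \<alpha> N (i, j)) \<le>
       C * (norm \<alpha> / A1) powi N * majorant rho (norm \<kappa>1 / A1) (norm \<kappa>2 / A1) L A1 N (i, j)"
proof -
  obtain D1 where D1: "D1 > 0" "\<And>x. norm x \<le> L * A2 \<Longrightarrow> norm (qpoch_inf x q) \<le> D1"
    using qpoch_inf_bounded_on_disc[OF q(2)] by metis
  obtain D2 where D2: "D2 > 0" "\<And>\<epsilon> \<alpha> M. \<epsilon> \<in> {1, -1} \<Longrightarrow> norm \<alpha> \<le> A2 \<Longrightarrow> norm (cofactor \<epsilon> \<alpha> M) \<le> D2"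
    using cofactor_bounded by metis
  show ?thesis
  proof (rule that[of "eul_const^4 * (D1 * D2)"])
    show "eul_const^4 * (D1 * D2) > 0" using eul_const(1) D1 D2 by simp
    fix \<alpha> lam :: complex and N :: int and i j :: nat
    assume al: "A1 \<le> norm \<alpha>" "norm \<alpha> \<le> A2" and lam: "norm lam \<le> L"
    have L: "L \<ge> 0" using lam norm_ge_zero[of lam] by linarith
    have a0: "norm \<alpha> > 0" using A1 al by linarith
    define x where "x = norm \<alpha> * rho ^ (i + j)"
    have x: "x > 0" "A1 * rho ^ (i + j) > 0" using a0 A1 rho by (auto simp: x_def)
    define Y where "Y = (1 + rho ^ (2 * i) / rho ^ (2 * j)) * x powi N
        * (eul_const * pth rho (norm \<kappa>1 / A1 / rho ^ (i + j))) * (eul_const * pth rho (norm \<kappa>2 / A1 / rho ^ (i + j)))"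
    have pth0: "0 \<le> pth rho (norm \<kappa> / A1 / rho ^ (i + j))" if "\<kappa> \<noteq> 0" for \<kappa> :: complex
      using that A1 rho by (intro pth_nonneg) auto
    have Y0: "Y \<ge> 0" unfolding Y_def using x rho eul_const(1)
      by (intro mult_nonneg_nonneg add_nonneg_nonneg pth0 ka) auto
    define t where "t \<epsilon> = nd \<kappa>1 \<kappa>2 N i j (\<epsilon> * (\<alpha> * p ^ (i + j))) *
        (qpoch_inf (lam * (\<epsilon> * (\<alpha> * p ^ (i + j)))) q * cofactor \<epsilon> \<alpha> (i + j))" for \<epsilon>
    have t_le: "norm (t \<epsilon>) \<le> Y * (D1 * D2)" if eps: "\<epsilon> \<in> {1, -1}" for \<epsilon>
    proof -
      define s where "s = \<epsilon> * (\<alpha> * p ^ (i + j))"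
      have s: "norm s = x" unfolding s_def x_def by (rule norm_node[OF eps])
      have k: "norm (qpoch_inf (\<kappa> / s) q) \<le> eul_const * pth rho (norm \<kappa> / A1 / rho ^ (i + j))" if "\<kappa> \<noteq> 0" for \<kappa>
      proof (rule norm_qpoch_inf_le')
        show "norm (\<kappa> / s) \<le> norm \<kappa> / A1 / rho ^ (i + j)"
          unfolding norm_divide s x_def divide_divide_eq_left using al x A1 rho
          by (intro divide_left_mono mult_right_mono mult_pos_pos) auto
        show "norm \<kappa> / A1 / rho ^ (i + j) > 0" using that A1 rho by simp
      qed
      have nd: "norm (nd \<kappa>1 \<kappa>2 N i j s) \<le> Y"
      proof -
        have "norm (nd \<kappa>1 \<kappa>2 N i j s) = norm (1 - q ^ i / q ^ j) * x powi N *
           norm (qpoch_inf (\<kappa>1 / s) q) * norm (qpoch_inf (\<kappa>2 / s) q)"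
          by (simp only: nd_def norm_mult norm_power_int s)
        also have "\<dots> \<le> Y" unfolding Y_def using x rho eul_const(1)
          by (intro mult_mono k ka norm_one_minus_le order_refl mult_nonneg_nonneg pth0) auto
        finally show ?thesis .
      qed
      have "x \<le> norm \<alpha> * 1" unfolding x_def using rho by (intro mult_left_mono power_le_one) auto
      then have "norm lam * norm s \<le> L * A2" using s al lam L x by (intro mult_mono) auto
      then have d1: "norm (qpoch_inf (lam * s) q) \<le> D1" by (intro D1(2)) (simp add: norm_mult)
      show ?thesis unfolding t_def s_def[symmetric] norm_mult using D1(1) D2(1)
        by (intro mult_mono nd d1 D2(2) eps al Y0 mult_nonneg_nonneg) auto
    qed
    have tri: "norm (t 1 + t (-1)) \<le> 2 * (Y * (D1 * D2))"
      using norm_triangle_ineq[of "t 1" "t (-1)"] t_le[of 1] t_le[of "-1"] by simp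
    have "norm (node_entire lam \<kappa>1 \<kappa>2 \<alpha> N (i, j)) =
        norm (lam ^ i * eul i * (q powi (- N)) ^ i) * (norm (eul j * q ^ j) * (norm (t 1 + t (-1)) / 2))"
      unfolding node_entire_def prod.case sum_signs t_def norm_mult by simp
    also have "\<dots> \<le> (eul_const * (L ^ i * rho powi ((int i)^2 - int i - 2 * N * int i))) *
        ((eul_const * rho powi ((int j)^2 + int j)) * (Y * (D1 * D2)))"
    proof (intro mult_mono norm_eul_q_le)
      have "norm (lam ^ i * eul i * (q powi (- N)) ^ i) \<le>
         eul_const * (norm lam ^ i * rho powi ((int i)^2 - int i - 2 * N * int i))" by (rule norm_coeff_le)
      also have "\<dots> \<le> eul_const * (L ^ i * rho powi ((int i)^2 - int i - 2 * N * int i))"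
        using lam eul_const(1) by (intro mult_left_mono mult_right_mono power_mono) auto
      finally show "norm (lam ^ i * eul i * (q powi (- N)) ^ i) \<le>
         eul_const * (L ^ i * rho powi ((int i)^2 - int i - 2 * N * int i))" .
      show "norm (t 1 + t (-1)) / 2 \<le> Y * (D1 * D2)" using tri by simp
    qed (use eul_const(1) L Y0 D1 D2 in auto)
    finally have "rho powi (N^2 - N) * norm (node_entire lam \<kappa>1 \<kappa>2 \<alpha> N (i, j)) \<le> rho powi (N^2 - N) *
       ((eul_const * (L ^ i * rho powi ((int i)^2 - int i - 2 * N * int i))) *
        ((eul_const * rho powi ((int j)^2 + int j)) * (Y * (D1 * D2))))"
      by (intro mult_left_mono) auto
    also have "\<dots> = eul_const^4 * (D1 * D2) * (norm \<alpha> / A1) powi N *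
        majorant rho (norm \<kappa>1 / A1) (norm \<kappa>2 / A1) L A1 N (i, j)"
    proof -
      have "x powi N = (norm \<alpha> / A1) powi N * (A1 * rho ^ (i + j)) powi N"
        using A1 by (simp add: x_def flip: power_int_mult_distrib)
      then show ?thesis
        unfolding Y_def majorant_def prod.case by (simp add: power4_eq_xxxx mult_ac)
    qed
    finally show "rho powi (N^2 - N) * norm (node_entire lam \<kappa>1 \<kappa>2 \<alpha> N (i, j)) \<le>
       eul_const^4 * (D1 * D2) * (norm \<alpha> / A1) powi N * majorant rho (norm \<kappa>1 / A1) (norm \<kappa>2 / A1) L A1 N (i, j)" .
  qed
qed

text \<open>The very-well-poised numerator $(a;q)_k(1 - aq^{2k})/(1 - a)$ with $1 - a$ cancelled, hence a polynomial in $a$.\<close>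

definition vwp :: "complex \<Rightarrow> nat \<Rightarrow> complex" where
  "vwp a k = (if k = 0 then 1 else (1 - a * q ^ (2 * k)) * qpoch (a * q) q (k - 1))"

lemma vwp_eq:
  assumes "qpoch_inf a q \<noteq> 0"
  shows "vwp a k = qpoch_inf (q * a) q * (1 - a * q ^ (2 * k)) / qpoch_inf (a * q ^ k) q"
proof (cases k)
  case 0
  then show ?thesis using assms qpoch_inf_Suc[OF q(2), of a] by (simp add: vwp_def mult.commute)
next
  case (Suc m)
  have nz: "qpoch_inf (a * q ^ k) q \<noteq> 0" by (rule qpoch_nonzero_of_inf(2)[OF q(2) assms])
  have "qpoch_inf (q * a) q = qpoch (a * q) q m * qpoch_inf (a * q ^ k) q"
    using qpoch_inf_split[OF q(2), of "a * q" m] by (simp add: Suc mult_ac)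
  then show ?thesis using nz by (simp add: vwp_def Suc)
qed

text \<open>The contribution of the $k$-th term of the very-well-poised series to the coefficient of $z^N$ in its product with
$\vartheta(z;q)$, divided by the $N$-th Laurent coefficient of $\vartheta(z;q)$ itself: the shift from $N$ to
$N - k$ produces $(-1)^kq^{k(k+1)/2-Nk}$.\<close>

definition dual :: "complex \<Rightarrow> complex \<Rightarrow> complex \<Rightarrow> complex \<Rightarrow> int \<Rightarrow> nat \<Rightarrow> complex" where
  "dual lam \<kappa>1 \<kappa>2 \<alpha> N k = (q powi (- N)) ^ k * (eul k * q ^ k) * vwp (\<alpha>^2) k
     * (qpoch (q * \<alpha>^2 / \<kappa>1) q k * qpoch (lam * \<kappa>1 / q) q k / (qpoch \<kappa>1 q k * qpoch \<kappa>2 q k))"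

text \<open>Sum \<open>superposition\<close> over $i$ with Euler's coefficients and regroup by $k = i + j$. The inner sum over
$j \le k$ is the balanced sum of \<open>q_saalschuetz\<close>.\<close>

lemma coefficient_identity_small:
  assumes al: "\<alpha> \<noteq> 0" "norm \<alpha> < 1" and lam: "lam \<noteq> 0" "norm (lam * q powi (- N)) < 1"
    and ka: "\<kappa>1 \<noteq> 0" "\<kappa>2 \<noteq> 0" "\<kappa>1 * \<kappa>2 * lam = q^2 * \<alpha>^2"
    and kinf: "qpoch_inf \<kappa>1 q \<noteq> 0" "qpoch_inf \<kappa>2 q \<noteq> 0"
    and sm: "node_pole lam \<kappa>1 \<kappa>2 \<alpha> N summable_on UNIV"
  shows "((\<lambda>k. qpoch_inf lam q * qpoch_inf \<kappa>1 q * qpoch_inf \<kappa>2 q * dual lam \<kappa>1 \<kappa>2 \<alpha> N k) has_sum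
      (qpoch_inf (q * \<alpha>^2) q * infsum (node_pole lam \<kappa>1 \<kappa>2 \<alpha> N) UNIV)) UNIV"
proof -
  define c where "c i = lam ^ i * eul i * (q powi (- N)) ^ i" for i
  define T where "T i j = qpoch_inf lam q * (hpoch lam q q j / qpoch q q j * (q powi (- N)) ^ j)
        / qpoch_inf (\<alpha>^2 * q ^ i * q ^ (2 * j)) q * (1 - \<alpha>^2 * q ^ (2 * i) * q ^ (2 * j))
        * (qpoch_inf (\<kappa>1 * q ^ j) q * qpoch_inf (\<kappa>2 * q ^ j) q)" for i j
  have "\<exists>S. ((\<lambda>j. node_pole lam \<kappa>1 \<kappa>2 \<alpha> N (i, j)) has_sum S) UNIV \<and> ((\<lambda>j. c i * T i j) has_sum S) UNIV" for i
  proof (rule superposition[OF al lam ka, of i])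
    fix S
    assume a: "((\<lambda>j. eul j * q ^ j * (1/2) * (\<Sum>\<epsilon>\<in>{1,-1}. nd \<kappa>1 \<kappa>2 N i j (\<epsilon> * (\<alpha> * p ^ (i + j)))
         * ratio lam (\<epsilon> * (\<alpha> * p ^ (i + j))))) has_sum S) UNIV"
      and b: "((\<lambda>j. qpoch_inf lam q * (hpoch lam q q j / qpoch q q j * (q powi (- N)) ^ j)
        / qpoch_inf (\<alpha>^2 * q ^ i * q ^ (2 * j)) q * (1 - \<alpha>^2 * q ^ (2 * i) * q ^ (2 * j))
        * (qpoch_inf (\<kappa>1 * q ^ j) q * qpoch_inf (\<kappa>2 * q ^ j) q)) has_sum S) UNIV"
    have "((\<lambda>j. node_pole lam \<kappa>1 \<kappa>2 \<alpha> N (i, j)) has_sum (c i * S)) UNIV"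
      using has_sum_cmult_right[OF a, of "c i"] unfolding node_pole_def c_def prod.case .
    moreover have "((\<lambda>j. c i * T i j) has_sum (c i * S)) UNIV"
      using has_sum_cmult_right[OF b, of "c i"] unfolding T_def .
    ultimately show ?thesis by blast
  qed
  then obtain S where S: "\<And>i. ((\<lambda>j. node_pole lam \<kappa>1 \<kappa>2 \<alpha> N (i, j)) has_sum S i) UNIV"
    "\<And>i. ((\<lambda>j. c i * T i j) has_sum S i) UNIV" by metis
  define R where "R = infsum (node_pole lam \<kappa>1 \<kappa>2 \<alpha> N) UNIV"
  have "(node_pole lam \<kappa>1 \<kappa>2 \<alpha> N has_sum R) (UNIV \<times> UNIV)"
    using sm by (simp add: R_def)
  then have SR: "(S has_sum R) UNIV"
    by (rule has_sum_SigmaD) (use S in auto)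

  have al2: "norm (\<alpha>^2) < 1" using al by (simp add: norm_power power_less_one_iff)
  obtain D1 where D1: "D1 > 0" "\<And>x. norm x \<le> norm \<kappa>1 + norm \<kappa>2 \<Longrightarrow> norm (qpoch_inf x q) \<le> D1"
    using qpoch_inf_bounded_on_disc[OF q(2)] by metis
  obtain D3 where D3: "D3 > 0" "\<And>x. norm x \<le> norm (\<alpha>^2) \<Longrightarrow> norm (1 / qpoch_inf x q) \<le> D3"
    using qpoch_inf_recip_bounded_on_disc[OF q(2) al2] by metis
  have "(\<lambda>z. case z of (i, j) \<Rightarrow> c i * T i j) summable_on UNIV \<times> UNIV"
  proof (rule abs_summable_summable, rule Infinite_Sum.abs_summable_on_comparison_test')
    let ?t = "\<lambda>j. norm (hpoch lam q q j / qpoch q q j * (q powi (- N)) ^ j)"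
    have s1: "?t summable_on UNIV"
      using hq_binomial_norm_summable[OF q(2) lam(2), of q]
      by (intro summable_nonneg_imp_summable_on) auto
    have s2: "(\<lambda>i. norm (c i)) summable_on UNIV"
    proof -
      have "c i = eul i * (lam * q powi (- N)) ^ i" for i
        by (simp add: c_def power_mult_distrib)
      then show ?thesis using summable_norm_eul[of "lam * q powi (- N)"] by simp
    qed
    show "(\<lambda>(i, j). norm (c i) * ((norm (qpoch_inf lam q) * D3 * 2 * (D1 * D1)) * ?t j)) summable_on UNIV \<times> UNIV"
      by (intro summable_on_times_prod s2 summable_on_cmult_right s1) (use D1 D3 in auto)
    fix z :: "nat \<times> nat"
    obtain i j where z: "z = (i, j)" by (cases z)
    have qn: "norm (q ^ m) \<le> 1" for m using q by (simp add: norm_power power_le_one)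
    have a: "norm (\<alpha>^2 * q ^ m * q ^ n) \<le> norm (\<alpha>^2)" for m n
    proof -
      have "norm (\<alpha>^2 * q ^ m * q ^ n) = norm (\<alpha>^2) * norm (q ^ (m + n))"
        by (simp add: norm_mult power_add)
      also have "\<dots> \<le> norm (\<alpha>^2)" using qn by (intro mult_left_le) auto
      finally show ?thesis .
    qed
    have b: "norm (1 - \<alpha>^2 * q ^ (2 * i) * q ^ (2 * j)) \<le> 2"
      using norm_triangle_ineq4[of 1 "\<alpha>^2 * q ^ (2 * i) * q ^ (2 * j)"] a[of "2 * i" "2 * j"] al2 by simp
    have k: "norm (\<kappa> * q ^ j) \<le> norm \<kappa>1 + norm \<kappa>2" if "\<kappa> = \<kappa>1 \<or> \<kappa> = \<kappa>2" for \<kappa>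
    proof -
      have "norm (\<kappa> * q ^ j) \<le> norm \<kappa>" using qn[of j] by (simp add: norm_mult mult_left_le)
      also have "norm \<kappa> \<le> norm \<kappa>1 + norm \<kappa>2" using that by auto
      finally show ?thesis .
    qed
    have "T i j = qpoch_inf lam q * (1 / qpoch_inf (\<alpha>^2 * q ^ i * q ^ (2 * j)) q) *
          (1 - \<alpha>^2 * q ^ (2 * i) * q ^ (2 * j)) * (qpoch_inf (\<kappa>1 * q ^ j) q * qpoch_inf (\<kappa>2 * q ^ j) q)
          * (hpoch lam q q j / qpoch q q j * (q powi (- N)) ^ j)"
      by (simp add: T_def mult_ac)
    then have "norm (T i j) = norm (qpoch_inf lam q) * norm (1 / qpoch_inf (\<alpha>^2 * q ^ i * q ^ (2 * j)) q) *
          norm (1 - \<alpha>^2 * q ^ (2 * i) * q ^ (2 * j)) * (norm (qpoch_inf (\<kappa>1 * q ^ j) q) * norm (qpoch_inf (\<kappa>2 * q ^ j) q)) * ?t j"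
      by (simp only: norm_mult)
    also have "\<dots> \<le> norm (qpoch_inf lam q) * D3 * 2 * (D1 * D1) * ?t j"
      using D1(1) D3(1) by (intro mult_mono mult_nonneg_nonneg order_refl D3(2) D1(2) a b k) auto
    finally show "norm (case z of (i, j) \<Rightarrow> c i * T i j) \<le> (case z of (i, j) \<Rightarrow>
        norm (c i) * ((norm (qpoch_inf lam q) * D3 * 2 * (D1 * D1)) * ?t j))"
      unfolding z prod.case norm_mult[of "c i"] by (intro mult_left_mono) auto
  qed
  then obtain R' where R': "((\<lambda>(i, j). c i * T i j) has_sum R') (UNIV \<times> UNIV)"
    by (auto simp: summable_on_def)
  then have "(S has_sum R') UNIV"
    by (rule has_sum_SigmaD) (use S in auto)
  then have "R' = R" using SR has_sum_unique by blast
  with R' have "((\<lambda>k. \<Sum>j\<le>k. c (k - j) * T (k - j) j) has_sum R) UNIV"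
    using has_sum_antidiagonal[OF R'] by simp
  from has_sum_cmult_right[OF this, of "qpoch_inf (q * \<alpha>^2) q"]
  have "((\<lambda>k. qpoch_inf (q * \<alpha>^2) q * (\<Sum>j\<le>k. c (k - j) * T (k - j) j)) has_sum (qpoch_inf (q * \<alpha>^2) q * R)) UNIV" .
  moreover have "qpoch_inf (q * \<alpha>^2) q * (\<Sum>j\<le>k. c (k - j) * T (k - j) j) =
     qpoch_inf lam q * qpoch_inf \<kappa>1 q * qpoch_inf \<kappa>2 q * dual lam \<kappa>1 \<kappa>2 \<alpha> N k" for k
  proof -
    have anz: "qpoch_inf (\<alpha>^2) q \<noteq> 0" by (rule qpoch_inf_nonzero[OF q(2) al2])
    have aknz: "qpoch_inf (\<alpha>^2 * q ^ k) q \<noteq> 0" by (rule qpoch_nonzero_of_inf(2)[OF q(2) anz])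
    define W where "W = qpoch_inf lam q * qpoch_inf \<kappa>1 q * qpoch_inf \<kappa>2 q * (q powi (- N)) ^ k
         * (1 - \<alpha>^2 * q ^ (2 * k)) / qpoch_inf (\<alpha>^2 * q ^ k) q"
    have "c (k - j) * T (k - j) j = W * (lam ^ (k - j) * hpoch 0 1 q (k - j) * hpoch lam q q j * qpoch (\<alpha>^2 * q ^ k) q j
            / (qpoch q q (k - j) * qpoch q q j * qpoch \<kappa>1 q j * qpoch \<kappa>2 q j))" if "j \<le> k" for j
    proof -
      define X where "X = q powi (- N)"
      have e1: "(\<alpha>^2 * q ^ (k - j) * q ^ (2 * j)) = \<alpha>^2 * q ^ k * q ^ j"
        "\<alpha>^2 * q ^ (2 * (k - j)) * q ^ (2 * j) = \<alpha>^2 * q ^ (2 * k)"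
      proof -
        have "k - j + 2 * j = k + j" "2 * (k - j) + 2 * j = 2 * k" using that by auto
        then show "\<alpha>^2 * q ^ (k - j) * q ^ (2 * j) = \<alpha>^2 * q ^ k * q ^ j"
          and "\<alpha>^2 * q ^ (2 * (k - j)) * q ^ (2 * j) = \<alpha>^2 * q ^ (2 * k)"
          by (simp_all only: mult.assoc power_add[symmetric])
      qed
      have e3: "X ^ (k - j) * X ^ j = X ^ k" using that by (simp flip: power_add)
      have k1: "qpoch_inf (\<kappa>1 * q ^ j) q = qpoch_inf \<kappa>1 q / qpoch \<kappa>1 q j"
        and k2: "qpoch_inf (\<kappa>2 * q ^ j) q = qpoch_inf \<kappa>2 q / qpoch \<kappa>2 q j"
        using qpoch_inf_split[OF q(2), of \<kappa>1 j] qpoch_inf_split[OF q(2), of \<kappa>2 j] kinf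
          qpoch_nonzero_of_inf(1)[OF q(2)] by (simp_all add: field_simps)
      have k3: "1 / qpoch_inf (\<alpha>^2 * q ^ k * q ^ j) q = qpoch (\<alpha>^2 * q ^ k) q j / qpoch_inf (\<alpha>^2 * q ^ k) q"
        using qpoch_inf_split[OF q(2), of "\<alpha>^2 * q ^ k" j] aknz by (auto simp: field_simps)
      have "c (k - j) * T (k - j) j = lam ^ (k - j) * eul (k - j) * (X ^ (k - j) * X ^ j) * qpoch_inf lam q *
         (hpoch lam q q j / qpoch q q j) * (1 / qpoch_inf (\<alpha>^2 * q ^ k * q ^ j) q) * (1 - \<alpha>^2 * q ^ (2 * k))
         * (qpoch_inf (\<kappa>1 * q ^ j) q * qpoch_inf (\<kappa>2 * q ^ j) q)"
        unfolding c_def T_def e1 X_def by (simp add: mult_ac)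
      then show ?thesis unfolding e3 k1 k2 k3 W_def eul_def unfolding X_def by (simp add: mult_ac)
    qed
    then have "(\<Sum>j\<le>k. c (k - j) * T (k - j) j) = W * (\<Sum>j\<le>k. lam ^ (k - j) * hpoch 0 1 q (k - j) * hpoch lam q q j * qpoch (\<alpha>^2 * q ^ k) q j
            / (qpoch q q (k - j) * qpoch q q j * qpoch \<kappa>1 q j * qpoch \<kappa>2 q j))"
      by (simp add: sum_distrib_left)
    also have "\<dots> = W * (hpoch 0 1 q k * q ^ k * qpoch (q * \<alpha>^2 / \<kappa>1) q k * qpoch (lam * \<kappa>1 / q) q k
            / (qpoch q q k * qpoch \<kappa>1 q k * qpoch \<kappa>2 q k))"
    proof -
      have "\<kappa>2 * \<kappa>1 * lam = q^2 * \<alpha>^2" using ka(3) by (simp add: mult_ac)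
      from q_saalschuetz[OF ka(1) lam(1) qpoch_nonzero_of_inf(1)[OF q(2) kinf(1)]
          qpoch_nonzero_of_inf(1)[OF q(2) kinf(2)] this, of k]
      show ?thesis by simp
    qed
    finally show ?thesis
      unfolding dual_def vwp_eq[OF anz] W_def eul_def by (simp add: mult_ac)
  qed
  ultimately show ?thesis by (simp add: R_def)
qed

section \<open>Analytic continuation of the coefficient identity\<close>

lemma holomorphic_qpoch_inf_compose [holomorphic_intros]:
  "f holomorphic_on A \<Longrightarrow> (\<lambda>x. qpoch_inf (f x) q) holomorphic_on A"
  "f holomorphic_on A \<Longrightarrow> (\<lambda>x. qpoch_inf (f x) p) holomorphic_on A"
  using holomorphic_on_compose[of f A "\<lambda>x. qpoch_inf x q"] holomorphic_qpoch_inf[OF q(2)]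
    holomorphic_on_compose[of f A "\<lambda>x. qpoch_inf x p"] holomorphic_qpoch_inf[OF p(2)]
  by (auto simp: o_def)

lemma holomorphic_qpoch_compose [holomorphic_intros]:
  "f holomorphic_on A \<Longrightarrow> (\<lambda>x. qpoch (f x) r n) holomorphic_on A"
  unfolding qpoch_def by (intro holomorphic_intros)

lemma holomorphic_node_entire:
  assumes "\<alpha> \<noteq> 0"
  shows "(\<lambda>\<tau>. node_entire (lam * \<tau>^2) \<kappa>1 \<kappa>2 (\<alpha> * \<tau>) N z) holomorphic_on - {0}"
  unfolding node_entire_def nd_def cofactor_def case_prod_unfold sum_signs
  using assms p by (intro holomorphic_intros) auto

text \<open>Two uses: the second part makes the coefficients well defined, the first one, with $\zeta = |z|$, permits summing
them over $N$.\<close>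

lemma norm_summable_node_entire:
  assumes al: "\<alpha> \<noteq> 0" and ka: "\<kappa>1 \<noteq> 0" "\<kappa>2 \<noteq> 0" "\<kappa>1 * \<kappa>2 * lam = q^2 * \<alpha>^2" and lam: "lam \<noteq> 0"
    and zeta: "\<zeta> > 0"
  shows "(\<lambda>(z, N). \<zeta> powi N * rho powi (N^2 - N) * norm (node_entire lam \<kappa>1 \<kappa>2 \<alpha> N z)) summable_on UNIV \<times> UNIV"
    and "(\<lambda>z. norm (node_entire lam \<kappa>1 \<kappa>2 \<alpha> N z)) summable_on UNIV"
proof -
  define k1 k2 A where "k1 = norm \<kappa>1 / norm \<alpha>" and "k2 = norm \<kappa>2 / norm \<alpha>" and "A = norm \<alpha> * \<zeta>"
  have A: "A > 0" "norm \<alpha> > 0" using al zeta by (auto simp: A_def)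
  obtain C where C: "C > 0" "\<And>\<alpha>' lam' N i j. norm \<alpha> \<le> norm \<alpha>' \<Longrightarrow> norm \<alpha>' \<le> norm \<alpha> \<Longrightarrow> norm lam' \<le> norm lam \<Longrightarrow>
     rho powi (N^2 - N) * norm (node_entire lam' \<kappa>1 \<kappa>2 \<alpha>' N (i, j)) \<le>
       C * (norm \<alpha>' / norm \<alpha>) powi N * majorant rho k1 k2 (norm lam) (norm \<alpha>) N (i, j)"
    unfolding k1_def k2_def using node_entire_bounded[OF A(2) ka(1,2), of "norm \<alpha>" "norm lam"] by metis
  have le: "\<zeta> powi N * rho powi (N^2 - N) * norm (node_entire lam \<kappa>1 \<kappa>2 \<alpha> N z) \<le>
       C * majorant rho k1 k2 (norm lam) A N z" for N z
  proof -
    obtain i j where z: "z = (i, j)" by (cases z)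
    have "\<zeta> powi N * (rho powi (N^2 - N) * norm (node_entire lam \<kappa>1 \<kappa>2 \<alpha> N z)) \<le>
        \<zeta> powi N * (C * majorant rho k1 k2 (norm lam) (norm \<alpha>) N z)"
      using C(2)[of \<alpha> lam N i j] al zeta unfolding z by (intro mult_left_mono) auto
    also have "\<zeta> powi N * (C * majorant rho k1 k2 (norm lam) (norm \<alpha>) N z) = C * majorant rho k1 k2 (norm lam) A N z"
      unfolding majorant_def z prod.case A_def by (simp add: power_int_mult_distrib mult_ac)
    finally show ?thesis by (simp only: mult.assoc)
  qed
  have cond: "k1 * k2 * norm lam < rho^2"
    unfolding k1_def k2_def by (rule majorant_condition[OF al ka(3)])
  have pos: "k1 > 0" "k2 > 0" "norm lam > 0"
    using al ka lam by (auto simp: k1_def k2_def)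
  show "(\<lambda>(z, N). \<zeta> powi N * rho powi (N^2 - N) * norm (node_entire lam \<kappa>1 \<kappa>2 \<alpha> N z)) summable_on UNIV \<times> UNIV"
  proof (rule summable_on_comparison_test)
    show "(\<lambda>(z, N). C * majorant rho k1 k2 (norm lam) A N z) summable_on UNIV \<times> UNIV"
      using summable_on_cmult_right[OF majorant_summable[OF rho pos A(1) cond], of C] by (simp add: case_prod_unfold)
  qed (use le zeta in auto)
  have "(\<lambda>z. \<zeta> powi N * rho powi (N^2 - N) * norm (node_entire lam \<kappa>1 \<kappa>2 \<alpha> N z)) summable_on UNIV"
  proof (rule summable_on_comparison_test)
    show "(\<lambda>z. C * majorant rho k1 k2 (norm lam) A N z) summable_on UNIV"
      by (intro summable_on_cmult_right majorant_summable_fixed[OF rho pos A(1) cond])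
  qed (use le zeta in auto)
  from summable_on_cmult_right[OF this, of "1 / (\<zeta> powi N * rho powi (N^2 - N))"]
  show "(\<lambda>z. norm (node_entire lam \<kappa>1 \<kappa>2 \<alpha> N z)) summable_on UNIV" using p zeta by simp
qed

lemma holomorphic_infsum_node_entire:
  assumes al: "\<alpha> \<noteq> 0" and ka: "\<kappa>1 \<noteq> 0" "\<kappa>2 \<noteq> 0" "\<kappa>1 * \<kappa>2 * lam = q^2 * \<alpha>^2" and lam: "lam \<noteq> 0"
  shows "(\<lambda>\<tau>. \<Sum>\<^sub>\<infinity>z. node_entire (lam * \<tau>^2) \<kappa>1 \<kappa>2 (\<alpha> * \<tau>) N z) holomorphic_on - {0}"
proof (rule holomorphic_on_infsum[OF _ holomorphic_node_entire[OF al]])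
  fix x :: complex assume "x \<in> - {0}"
  then have x: "norm x > 0" by simp
  \<comment> \<open>The ball is chosen so small that replacing the modulus of the parameter by its extreme
      values on the ball keeps the majorant summable.\<close>
  define t where "t = (1 - rho) / 2"
  have t: "0 < t" "t < 1" "rho * (1 + t) < 1 - t"
  proof -
    have "0 < (1 - r) / 2" "(1 - r) / 2 < 1" if "0 < r" "r < 1" for r :: real
      using that by simp_all
    from this[OF rho] show "0 < t" "t < 1" unfolding t_def by blast+
    have "0 < (1 - rho) * (1 - rho)" using rho by simp
    then show "rho * (1 + t) < 1 - t" by (simp add: t_def field_simps)
  qed
  define r1 r2 where "r1 = norm x * (1 - t)" and "r2 = norm x * (1 + t)"
  have r: "0 < r1" "r1 \<le> r2" "rho * r2 < r1"
  proof -
    show "0 < r1" using x t by (simp add: r1_def)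
    show "r1 \<le> r2" using x t by (simp add: r1_def r2_def)
    show "rho * r2 < r1" using mult_strict_left_mono[OF t(3) x] by (simp add: r1_def r2_def mult_ac)
  qed
  have ball: "r1 \<le> norm y" "norm y \<le> r2" if "y \<in> cball x (norm x * t)" for y
  proof -
    have d: "norm (x - y) \<le> norm x * t" using that by (simp add: dist_norm)
    show "r1 \<le> norm y" using norm_triangle_ineq2[of x y] d by (simp add: r1_def algebra_simps)
    show "norm y \<le> r2" using norm_triangle_ineq3[of x y] d by (simp add: r2_def algebra_simps abs_le_iff)
  qed
  define A1 A2 L where "A1 = norm \<alpha> * r1" and "A2 = norm \<alpha> * r2" and "L = norm lam * r2^2"
  have A1: "A1 > 0" using al r by (simp add: A1_def)
  obtain C where C: "C > 0" "\<And>\<alpha> lam N i j. A1 \<le> norm \<alpha> \<Longrightarrow> norm \<alpha> \<le> A2 \<Longrightarrow> norm lam \<le> L \<Longrightarrow>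
     rho powi (N^2 - N) * norm (node_entire lam \<kappa>1 \<kappa>2 \<alpha> N (i, j)) \<le>
       C * (norm \<alpha> / A1) powi N * majorant rho (norm \<kappa>1 / A1) (norm \<kappa>2 / A1) L A1 N (i, j)"
    using node_entire_bounded[OF A1 ka(1,2), of A2 L] by metis
  have "r2 > 0" using r by linarith
  then have pos: "norm \<kappa>1 / A1 > 0" "norm \<kappa>2 / A1 > 0" "L > 0"
    using A1 ka lam by (auto simp: L_def)
  have cond: "norm \<kappa>1 / A1 * (norm \<kappa>2 / A1) * L < rho^2"
  proof -
    have "norm \<kappa>1 / A1 * (norm \<kappa>2 / A1) * L = (norm \<kappa>1 / norm \<alpha> * (norm \<kappa>2 / norm \<alpha>) * norm lam) * (r2 / r1)^2"
      by (simp add: A1_def L_def power2_eq_square mult_ac)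
    also have "norm \<kappa>1 / norm \<alpha> * (norm \<kappa>2 / norm \<alpha>) * norm lam = rho^4"
    proof -
      have "norm \<kappa>1 * norm \<kappa>2 * norm lam = rho^4 * norm \<alpha>^2"
        using arg_cong[OF ka(3), of norm] by (simp add: norm_mult norm_power q_eq)
      then show ?thesis using al by (simp add: power2_eq_square field_simps)
    qed
    also have "rho^4 * (r2 / r1)^2 = rho^2 * (rho * r2 / r1)^2"
      by (simp add: power_mult_distrib power_divide power2_eq_square power4_eq_xxxx)
    also have "(rho * r2 / r1)^2 < 1"
      using r rho \<open>r2 > 0\<close> by (simp add: power_less_one_iff)
    then have "rho^2 * (rho * r2 / r1)^2 < rho^2" using rho by simp
    finally show ?thesis .
  qed
  define c where "c = (1 powi N + (r2 / r1) powi N)"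
  have cN: "u powi N \<le> c" if u: "1 \<le> u" "u \<le> r2 / r1" for u
  proof (cases "N \<ge> 0")
    case True
    then have "u powi N \<le> (r2 / r1) powi N" using u by (intro power_int_mono) auto
    then show ?thesis by (simp add: c_def)
  next
    case False
    then have "u powi N \<le> 1" using u by (simp add: power_int_def inverse_le_1_iff power_inverse one_le_power)
    moreover have "(r2 / r1) powi N > 0" using r \<open>r2 > 0\<close> by simp
    ultimately show ?thesis by (simp add: c_def)
  qed
  define M where "M = (\<lambda>z. (C * c / rho powi (N^2 - N)) * majorant rho (norm \<kappa>1 / A1) (norm \<kappa>2 / A1) L A1 N z)"
  show "\<exists>d>0. \<exists>M. cball x d \<subseteq> - {0} \<and> M summable_on UNIV \<and>
      (\<forall>i. \<forall>y\<in>cball x d. norm (node_entire (lam * y^2) \<kappa>1 \<kappa>2 (\<alpha> * y) N i) \<le> M i)"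
  proof (intro exI[of _ "norm x * t"] exI[of _ M] conjI allI ballI)
    show "norm x * t > 0" using x t by simp
    show "cball x (norm x * t) \<subseteq> - {0}" using ball(1)[of 0] r by auto
    show "M summable_on UNIV" unfolding M_def
      by (intro summable_on_cmult_right majorant_summable_fixed[OF rho pos A1 cond])
    fix z y assume y: "y \<in> cball x (norm x * t)"
    have a: "A1 \<le> norm (\<alpha> * y)" "norm (\<alpha> * y) \<le> A2" "norm (lam * y^2) \<le> L"
      using ball[OF y] by (auto simp: A1_def A2_def L_def norm_mult norm_power intro!: mult_left_mono power_mono)
    have m0: "majorant rho (norm \<kappa>1 / A1) (norm \<kappa>2 / A1) L A1 N z \<ge> 0"
      by (rule majorant_nonneg[OF rho pos A1])
    have "(norm (\<alpha> * y) / A1) powi N \<le> c"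
      using ball[OF y] r al by (intro cN) (auto simp: A1_def norm_mult field_simps)
    then have "C * (norm (\<alpha> * y) / A1) powi N * majorant rho (norm \<kappa>1 / A1) (norm \<kappa>2 / A1) L A1 N z
       \<le> C * c * majorant rho (norm \<kappa>1 / A1) (norm \<kappa>2 / A1) L A1 N z"
      using C(1) m0 by (intro mult_right_mono mult_left_mono) auto
    with C(2)[OF a, of N "fst z" "snd z"]
    have "rho powi (N^2 - N) * norm (node_entire (lam * y^2) \<kappa>1 \<kappa>2 (\<alpha> * y) N z)
       \<le> C * c * majorant rho (norm \<kappa>1 / A1) (norm \<kappa>2 / A1) L A1 N z" by simp
    then show "norm (node_entire (lam * y^2) \<kappa>1 \<kappa>2 (\<alpha> * y) N z) \<le> M z"
      using p unfolding M_def by (simp add: field_simps)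
  qed
qed auto

lemma qpoch_recip_bounded:
  assumes "qpoch_inf \<kappa> q \<noteq> 0"
  obtains D where "D > 0" "\<And>k. norm (1 / qpoch \<kappa> q k) \<le> D"
proof -
  have "(\<lambda>n. 1 / qpoch \<kappa> q n) \<longlonglongrightarrow> 1 / qpoch_inf \<kappa> q"
    by (intro tendsto_intros qpoch_LIMSEQ q assms)
  then have "Bseq (\<lambda>n. 1 / qpoch \<kappa> q n)" by (intro convergent_imp_Bseq convergentI)
  then show ?thesis using that by (auto simp: Bseq_def)
qed

lemma vwp_bounded:
  assumes "norm a \<le> R"
  shows "norm (vwp a k) \<le> (1 + R) * exp (R / (1 - norm q))"
proof -
  have R: "R \<ge> 0" using assms norm_ge_zero[of a] by linarith
  have qn: "norm (q ^ m) \<le> 1" for m using q by (simp add: norm_power power_le_one)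
  have e: "1 \<le> exp (R / (1 - norm q))" using R q by simp
  show ?thesis
  proof (cases "k = 0")
    case True
    have "1 * 1 \<le> (1 + R) * exp (R / (1 - norm q))" using R e by (intro mult_mono) auto
    then show ?thesis using True by (simp add: vwp_def)
  next
    case False
    have "norm (a * q ^ (2 * k)) \<le> norm a" using qn by (simp add: norm_mult mult_left_le)
    then have "norm (1 - a * q ^ (2 * k)) \<le> 1 + R"
      using norm_triangle_ineq4[of 1 "a * q ^ (2 * k)"] assms by simp
    moreover have "norm (a * q) \<le> R"
      using assms mult_left_le[of "norm q" "norm a"] q by (simp add: norm_mult)
    ultimately show ?thesis
      using False R unfolding vwp_def
      by (simp add: norm_mult) (intro mult_mono norm_qpoch_le q, auto simp: norm_mult)
  qed
qed

lemma weight_bounded: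
  assumes ka: "\<kappa>1 \<noteq> 0" and kinf: "qpoch_inf \<kappa>1 q \<noteq> 0" "qpoch_inf \<kappa>2 q \<noteq> 0"
  obtains D where "D > 0" "\<And>\<alpha> lam k. norm \<alpha> \<le> A \<Longrightarrow> norm lam \<le> L \<Longrightarrow>
     norm (vwp (\<alpha>^2) k * (qpoch (q * \<alpha>^2 / \<kappa>1) q k * qpoch (lam * \<kappa>1 / q) q k / (qpoch \<kappa>1 q k * qpoch \<kappa>2 q k))) \<le> D"
proof -
  obtain D1 where D1: "D1 > 0" "\<And>k. norm (1 / qpoch \<kappa>1 q k) \<le> D1" using qpoch_recip_bounded[OF kinf(1)] by metis
  obtain D2 where D2: "D2 > 0" "\<And>k. norm (1 / qpoch \<kappa>2 q k) \<le> D2" using qpoch_recip_bounded[OF kinf(2)] by metis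
  define R1 where "R1 = norm q * A^2 / norm \<kappa>1"
  define R2 where "R2 = L * norm \<kappa>1 / norm q"
  define E where "E R = exp (R / (1 - norm q))" for R
  show ?thesis
  proof (rule that[of "((1 + A^2) * E (A^2)) * (E R1 * E R2 * (D1 * D2))"])
    show "((1 + A^2) * E (A^2)) * (E R1 * E R2 * (D1 * D2)) > 0"
      using D1 D2 by (auto simp: E_def intro!: mult_pos_pos add_pos_nonneg)
    fix \<alpha> lam :: complex and k assume al: "norm \<alpha> \<le> A" and lam: "norm lam \<le> L"
    have a2: "norm (\<alpha>^2) \<le> A^2" using al by (simp add: norm_power power_mono)
    have 1: "norm (q * \<alpha>^2 / \<kappa>1) \<le> R1"
      unfolding R1_def norm_divide norm_mult using a2 by (intro divide_right_mono mult_left_mono) auto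
    have 2: "norm (lam * \<kappa>1 / q) \<le> R2"
      unfolding R2_def norm_divide norm_mult using lam by (intro divide_right_mono mult_right_mono) auto
    have "vwp (\<alpha>^2) k * (qpoch (q * \<alpha>^2 / \<kappa>1) q k * qpoch (lam * \<kappa>1 / q) q k / (qpoch \<kappa>1 q k * qpoch \<kappa>2 q k))
      = vwp (\<alpha>^2) k * (qpoch (q * \<alpha>^2 / \<kappa>1) q k * qpoch (lam * \<kappa>1 / q) q k
       * ((1 / qpoch \<kappa>1 q k) * (1 / qpoch \<kappa>2 q k)))"
      by simp
    then have "norm (vwp (\<alpha>^2) k * (qpoch (q * \<alpha>^2 / \<kappa>1) q k * qpoch (lam * \<kappa>1 / q) q k / (qpoch \<kappa>1 q k * qpoch \<kappa>2 q k)))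
      = norm (vwp (\<alpha>^2) k) * (norm (qpoch (q * \<alpha>^2 / \<kappa>1) q k) * norm (qpoch (lam * \<kappa>1 / q) q k)
       * (norm (1 / qpoch \<kappa>1 q k) * norm (1 / qpoch \<kappa>2 q k)))"
      by (simp only: norm_mult)
    also have "\<dots> \<le> ((1 + A^2) * E (A^2)) * (E R1 * E R2 * (D1 * D2))"
      unfolding E_def using D1(1) D2(1)
      by (intro mult_mono vwp_bounded a2 norm_qpoch_le q 1 2 D1(2) D2(2) mult_nonneg_nonneg add_nonneg_nonneg) auto
    finally show "norm (vwp (\<alpha>^2) k * (qpoch (q * \<alpha>^2 / \<kappa>1) q k * qpoch (lam * \<kappa>1 / q) q k / (qpoch \<kappa>1 q k * qpoch \<kappa>2 q k)))
      \<le> ((1 + A^2) * E (A^2)) * (E R1 * E R2 * (D1 * D2))" .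
  qed
qed

lemma dual_bounded:
  assumes ka: "\<kappa>1 \<noteq> 0" and kinf: "qpoch_inf \<kappa>1 q \<noteq> 0" "qpoch_inf \<kappa>2 q \<noteq> 0"
  obtains D where "D > 0" "\<And>\<alpha> lam N k. norm \<alpha> \<le> A \<Longrightarrow> norm lam \<le> L \<Longrightarrow>
     norm (dual lam \<kappa>1 \<kappa>2 \<alpha> N k) \<le> D * norm (eul k * (q powi (1 - N)) ^ k)"
proof -
  obtain D where D: "D > 0" "\<And>\<alpha> lam k. norm \<alpha> \<le> A \<Longrightarrow> norm lam \<le> L \<Longrightarrow>
     norm (vwp (\<alpha>^2) k * (qpoch (q * \<alpha>^2 / \<kappa>1) q k * qpoch (lam * \<kappa>1 / q) q k / (qpoch \<kappa>1 q k * qpoch \<kappa>2 q k))) \<le> D"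
    using weight_bounded[OF assms, of A L] by metis
  show ?thesis
  proof (rule that[of D])
    fix \<alpha> lam :: complex and N k assume "norm \<alpha> \<le> A" and "norm lam \<le> L"
    have "q powi (1 - N) = q powi (- N) * q" using powi_add(2)[of "- N" 1] by simp
    then have "dual lam \<kappa>1 \<kappa>2 \<alpha> N k = vwp (\<alpha>^2) k * (qpoch (q * \<alpha>^2 / \<kappa>1) q k * qpoch (lam * \<kappa>1 / q) q k
       / (qpoch \<kappa>1 q k * qpoch \<kappa>2 q k)) * (eul k * (q powi (1 - N)) ^ k)"
      by (simp add: dual_def power_mult_distrib mult_ac)
    also have "norm \<dots> \<le> D * norm (eul k * (q powi (1 - N)) ^ k)"
      unfolding norm_mult[of _ "eul k * (q powi (1 - N)) ^ k"]
      by (intro mult_right_mono D(2) norm_ge_zero) fact+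
    finally show "norm (dual lam \<kappa>1 \<kappa>2 \<alpha> N k) \<le> D * norm (eul k * (q powi (1 - N)) ^ k)" .
  qed fact
qed

lemma summable_dual:
  assumes ka: "\<kappa>1 \<noteq> 0" and kinf: "qpoch_inf \<kappa>1 q \<noteq> 0" "qpoch_inf \<kappa>2 q \<noteq> 0"
  shows "dual lam \<kappa>1 \<kappa>2 \<alpha> N summable_on UNIV"
proof -
  obtain D where D: "D > 0" "\<And>\<alpha>' lam' N k. norm \<alpha>' \<le> norm \<alpha> \<Longrightarrow> norm lam' \<le> norm lam \<Longrightarrow>
     norm (dual lam' \<kappa>1 \<kappa>2 \<alpha>' N k) \<le> D * norm (eul k * (q powi (1 - N)) ^ k)"
    using dual_bounded[OF assms] by metis
  show ?thesis
  proof (rule abs_summable_summable, rule Infinite_Sum.abs_summable_on_comparison_test')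
    show "(\<lambda>k. D * norm (eul k * (q powi (1 - N)) ^ k)) summable_on UNIV"
      by (intro summable_on_cmult_right summable_norm_eul)
  qed (use D(2)[of \<alpha> lam N] in auto)
qed

lemma holomorphic_infsum_dual:
  assumes ka: "\<kappa>1 \<noteq> 0" and kinf: "qpoch_inf \<kappa>1 q \<noteq> 0" "qpoch_inf \<kappa>2 q \<noteq> 0"
  shows "(\<lambda>\<tau>. \<Sum>\<^sub>\<infinity>k. dual (lam * \<tau>^2) \<kappa>1 \<kappa>2 (\<alpha> * \<tau>) N k) holomorphic_on UNIV"
proof (rule holomorphic_on_infsum)
  show "(\<lambda>\<tau>. dual (lam * \<tau>^2) \<kappa>1 \<kappa>2 (\<alpha> * \<tau>) N k) holomorphic_on UNIV" for k
  proof (cases "k = 0")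
    case True
    then show ?thesis by (simp add: dual_def vwp_def)
  next
    case False
    then show ?thesis unfolding dual_def vwp_def
      using q ka qpoch_nonzero_of_inf(1)[OF q(2) kinf(1)] qpoch_nonzero_of_inf(1)[OF q(2) kinf(2)]
      by (simp only: if_False) (intro holomorphic_intros, auto)
  qed
  fix x :: complex
  define r where "r = norm x + 1"
  obtain D where D: "D > 0" "\<And>\<alpha>' lam' N k. norm \<alpha>' \<le> norm \<alpha> * r \<Longrightarrow> norm lam' \<le> norm lam * r^2 \<Longrightarrow>
     norm (dual lam' \<kappa>1 \<kappa>2 \<alpha>' N k) \<le> D * norm (eul k * (q powi (1 - N)) ^ k)"
    using dual_bounded[OF assms] by metis
  show "\<exists>d>0. \<exists>M. cball x d \<subseteq> UNIV \<and> M summable_on UNIV \<and>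
      (\<forall>k. \<forall>y\<in>cball x d. norm (dual (lam * y^2) \<kappa>1 \<kappa>2 (\<alpha> * y) N k) \<le> M k)"
  proof (intro exI[of _ 1] exI[of _ "\<lambda>k. D * norm (eul k * (q powi (1 - N)) ^ k)"] conjI allI ballI)
    show "(\<lambda>k. D * norm (eul k * (q powi (1 - N)) ^ k)) summable_on UNIV"
      by (intro summable_on_cmult_right summable_norm_eul)
    fix k y assume "y \<in> cball x 1"
    then have "norm y \<le> r" using norm_triangle_ineq3[of x y] by (simp add: r_def dist_norm abs_le_iff)
    then show "norm (dual (lam * y^2) \<kappa>1 \<kappa>2 (\<alpha> * y) N k) \<le> D * norm (eul k * (q powi (1 - N)) ^ k)"
      by (intro D(2)) (auto simp: norm_mult norm_power intro!: mult_left_mono power_mono)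
  qed auto
qed auto

text \<open>Both sides are holomorphic in $\tau$ on the connected punctured plane after $\alpha \mapsto \alpha\tau$ and
$\lambda \mapsto \lambda\tau^2$, and they agree for small $\tau$.\<close>

theorem coefficient_identity:
  assumes al: "\<alpha> \<noteq> 0" and lam: "lam \<noteq> 0"
    and ka: "\<kappa>1 \<noteq> 0" "\<kappa>2 \<noteq> 0" "\<kappa>1 * \<kappa>2 * lam = q^2 * \<alpha>^2"
    and kinf: "qpoch_inf \<kappa>1 q \<noteq> 0" "qpoch_inf \<kappa>2 q \<noteq> 0"
  shows "(\<Sum>\<^sub>\<infinity>z. node_entire lam \<kappa>1 \<kappa>2 \<alpha> N z)
       = qpoch_inf lam q * qpoch_inf \<kappa>1 q * qpoch_inf \<kappa>2 q * (\<Sum>\<^sub>\<infinity>k. dual lam \<kappa>1 \<kappa>2 \<alpha> N k)"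
proof -
  define F where "F \<tau> = (\<Sum>\<^sub>\<infinity>z. node_entire (lam * \<tau>^2) \<kappa>1 \<kappa>2 (\<alpha> * \<tau>) N z)" for \<tau>
  define G where "G \<tau> = qpoch_inf (lam * \<tau>^2) q * qpoch_inf \<kappa>1 q * qpoch_inf \<kappa>2 q
      * (\<Sum>\<^sub>\<infinity>k. dual (lam * \<tau>^2) \<kappa>1 \<kappa>2 (\<alpha> * \<tau>) N k)" for \<tau>
  \<comment> \<open>Below $\delta \le 1$ both $|\alpha\tau|$ and $|\lambda\tau^2q^{-N}|$ are less than one, as the small case demands.\<close>
  define \<delta> where "\<delta> = 1 / (1 + norm \<alpha> + norm (lam * q powi (- N)))"
  have d0: "\<delta> > 0" unfolding \<delta>_def by (simp add: add_pos_nonneg)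
  have "F 1 = G 1"
  proof (rule analytic_continuation_open[of "ball 0 \<delta> - {0}" "- {0}" F G])
    show "open (ball 0 \<delta> - {0 :: complex})" by (intro open_Diff) auto
    show "ball 0 \<delta> - {0 :: complex} \<noteq> {}"
    proof -
      have "of_real (\<delta> / 2) \<in> ball 0 \<delta> - {0 :: complex}" using d0 by simp
      then show ?thesis by blast
    qed
    show "connected (- {0 :: complex})"
      using connected_open_delete_finite[OF open_UNIV connected_UNIV, of "{0 :: complex}"]
      by (simp add: Compl_eq_Diff_UNIV)
    show "F holomorphic_on - {0}"
      unfolding F_def by (rule holomorphic_infsum_node_entire[OF al ka lam])
    show "G holomorphic_on - {0}"
      unfolding G_def
      by (intro holomorphic_intros holomorphic_on_subset[OF holomorphic_infsum_dual[OF ka(1) kinf]]) auto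
  next
    fix \<tau> assume "\<tau> \<in> ball 0 \<delta> - {0 :: complex}"
    then have t0: "\<tau> \<noteq> 0" and t: "norm \<tau> < \<delta>" by auto
    define w where "w = 1 + norm \<alpha> + norm (lam * q powi (- N))"
    have w: "w \<ge> 1" "norm \<alpha> \<le> w" "norm (lam * q powi (- N)) \<le> w" by (auto simp: w_def)
    have "\<delta> = 1 / w" by (simp add: \<delta>_def w_def)
    then have "\<delta> * w = 1" using w(1) by simp
    then have tw: "norm \<tau> * w < 1" using mult_strict_right_mono[OF t, of w] w(1) by linarith
    have t1: "norm \<tau> \<le> 1" using tw mult_left_mono[OF w(1) norm_ge_zero[of \<tau>]] by linarith
    have al1: "norm (\<alpha> * \<tau>) < 1"
    proof -
      have "norm (\<alpha> * \<tau>) \<le> norm \<tau> * w" using mult_left_mono[OF w(2) norm_ge_zero[of \<tau>]]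
        by (simp add: norm_mult mult.commute)
      then show ?thesis using tw by linarith
    qed
    have lam1: "norm (lam * \<tau>^2 * q powi (- N)) < 1"
    proof -
      have "norm (lam * \<tau>^2 * q powi (- N)) = norm \<tau> * (norm \<tau> * norm (lam * q powi (- N)))"
        by (simp add: norm_mult norm_power power2_eq_square mult_ac)
      also have "\<dots> \<le> norm \<tau> * (1 * w)" using t1 w by (intro mult_left_mono mult_mono) auto
      finally show ?thesis using tw by simp
    qed
    have ka': "\<kappa>1 * \<kappa>2 * (lam * \<tau>^2) = q^2 * (\<alpha> * \<tau>)^2"
      using ka(3) by (simp add: power_mult_distrib mult_ac)
    have lam0: "lam * \<tau>^2 \<noteq> 0" and al0: "\<alpha> * \<tau> \<noteq> 0" using lam al t0 by auto
    have qa: "qpoch_inf (q * (\<alpha> * \<tau>)^2) q \<noteq> 0"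
    proof (rule qpoch_inf_nonzero[OF q(2)])
      have "norm ((\<alpha> * \<tau>)^2) < 1" using al1 unfolding norm_power by (intro power_less_one_iff[THEN iffD2]) auto
      then have "norm q * norm ((\<alpha> * \<tau>)^2) \<le> norm q * 1" by (intro mult_left_mono) auto
      then show "norm (q * (\<alpha> * \<tau>)^2) < 1"
        unfolding norm_mult[of q] using q by linarith
    qed
    have ne: "node_entire (lam * \<tau>^2) \<kappa>1 \<kappa>2 (\<alpha> * \<tau>) N z =
        qpoch_inf (q * (\<alpha> * \<tau>)^2) q * node_pole (lam * \<tau>^2) \<kappa>1 \<kappa>2 (\<alpha> * \<tau>) N z" for z
      by (rule node_entire_eq[OF qa])
    have "(\<lambda>z. node_entire (lam * \<tau>^2) \<kappa>1 \<kappa>2 (\<alpha> * \<tau>) N z) summable_on UNIV"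
      by (rule abs_summable_summable[OF norm_summable_node_entire(2)[OF al0 ka(1,2) ka' lam0 zero_less_one]])
    from summable_on_cmult_right[OF this, of "1 / qpoch_inf (q * (\<alpha> * \<tau>)^2) q"]
    have sm: "node_pole (lam * \<tau>^2) \<kappa>1 \<kappa>2 (\<alpha> * \<tau>) N summable_on UNIV"
      unfolding ne using qa by simp
    have "G \<tau> = qpoch_inf (q * (\<alpha> * \<tau>)^2) q * infsum (node_pole (lam * \<tau>^2) \<kappa>1 \<kappa>2 (\<alpha> * \<tau>) N) UNIV"
      unfolding G_def
      using infsumI[OF coefficient_identity_small[OF al0 al1 lam0 lam1 ka(1,2) ka' kinf sm]]
        infsum_cmult_right[OF summable_dual[OF ka(1) kinf]] by simp
    also have "\<dots> = F \<tau>"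
      unfolding F_def ne by (rule infsum_cmult_right[symmetric, OF sm])
    finally show "F \<tau> = G \<tau>" ..
  qed auto
  then show ?thesis by (simp add: F_def G_def)
qed

section \<open>The expansion over the nodes\<close>

lemma finite_q_binomial:
  "(\<Sum>j\<le>M. w ^ (M - j) * hpoch 0 1 q j * x ^ j / (qpoch q q (M - j) * qpoch q q j))
     = hpoch w x q M / qpoch q q M"
proof (induction M)
  case (Suc M)
  define t where "t M j = w ^ (M - j) * hpoch 0 1 q j * x ^ j / (qpoch q q (M - j) * qpoch q q j)" for M j
  define u where "u j = (if j = 0 then 0 else - x * q ^ M * t M (j - 1))" for j
  have nz: "1 - q * q ^ n \<noteq> 0" for n by (rule one_minus_q_pow_nonzero)
  have step: "(1 - q ^ Suc M) * t (Suc M) j = (if j \<le> M then w * t M j else 0) + u j" if "j \<le> Suc M" for j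
  proof -
    have a: "(1 - q ^ (Suc M - j)) * t (Suc M) j = (if j \<le> M then w * t M j else 0)"
    proof (cases "j \<le> M")
      case True
      then have "Suc M - j = Suc (M - j)" by simp
      then show ?thesis using True nz[of "M - j"] by (simp add: t_def qpoch_Suc)
    next
      case False
      then show ?thesis using that by (simp add: le_Suc_eq)
    qed
    have b: "q ^ (Suc M - j) * (1 - q ^ j) * t (Suc M) j = u j"
    proof (cases j)
      case (Suc l)
      have "q ^ (M - l) * q ^ l = q ^ M" using that Suc by (simp flip: power_add)
      then show ?thesis using Suc nz[of l] by (simp add: u_def t_def qpoch_Suc hpoch_Suc mult_ac)
    qed (simp add: u_def)
    have "q ^ (Suc M - j) * q ^ j = q ^ Suc M" using that by (simp flip: power_add)
    then have "(1 - q ^ Suc M) = (1 - q ^ (Suc M - j)) + q ^ (Suc M - j) * (1 - q ^ j)"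
      by (simp add: algebra_simps)
    then show ?thesis using a b by (simp only: distrib_right)
  qed
  have "(1 - q ^ Suc M) * (\<Sum>j\<le>Suc M. t (Suc M) j) = (\<Sum>j\<le>Suc M. (if j \<le> M then w * t M j else 0) + u j)"
    unfolding sum_distrib_left by (intro sum.cong step) auto
  also have "\<dots> = (\<Sum>j\<le>M. w * t M j) + (\<Sum>j\<le>Suc M. u j)"
    by (simp add: sum.distrib)
  also have "(\<Sum>j\<le>Suc M. u j) = (\<Sum>j\<le>M. - x * q ^ M * t M j)"
    by (simp only: sum.atMost_Suc_shift) (simp add: u_def)
  also have "(\<Sum>j\<le>M. w * t M j) + (\<Sum>j\<le>M. - x * q ^ M * t M j) = (w - x * q ^ M) * (\<Sum>j\<le>M. t M j)"
    by (simp add: sum_distrib_left sum.distrib[symmetric] algebra_simps)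
  also have "(\<Sum>j\<le>M. t M j) = hpoch w x q M / qpoch q q M"
    using Suc by (simp add: t_def)
  finally have "(1 - q * q ^ M) * (\<Sum>j\<le>Suc M. t (Suc M) j) = (w - x * q ^ M) * (hpoch w x q M / qpoch q q M)"
    by simp
  then have "(\<Sum>j\<le>Suc M. t (Suc M) j) = (w - x * q ^ M) * (hpoch w x q M / qpoch q q M) / (1 - q * q ^ M)"
    using nz[of M] by (metis nonzero_mult_div_cancel_left)
  then show ?case unfolding t_def by (simp add: hpoch_Suc qpoch_Suc mult_ac)
qed auto

text \<open>The polynomial in $w = \lambda zs/q$ that collects the pairs $(i,j)$ with $i + j = M$, all of which share the nodes
$\pm\alpha p^M$.\<close>

definition bracket :: "nat \<Rightarrow> complex \<Rightarrow> complex" where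
  "bracket M w = (\<Sum>j\<le>M. w ^ (M - j) / qpoch q q (M - j) * (eul j * (q ^ j - q ^ (M - j))))"

lemma bracket_0: "bracket 0 w = 0"
  by (simp add: bracket_def)

lemma bracket_diff: "bracket M w = (hpoch w q q M - hpoch (q * w) 1 q M) / qpoch q q M"
proof -
  have "bracket M w = (\<Sum>j\<le>M. w ^ (M - j) * hpoch 0 1 q j * q ^ j / (qpoch q q (M - j) * qpoch q q j))
      - (\<Sum>j\<le>M. (q * w) ^ (M - j) * hpoch 0 1 q j * 1 ^ j / (qpoch q q (M - j) * qpoch q q j))"
    unfolding bracket_def sum_subtractf[symmetric]
    by (intro sum.cong refl) (simp add: eul_def power_mult_distrib diff_divide_distrib algebra_simps)
  then show ?thesis unfolding finite_q_binomial by (simp add: diff_divide_distrib)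
qed

lemma bracket_1: "bracket 1 w = 1 + w"
proof -
  have "1 - q \<noteq> 0" using one_minus_q_pow_nonzero[of 0] by simp
  then show ?thesis unfolding bracket_diff
    by (simp add: hpoch_def qpoch_def divide_eq_eq) (simp add: algebra_simps)
qed

text \<open>The two products given by the finite $q$-binomial theorem have a long common factor.\<close>

lemma bracket_Suc_Suc:
  "bracket (Suc (Suc n)) w = (w^2 - q ^ Suc n) * hpoch w q q n / qpoch q q (Suc n)"
proof -
  have h1: "hpoch w q q (Suc (Suc n)) = hpoch w q q n * (w - q * q ^ n) * (w - q * q ^ Suc n)"
    by (simp add: hpoch_Suc)
  have "hpoch (q * w) 1 q m = q ^ m * hpoch w (1 / q) q m" for m
    using q by (induction m) (simp_all add: hpoch_Suc algebra_simps)
  moreover have "hpoch w (1 / q) q (Suc (Suc m)) = (w - 1 / q) * (w - 1) * hpoch w q q m" for m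
  proof (induction m)
    case 0
    then show ?case using q by (simp add: hpoch_Suc)
  next
    case (Suc m)
    have e: "1 / q * q ^ Suc (Suc m) = q * q ^ m" using q by simp
    show ?case
      unfolding hpoch_Suc[of w "1 / q" q "Suc (Suc m)"] Suc hpoch_Suc[of w q q m] e by (simp only: mult_ac)
  qed
  ultimately have h2: "hpoch (q * w) 1 q (Suc (Suc n)) = q ^ Suc (Suc n) * ((w - 1 / q) * (w - 1) * hpoch w q q n)"
    by metis
  have "hpoch w q q (Suc (Suc n)) - hpoch (q * w) 1 q (Suc (Suc n))
      = hpoch w q q n * ((w^2 - q ^ Suc n) * (1 - q * q ^ Suc n))"
    unfolding h1 h2 using q by (simp add: power2_eq_square field_simps)
  moreover have "qpoch q q (Suc (Suc n)) = qpoch q q (Suc n) * (1 - q * q ^ Suc n)" by (rule qpoch_Suc)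
  ultimately show ?thesis unfolding bracket_diff using one_minus_q_pow_nonzero[of "Suc n"] by simp
qed

text \<open>Summing the factor $q^{-Ni}$ over $N$ moves the argument of the theta function to $x/q^i$; quasi-periodicity moves it
back and cancels the Gaussian in Euler's coefficient.\<close>

lemma eul_qtheta:
  assumes "x \<noteq> 0"
  shows "eul i * qtheta (x / q ^ i) q = (x / q) ^ i / qpoch q q i * qtheta x q"
proof (induction i)
  case (Suc i)
  define y where "y = x / q ^ Suc i"
  have y: "y \<noteq> 0" "q * y = x / q ^ i" using assms q by (auto simp: y_def)
  have t: "qtheta y q = - y * qtheta (x / q ^ i) q"
    using qtheta_q_mult[OF y(1)] y by simp
  have "eul (Suc i) = eul i * (- (q ^ i)) / (1 - q * q ^ i)"
    by (simp add: eul_def hpoch_Suc qpoch_Suc)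
  then have "eul (Suc i) * qtheta y q = (q ^ i * y / (1 - q * q ^ i)) * (eul i * qtheta (x / q ^ i) q)"
    unfolding t by simp
  also have "q ^ i * y = x / q" using q by (simp add: y_def)
  finally show ?case unfolding Suc y_def by (simp add: qpoch_Suc mult_ac)
qed (simp add: eul_def)

text \<open>The factor that depends on $i$ and $j$ through $M = i + j$ alone, multiplied by $(q\alpha^2;q)_\infty$ to clear
the poles.\<close>

definition node_kernel :: "complex \<Rightarrow> complex \<Rightarrow> complex \<Rightarrow> complex \<Rightarrow> complex \<Rightarrow> nat \<Rightarrow> complex \<Rightarrow> complex" where
  "node_kernel lam \<kappa>1 \<kappa>2 \<alpha> z M \<epsilon> = qpoch_inf (\<kappa>1 / (\<epsilon> * (\<alpha> * p ^ M))) q * qpoch_inf (\<kappa>2 / (\<epsilon> * (\<alpha> * p ^ M))) q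
      * (qpoch_inf (lam * (\<epsilon> * (\<alpha> * p ^ M))) q * cofactor \<epsilon> \<alpha> M) * qtheta (z * (\<epsilon> * (\<alpha> * p ^ M))) q"

text \<open>Multiply \<open>coefficient_identity\<close> by the $N$-th theta coefficient and $z^N$, and sum over $N$. On the node side
the triple product restores $\vartheta(zs;q)$, and collecting $i + j = M$ produces the bracket; on the other side it
restores $\vartheta(z;q)$ times the very-well-poised series.\<close>

theorem node_expansion:
  assumes al: "\<alpha> \<noteq> 0" and lam: "lam \<noteq> 0"
    and ka: "\<kappa>1 \<noteq> 0" "\<kappa>2 \<noteq> 0" "\<kappa>1 * \<kappa>2 * lam = q^2 * \<alpha>^2"
    and kinf: "qpoch_inf \<kappa>1 q \<noteq> 0" "qpoch_inf \<kappa>2 q \<noteq> 0"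
    and z: "z \<noteq> 0" "norm z < 1"
  obtains S where
    "((\<lambda>M. (1/2) * (\<Sum>\<epsilon>\<in>{1,-1}. bracket M (lam * z * (\<epsilon> * (\<alpha> * p ^ M)) / q) * node_kernel lam \<kappa>1 \<kappa>2 \<alpha> z M \<epsilon>)) has_sum
        (qtheta z q * (qpoch_inf lam q * qpoch_inf \<kappa>1 q * qpoch_inf \<kappa>2 q) * S)) UNIV"
    "((\<lambda>k. z ^ k / qpoch q q k * vwp (\<alpha>^2) k
        * (qpoch (q * \<alpha>^2 / \<kappa>1) q k * qpoch (lam * \<kappa>1 / q) q k / (qpoch \<kappa>1 q k * qpoch \<kappa>2 q k))) has_sum S) UNIV"
proof -
  define th where "th N = (-1) powi N * p powi (N^2 - N)" for N :: int
  have norm_th: "norm (th N) = rho powi (N^2 - N)" for N by (simp add: th_def norm_mult norm_power_int)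
  have th_sum: "((\<lambda>N. th N * x powi N) has_sum (qpoch_inf q q * qtheta x q)) UNIV" if "x \<noteq> 0" for x
    using jacobi_triple_product[OF that] by (simp add: th_def)
  define s where "s \<epsilon> M = \<epsilon> * (\<alpha> * p ^ M)" for \<epsilon> :: complex and M
  have s0: "s \<epsilon> M \<noteq> 0" if "\<epsilon> \<in> {1,-1}" for \<epsilon> M using that al p by (auto simp: s_def)
  define w where "w \<epsilon> M = lam * z * s \<epsilon> M / q" for \<epsilon> M
  define g where "g \<epsilon> = (\<lambda>(i, j). w \<epsilon> (i + j) ^ i / qpoch q q i * (eul j * (q ^ j - q ^ i)) * node_kernel lam \<kappa>1 \<kappa>2 \<alpha> z (i + j) \<epsilon>)" for \<epsilon>
  define f where "f = (\<lambda>(y, N). th N * z powi N * node_entire lam \<kappa>1 \<kappa>2 \<alpha> N y)"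

  have row: "((\<lambda>N. f ((i, j), N)) has_sum (qpoch_inf q q * ((1/2) * (g 1 (i, j) + g (-1) (i, j))))) UNIV" for i j
  proof -
    define c where "c \<epsilon> = lam ^ i * (eul j * q ^ j * (1/2)) * ((1 - q ^ i / q ^ j) *
        (qpoch_inf (\<kappa>1 / s \<epsilon> (i + j)) q * qpoch_inf (\<kappa>2 / s \<epsilon> (i + j)) q
         * (qpoch_inf (lam * s \<epsilon> (i + j)) q * cofactor \<epsilon> \<alpha> (i + j))))" for \<epsilon>
    define x where "x \<epsilon> = z * s \<epsilon> (i + j)" for \<epsilon>
    have x0: "x \<epsilon> \<noteq> 0" if "\<epsilon> \<in> {1,-1}" for \<epsilon> using z s0[OF that] by (simp add: x_def)
    have one: "((\<lambda>N. eul i * c \<epsilon> * (th N * (x \<epsilon> / q ^ i) powi N)) has_sum (qpoch_inf q q * ((1/2) * g \<epsilon> (i, j)))) UNIV"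
      if eps: "\<epsilon> \<in> {1,-1}" for \<epsilon>
    proof -
      have "((\<lambda>N. eul i * c \<epsilon> * (th N * (x \<epsilon> / q ^ i) powi N)) has_sum (eul i * c \<epsilon> * (qpoch_inf q q * qtheta (x \<epsilon> / q ^ i) q))) UNIV"
        using x0[OF eps] q by (intro has_sum_cmult_right th_sum) auto
      also have "eul i * c \<epsilon> * (qpoch_inf q q * qtheta (x \<epsilon> / q ^ i) q) = qpoch_inf q q * (c \<epsilon> * (eul i * qtheta (x \<epsilon> / q ^ i) q))"
        by (simp add: mult_ac)
      also have "eul i * qtheta (x \<epsilon> / q ^ i) q = (x \<epsilon> / q) ^ i / qpoch q q i * qtheta (x \<epsilon>) q"
        by (rule eul_qtheta[OF x0[OF eps]])
      also have "c \<epsilon> * ((x \<epsilon> / q) ^ i / qpoch q q i * qtheta (x \<epsilon>) q) = (1/2) * g \<epsilon> (i, j)"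
      proof -
        have "q ^ j * (1 - q ^ i / q ^ j) = q ^ j - q ^ i" using q by (simp add: algebra_simps)
        moreover have "lam ^ i * (x \<epsilon> / q) ^ i = w \<epsilon> (i + j) ^ i"
          by (simp add: w_def x_def flip: power_mult_distrib) (simp add: mult_ac)
        moreover have "c \<epsilon> * ((x \<epsilon> / q) ^ i / qpoch q q i * qtheta (x \<epsilon>) q)
           = (1/2) * ((lam ^ i * (x \<epsilon> / q) ^ i) / qpoch q q i * (eul j * (q ^ j * (1 - q ^ i / q ^ j))) *
              node_kernel lam \<kappa>1 \<kappa>2 \<alpha> z (i + j) \<epsilon>)"
        proof -
          have kx: "node_kernel lam \<kappa>1 \<kappa>2 \<alpha> z (i + j) \<epsilon> = (qpoch_inf (\<kappa>1 / s \<epsilon> (i + j)) q * qpoch_inf (\<kappa>2 / s \<epsilon> (i + j)) q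
             * (qpoch_inf (lam * s \<epsilon> (i + j)) q * cofactor \<epsilon> \<alpha> (i + j))) * qtheta (x \<epsilon>) q"
            by (simp only: node_kernel_def x_def s_def)
          show ?thesis unfolding c_def kx by (simp only: divide_inverse mult_ac)
        qed
        ultimately show ?thesis by (simp only: g_def prod.case)
      qed
      finally show ?thesis .
    qed
    have "f ((i, j), N) = eul i * c 1 * (th N * (x 1 / q ^ i) powi N) + eul i * c (-1) * (th N * (x (-1) / q ^ i) powi N)" for N
    proof -
      have pw: "z powi N * ((q powi (- N)) ^ i * s \<epsilon> (i + j) powi N) = (x \<epsilon> / q ^ i) powi N" for \<epsilon>
      proof -
        have "(q powi (- N)) ^ i = q powi (- N * int i)" by (simp only: power_int_mult power_int_of_nat)
        also have "- N * int i = - (int i * N)" by simp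
        also have "q powi (- (int i * N)) = 1 / (q ^ i) powi N"
          by (simp only: power_int_minus power_int_mult power_int_of_nat inverse_eq_divide)
        finally show ?thesis by (simp add: x_def power_int_mult_distrib power_int_divide_distrib)
      qed
      have "f ((i, j), N) = th N * (eul i * (c 1 * (z powi N * ((q powi (- N)) ^ i * s 1 (i + j) powi N))
           + c (-1) * (z powi N * ((q powi (- N)) ^ i * s (-1) (i + j) powi N))))"
        unfolding f_def prod.case node_entire_def sum_signs nd_def c_def s_def by (simp add: algebra_simps)
      then show ?thesis unfolding pw by (simp add: algebra_simps)
    qed
    moreover have "((\<lambda>N. eul i * c 1 * (th N * (x 1 / q ^ i) powi N) + eul i * c (-1) * (th N * (x (-1) / q ^ i) powi N))
       has_sum (qpoch_inf q q * ((1/2) * g 1 (i, j)) + qpoch_inf q q * ((1/2) * g (-1) (i, j)))) UNIV"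
      by (intro has_sum_add one) auto
    ultimately show ?thesis by (simp add: distrib_left)
  qed

  have "f summable_on UNIV \<times> UNIV"
  proof (rule abs_summable_summable)
    have "norm z > 0" using z by simp
    from norm_summable_node_entire(1)[OF al ka lam this]
    show "(\<lambda>x. norm (f x)) summable_on UNIV \<times> UNIV"
      by (simp add: f_def case_prod_unfold norm_mult norm_th norm_power_int mult_ac)
  qed
  then obtain T where T: "(f has_sum T) (UNIV \<times> UNIV)" by (auto simp: summable_on_def)
  have rows: "((\<lambda>y. qpoch_inf q q * ((1/2) * (g 1 y + g (-1) y))) has_sum T) (UNIV \<times> UNIV)"
    using has_sum_SigmaD[OF T, of "\<lambda>y. qpoch_inf q q * ((1/2) * (g 1 y + g (-1) y))"] row
    by (simp add: split_paired_all)
  from has_sum_cmult_right[OF has_sum_antidiagonal[OF this], of "1 / qpoch_inf q q"]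
  have "((\<lambda>M. \<Sum>j\<le>M. (1/2) * (g 1 (M - j, j) + g (-1) (M - j, j))) has_sum (T / qpoch_inf q q)) UNIV"
    using qpoch_qq_nonzero(2)[OF q(2)] by (simp add: sum_distrib_left mult.assoc[symmetric])
  moreover have "(\<Sum>j\<le>M. (1/2) * (g 1 (M - j, j) + g (-1) (M - j, j)))
     = (1/2) * (\<Sum>\<epsilon>\<in>{1,-1}. bracket M (lam * z * (\<epsilon> * (\<alpha> * p ^ M)) / q) * node_kernel lam \<kappa>1 \<kappa>2 \<alpha> z M \<epsilon>)" for M
  proof -
    have "(\<Sum>j\<le>M. g \<epsilon> (M - j, j)) = bracket M (w \<epsilon> M) * node_kernel lam \<kappa>1 \<kappa>2 \<alpha> z M \<epsilon>" for \<epsilon>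
      unfolding bracket_def sum_distrib_right by (intro sum.cong refl) (simp add: g_def)
    then show ?thesis
      unfolding sum_signs w_def s_def by (simp only: sum_distrib_left[symmetric] sum.distrib)
  qed
  ultimately have left: "((\<lambda>M. (1/2) * (\<Sum>\<epsilon>\<in>{1,-1}. bracket M (lam * z * (\<epsilon> * (\<alpha> * p ^ M)) / q) * node_kernel lam \<kappa>1 \<kappa>2 \<alpha> z M \<epsilon>))
      has_sum (T / qpoch_inf q q)) UNIV" by (simp only:)

  define C where "C = qpoch_inf lam q * qpoch_inf \<kappa>1 q * qpoch_inf \<kappa>2 q"
  have T': "((\<lambda>(N, y). f (y, N)) has_sum T) (UNIV \<times> UNIV)"
    by (rule has_sum_swap[THEN iffD1, OF T])
  have cols: "((\<lambda>N. C * (\<Sum>\<^sub>\<infinity>k. th N * z powi N * dual lam \<kappa>1 \<kappa>2 \<alpha> N k)) has_sum T) UNIV"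
  proof (rule has_sum_SigmaD[OF T'])
    fix N :: int
    have "((\<lambda>y. node_entire lam \<kappa>1 \<kappa>2 \<alpha> N y) has_sum (C * (\<Sum>\<^sub>\<infinity>k. dual lam \<kappa>1 \<kappa>2 \<alpha> N k))) UNIV"
      unfolding C_def coefficient_identity[OF al lam ka kinf, of N, symmetric]
      by (rule has_sum_infsum, rule abs_summable_summable, rule norm_summable_node_entire(2)[OF al ka lam zero_less_one])
    from has_sum_cmult_right[OF this, of "th N * z powi N"]
    moreover have "th N * z powi N * (C * (\<Sum>\<^sub>\<infinity>k. dual lam \<kappa>1 \<kappa>2 \<alpha> N k))
        = C * (\<Sum>\<^sub>\<infinity>k. th N * z powi N * dual lam \<kappa>1 \<kappa>2 \<alpha> N k)"
      unfolding infsum_cmult_right[OF summable_dual[OF ka(1) kinf], of "th N * z powi N"]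
      by (simp only: mult_ac)
    ultimately show "((\<lambda>y. case (N, y) of (N, y) \<Rightarrow> f (y, N)) has_sum (C * (\<Sum>\<^sub>\<infinity>k. th N * z powi N * dual lam \<kappa>1 \<kappa>2 \<alpha> N k))) UNIV"
      unfolding f_def prod.case by (simp only:)
  qed
  define D where "D k = vwp (\<alpha>^2) k
        * (qpoch (q * \<alpha>^2 / \<kappa>1) q k * qpoch (lam * \<kappa>1 / q) q k / (qpoch \<kappa>1 q k * qpoch \<kappa>2 q k))" for k
  define h where "h N k = th N * z powi N * dual lam \<kappa>1 \<kappa>2 \<alpha> N k" for N k
  obtain B where B: "B > 0" "\<And>\<alpha>' lam' N k. norm \<alpha>' \<le> norm \<alpha> \<Longrightarrow> norm lam' \<le> norm lam \<Longrightarrow>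
     norm (dual lam' \<kappa>1 \<kappa>2 \<alpha>' N k) \<le> B * norm (eul k * (q powi (1 - N)) ^ k)"
    by (rule dual_bounded[OF ka(1) kinf, of "norm \<alpha>" "norm lam"]) (rule that)
  have eq: "rho powi (N^2 - N) * norm z powi N * (rho powi ((int k)^2 - int k) * norm ((q powi (1 - N)) ^ k))
      = rho powi ((N - int k)^2 - (N - int k)) * norm z powi (N - int k) * norm z ^ k" for N k
  proof -
    have "norm ((q powi (1 - N)) ^ k) = rho powi (2 * (1 - N) * int k)"
    proof -
      have "(q powi (1 - N)) ^ k = p powi (2 * (1 - N) * int k)"
        unfolding q_powi by (simp only: power_int_mult power_int_of_nat)
      then show ?thesis by (simp add: norm_power_int)
    qed
    moreover have "rho powi (N^2 - N) * (rho powi ((int k)^2 - int k) * rho powi (2 * (1 - N) * int k))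
        = rho powi ((N - int k)^2 - (N - int k))"
    proof -
      have radd: "rho powi m * rho powi n = rho powi (m + n)" for m n
        using p by (simp add: power_int_add)
      show ?thesis unfolding radd
        by (rule arg_cong[of _ _ "\<lambda>e. rho powi e"]) (simp add: power2_eq_square algebra_simps)
    qed
    moreover have "norm z powi N = norm z powi (N - int k) * norm z ^ k"
      using z power_int_add[of "norm z" "N - int k" "int k"] by simp
    ultimately show ?thesis by (simp add: mult_ac)
  qed
  obtain U where U: "((\<lambda>N. (\<Sum>\<^sub>\<infinity>k. h N k)) has_sum U) UNIV" "((\<lambda>k. qpoch_inf q q * qtheta z q * (z ^ k / qpoch q q k * D k)) has_sum U) UNIV"
  proof (rule has_sum_interchange[of "\<lambda>(N, k). (B * eul_const) *
        (rho powi ((N - int k)^2 - (N - int k)) * norm z powi (N - int k) * norm z ^ k)" UNIV UNIV h])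
    have s1: "(\<lambda>n::int. rho powi (n^2 - n) * norm z powi n) summable_on UNIV"
      using summable_pth[OF rho, of "norm z"] z by simp
    have s2: "(\<lambda>k. norm z ^ k) summable_on UNIV"
      using z by (intro summable_nonneg_imp_summable_on summable_geometric) auto
    have "(\<lambda>(n, k). (rho powi (n^2 - n) * norm z powi n) * norm z ^ k) summable_on UNIV \<times> UNIV"
      by (rule summable_on_times_prod[OF s1 s2]) auto
    moreover have "(\<lambda>(n, k). (rho powi (n^2 - n) * norm z powi n) * norm z ^ k) summable_on UNIV \<times> UNIV \<longleftrightarrow>
       (\<lambda>(N, k). rho powi ((N - int k)^2 - (N - int k)) * norm z powi (N - int k) * norm z ^ k) summable_on UNIV \<times> UNIV"
      by (rule summable_on_reindex_bij_witness[of _ "\<lambda>(N, k). (N - int k, k)" "\<lambda>(n, k). (n + int k, k)"]) auto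
    ultimately have "(\<lambda>(N, k). rho powi ((N - int k)^2 - (N - int k)) * norm z powi (N - int k) * norm z ^ k) summable_on UNIV \<times> UNIV"
      by blast
    from summable_on_cmult_right[OF this, of "B * eul_const"]
    show "(\<lambda>(N, k). (B * eul_const) *
        (rho powi ((N - int k)^2 - (N - int k)) * norm z powi (N - int k) * norm z ^ k)) summable_on UNIV \<times> UNIV"
      by (simp add: case_prod_unfold)
    fix N :: int and k :: nat
    have "norm (h N k) = rho powi (N^2 - N) * norm z powi N * norm (dual lam \<kappa>1 \<kappa>2 \<alpha> N k)"
      by (simp add: h_def norm_mult norm_th norm_power_int)
    also have "\<dots> \<le> rho powi (N^2 - N) * norm z powi N * (B * (eul_const * rho powi ((int k)^2 - int k) * norm ((q powi (1 - N)) ^ k)))"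
    proof (intro mult_left_mono order_trans[OF B(2)[OF order_refl order_refl]])
      show "norm (eul k * (q powi (1 - N)) ^ k) \<le> eul_const * rho powi ((int k)^2 - int k) * norm ((q powi (1 - N)) ^ k)"
        unfolding norm_mult[of "eul k"] by (intro mult_right_mono eul_const) auto
    qed (use B z in auto)
    also have "\<dots> = (B * eul_const) * (rho powi (N^2 - N) * norm z powi N * (rho powi ((int k)^2 - int k) * norm ((q powi (1 - N)) ^ k)))"
      by (simp only: mult_ac)
    finally show "norm (h N k) \<le> (case (N, k) of (N, k) \<Rightarrow> (B * eul_const) *
        (rho powi ((N - int k)^2 - (N - int k)) * norm z powi (N - int k) * norm z ^ k))"
      unfolding eq prod.case .
  next
    fix N :: int
    show "((\<lambda>k. h N k) has_sum (\<Sum>\<^sub>\<infinity>k. h N k)) UNIV"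
      unfolding h_def by (intro has_sum_infsum summable_on_cmult_right summable_dual[OF ka(1) kinf])
  next
    fix k :: nat
    have zk: "z / q ^ k \<noteq> 0" using z q by simp
    have "((\<lambda>N. eul k * D k * q ^ k * (th N * (z / q ^ k) powi N)) has_sum (eul k * D k * q ^ k * (qpoch_inf q q * qtheta (z / q ^ k) q))) UNIV"
      by (intro has_sum_cmult_right th_sum zk)
    moreover have "eul k * D k * q ^ k * (th N * (z / q ^ k) powi N) = h N k" for N
    proof -
      have "(q powi (- N)) ^ k = q powi (- N * int k)" by (simp only: power_int_mult power_int_of_nat)
      also have "- N * int k = - (int k * N)" by simp
      also have "q powi (- (int k * N)) = 1 / (q ^ k) powi N"
        by (simp only: power_int_minus power_int_mult power_int_of_nat inverse_eq_divide)
      finally show ?thesis by (simp add: h_def dual_def D_def power_int_divide_distrib mult_ac)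
    qed
    moreover have "eul k * D k * q ^ k * (qpoch_inf q q * qtheta (z / q ^ k) q) = qpoch_inf q q * qtheta z q * (z ^ k / qpoch q q k * D k)"
    proof -
      have "eul k * D k * q ^ k * (qpoch_inf q q * qtheta (z / q ^ k) q) = D k * q ^ k * qpoch_inf q q * (eul k * qtheta (z / q ^ k) q)"
        by (simp only: mult_ac)
      then show ?thesis unfolding eul_qtheta[OF z(1)] using q by (simp add: power_divide mult_ac)
    qed
    ultimately show "((\<lambda>N. h N k) has_sum (qpoch_inf q q * qtheta z q * (z ^ k / qpoch q q k * D k))) UNIV"
      by simp
  qed
  have "T = C * U"
    using has_sum_unique[OF cols] has_sum_cmult_right[OF U(1), of C] unfolding h_def by blast
  obtain B' where B': "B' > 0" "\<And>k. norm (D k) \<le> B'"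
    using weight_bounded[OF ka(1) kinf, of "norm \<alpha>" "norm lam"] unfolding D_def by (metis order_refl)
  show ?thesis
  proof (rule that[of "infsum (\<lambda>k. z ^ k / qpoch q q k * D k) UNIV"])
    \<comment> \<open>The theta factor on the right may vanish, so summability of the series is argued separately.\<close>
    have sD: "(\<lambda>k. z ^ k / qpoch q q k * D k) summable_on UNIV"
    proof (rule abs_summable_summable, rule Infinite_Sum.abs_summable_on_comparison_test')
      show "(\<lambda>k. norm (z ^ k / qpoch q q k) * B') summable_on UNIV"
        using hq_binomial_norm_summable[OF q(2), of 1 z 0] z(2)
        by (intro summable_on_cmult_left summable_nonneg_imp_summable_on) (auto simp: hpoch_zero)
      show "norm (z ^ k / qpoch q q k * D k) \<le> norm (z ^ k / qpoch q q k) * B'" for k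
        unfolding norm_mult by (intro mult_left_mono B'(2)) auto
    qed
    then show "((\<lambda>k. z ^ k / qpoch q q k * vwp (\<alpha>^2) k
        * (qpoch (q * \<alpha>^2 / \<kappa>1) q k * qpoch (lam * \<kappa>1 / q) q k / (qpoch \<kappa>1 q k * qpoch \<kappa>2 q k)))
          has_sum infsum (\<lambda>k. z ^ k / qpoch q q k * D k) UNIV) UNIV"
      using has_sum_infsum[OF sD] unfolding D_def by (simp only: mult.assoc)
    have "U = qpoch_inf q q * qtheta z q * infsum (\<lambda>k. z ^ k / qpoch q q k * D k) UNIV"
      using has_sum_unique[OF U(2) has_sum_cmult_right[OF has_sum_infsum[OF sD]]] .
    then have "T / qpoch_inf q q = qtheta z q * C * infsum (\<lambda>k. z ^ k / qpoch q q k * D k) UNIV"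
      unfolding \<open>T = C * U\<close> using qpoch_qq_nonzero(2)[OF q(2)] by simp
    then show "((\<lambda>M. (1/2) * (\<Sum>\<epsilon>\<in>{1,-1}. bracket M (lam * z * (\<epsilon> * (\<alpha> * p ^ M)) / q) * node_kernel lam \<kappa>1 \<kappa>2 \<alpha> z M \<epsilon>)) has_sum
        (qtheta z q * (qpoch_inf lam q * qpoch_inf \<kappa>1 q * qpoch_inf \<kappa>2 q) * infsum (\<lambda>k. z ^ k / qpoch q q k * D k) UNIV)) UNIV"
      using left by (simp only: C_def)
  qed
qed

end

section \<open>Products and theta functions along a residue class of nodes\<close>

lemma not_forbidden:
  assumes "norm q < 1" "x \<notin> forbidden q"
  shows "qpoch_inf x q \<noteq> 0" "qpoch x q k \<noteq> 0"
proof -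
  have "x * q ^ n \<noteq> 1" for n
  proof
    assume "x * q ^ n = 1"
    then have "q ^ n \<noteq> 0" by (metis mult_zero_right zero_neq_one)
    then have "x = 1 / q ^ n" using \<open>x * q ^ n = 1\<close> by (simp add: eq_divide_eq)
    then show False using assms(2) by (auto simp: forbidden_def)
  qed
  then show inf: "qpoch_inf x q \<noteq> 0" using qpoch_inf_eq_0_iff[OF assms(1), of x] by auto
  show "qpoch x q k \<noteq> 0" by (rule qpoch_nonzero_of_inf(1)[OF assms(1) inf])
qed

context nome
begin

lemma qpoch_inf_div_q_pow:
  assumes x: "x \<noteq> 0"
  shows "qpoch_inf (x / q ^ k) q = (- x) ^ k * qpoch (q / x) q k * qpoch_inf x q / p ^ (k * (k + 1))"
proof (induction k)
  case (Suc k)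
  define y where "y = x / q ^ Suc k"
  have yq: "y * q = x / q ^ k" using q by (simp add: y_def)
  have "qpoch_inf y q = (1 - y) * qpoch_inf (x / q ^ k) q"
    using qpoch_inf_Suc[OF q(2), of y] yq by simp
  also have "1 - y = (- x) * (1 - q / x * q ^ k) / q ^ Suc k"
    using x q by (simp add: y_def field_simps)
  also have "q ^ Suc k = p ^ (2 * (k + 1))" by (simp only: q_pow(1)) simp
  also have "(- x) * (1 - q / x * q ^ k) / p ^ (2 * (k + 1)) * qpoch_inf (x / q ^ k) q
      = (- x) ^ Suc k * qpoch (q / x) q (Suc k) * qpoch_inf x q / (p ^ (2 * (k + 1)) * p ^ (k * (k + 1)))"
    unfolding Suc by (simp add: qpoch_Suc mult_ac)
  also have "p ^ (2 * (k + 1)) * p ^ (k * (k + 1)) = p ^ (Suc k * (Suc k + 1))"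
    by (simp only: power_add[symmetric]) (rule arg_cong[of _ _ "\<lambda>e. p ^ e"], simp)
  finally show ?case by (simp only: y_def)
qed simp

lemma qtheta_mult_q_pow:
  assumes x: "x \<noteq> 0"
  shows "qtheta (x * q ^ k) q * ((- x) ^ k * p ^ (k * (k - 1))) = qtheta x q"
proof (induction k)
  case (Suc k)
  have y: "x * q ^ k \<noteq> 0" using x q by simp
  have "qtheta (x * q ^ Suc k) q * (- (x * q ^ k)) = qtheta (x * q ^ k) q"
    using qtheta_q_mult[OF y] y by (simp add: mult_ac)
  moreover have "(- x) ^ Suc k * p ^ (Suc k * (Suc k - 1)) = (- (x * q ^ k)) * ((- x) ^ k * p ^ (k * (k - 1)))"
  proof -
    have "p ^ (Suc k * (Suc k - 1)) = p ^ (2 * k) * p ^ (k * (k - 1))"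
      unfolding power_add[symmetric] by (rule arg_cong[of _ _ "\<lambda>e. p ^ e"]) (cases k; simp)
    then show ?thesis by (simp add: q_pow(1))
  qed
  ultimately have "qtheta (x * q ^ Suc k) q * ((- x) ^ Suc k * p ^ (Suc k * (Suc k - 1)))
     = qtheta (x * q ^ k) q * ((- x) ^ k * p ^ (k * (k - 1)))"
    by (metis mult.assoc)
  then show ?case using Suc by simp
qed simp

lemma qtheta_inverse:
  assumes "x \<noteq> 0"
  shows "qtheta (1 / x) q = - qtheta x q / x"
proof -
  have "qtheta (1 / x) q = qtheta (q * x) q"
    using q by (simp add: qtheta_eq mult.commute)
  then show ?thesis using qtheta_q_mult[OF assms] by simp
qed

lemma qtheta_q_div:
  assumes "x \<noteq> 0"
  shows "qtheta (q / x) q = qtheta x q"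
  using q assms by (simp add: qtheta_eq mult.commute)

text \<open>One step $n \mapsto n + 1$ multiplies $\vartheta(q^nx,q^ny;q)$ by $1/(q^{2n}xy)$, which involves $x$ and $y$ through their
product only.\<close>

lemma qtheta_pair_shift:
  assumes nz: "x \<noteq> 0" "y \<noteq> 0" "x' \<noteq> 0" "y' \<noteq> 0" and xy: "x * y = x' * y'"
  shows "qtheta (q powi n * x) q * qtheta (q powi n * y) q * (qtheta x' q * qtheta y' q)
       = qtheta x q * qtheta y q * (qtheta (q powi n * x') q * qtheta (q powi n * y') q)"
proof -
  define F where "F x y n = qtheta (q powi n * x) q * qtheta (q powi n * y) q" for x y and n :: int
  have step: "F x y (n + 1) * (q powi (2 * n) * (x * y)) = F x y n" if "x \<noteq> 0" "y \<noteq> 0" for x y n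
  proof -
    have a: "qtheta (q powi (n + 1) * x) q * (- (q powi n * x)) = qtheta (q powi n * x) q" if "x \<noteq> 0" for x
    proof -
      define Y where "Y = q powi n * x"
      have Y: "Y \<noteq> 0" "q powi (n + 1) * x = q * Y" using that q by (auto simp: Y_def power_int_add)
      show ?thesis unfolding Y(2) Y_def[symmetric] using qtheta_q_mult[OF Y(1)] Y(1) by simp
    qed
    have "q powi (2 * n) = q powi n * q powi n" using powi_add(2)[of n n] by simp
    then have "F x y (n + 1) * (q powi (2 * n) * (x * y)) =
       (qtheta (q powi (n + 1) * x) q * (- (q powi n * x))) * (qtheta (q powi (n + 1) * y) q * (- (q powi n * y)))"
      by (simp add: F_def mult_ac)
    then show ?thesis unfolding a[OF that(1)] a[OF that(2)] by (simp add: F_def)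
  qed
  define P where "P n \<longleftrightarrow> F x y n * F x' y' 0 = F x y 0 * F x' y' n" for n
  have iff: "P (n + 1) \<longleftrightarrow> P n" for n
  proof -
    define c where "c = q powi (2 * n) * (x * y)"
    have c: "c \<noteq> 0" using nz q by (simp add: c_def)
    have s: "F x y (n + 1) * c = F x y n" "F x' y' (n + 1) * c = F x' y' n"
      using step[OF nz(1,2)] step[OF nz(3,4)] by (simp_all add: c_def xy)
    have "P n \<longleftrightarrow> c * (F x y (n + 1) * F x' y' 0) = c * (F x y 0 * F x' y' (n + 1))"
      unfolding P_def s[symmetric] by (simp add: mult_ac)
    then show ?thesis using c by (simp add: P_def)
  qed
  have "P n"
  proof (induction n rule: int_induct[of _ 0])
    case base
    show ?case by (simp add: P_def)
  next
    case (step1 i)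
    then show ?case using iff by simp
  next
    case (step2 i)
    then show ?case using iff[of "i - 1"] by simp
  qed
  then show ?thesis by (simp add: P_def F_def)
qed

text \<open>Euler's identity $(q;q^2)_\infty(-q;q)_\infty = 1$, with $(q;q^2)_\infty = (p,-p;q)_\infty$.\<close>

lemma qpoch_signs: "qpoch_inf p q * qpoch_inf (- p) q * qpoch_inf (- q) q = 1"
proof -
  have "qpoch_inf q q = qpoch_inf p p * qpoch_inf (- p) p"
    using qpoch_inf_square[of p] by (simp add: q_eq)
  also have "qpoch_inf p p = qpoch_inf p q * qpoch_inf q q"
    using qpoch_inf_base_p[of p] by (simp add: q_eq power2_eq_square)
  also have "qpoch_inf (- p) p = qpoch_inf (- p) q * qpoch_inf (- q) q"
    using qpoch_inf_base_p[of "- p"] by (simp add: q_eq power2_eq_square)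
  finally show ?thesis using qpoch_qq_nonzero(2)[OF q(2)] by (simp add: mult_ac)
qed

lemma qpoch_double_even:
  "qpoch q q (2 * k) = qpoch q q k * qpoch (- q) q k * qpoch p q k * qpoch (- p) q k"
proof (induction k)
  case (Suc k)
  have "(1 - q * q ^ (2 * k)) = (1 - p * q ^ k) * (1 - (- p) * q ^ k)"
       "(1 - q * q ^ Suc (2 * k)) = (1 - q * q ^ k) * (1 - (- q) * q ^ k)"
  proof -
    have "1 - p ^ 2 * (Q * Q) = (1 - p * Q) * (1 - (- p) * Q)" for Q
      by (simp add: power2_eq_square algebra_simps)
    then show "(1 - q * q ^ (2 * k)) = (1 - p * q ^ k) * (1 - (- p) * q ^ k)"
      by (simp only: mult_2 power_add q_eq[symmetric])
    have "1 - q * (q * (Q * Q)) = (1 - q * Q) * (1 - (- q) * Q)" for Q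
      by (simp add: algebra_simps)
    then show "(1 - q * q ^ Suc (2 * k)) = (1 - q * q ^ k) * (1 - (- q) * q ^ k)"
      by (simp only: mult_2 power_add power_Suc)
  qed
  then show ?case using Suc by (simp add: qpoch_Suc)
qed simp

lemma qpoch_double_odd:
  "qpoch q q (2 * k + 1) = (1 - q) * (qpoch q q k * qpoch (- q) q k * qpoch (p ^ 3) q k * qpoch (- (p ^ 3)) q k)"
proof (induction k)
  case (Suc k)
  have "(1 - q * q ^ Suc (2 * k)) = (1 - q * q ^ k) * (1 - (- q) * q ^ k)"
       "(1 - q * q ^ Suc (Suc (2 * k))) = (1 - p ^ 3 * q ^ k) * (1 - (- (p ^ 3)) * q ^ k)"
  proof -
    have "1 - p ^ 2 * (p ^ 2 * (p ^ 2 * (Q * Q))) = (1 - p ^ 3 * Q) * (1 - (- (p ^ 3)) * Q)" for Q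
      by (simp add: power2_eq_square power3_eq_cube algebra_simps)
    then show "(1 - q * q ^ Suc (Suc (2 * k))) = (1 - p ^ 3 * q ^ k) * (1 - (- (p ^ 3)) * q ^ k)"
      by (simp only: mult_2 power_add power_Suc q_eq[symmetric])
    have "1 - q * (q * (Q * Q)) = (1 - q * Q) * (1 - (- q) * Q)" for Q
      by (simp add: algebra_simps)
    then show "(1 - q * q ^ Suc (2 * k)) = (1 - q * q ^ k) * (1 - (- q) * q ^ k)"
      by (simp only: mult_2 power_add power_Suc)
  qed
  then show ?case using Suc by (simp add: qpoch_Suc)
qed (simp add: qpoch_Suc)

lemma hpoch_q_mult:
  "hpoch (q * w) q q (Suc (Suc n)) = q ^ Suc (Suc n) * ((w - 1) * (w - q ^ Suc n) * hpoch w q q n)"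
proof -
  have "hpoch (q * w) q q m = q ^ m * hpoch w 1 q m" for m
    by (induction m) (simp_all add: hpoch_Suc algebra_simps)
  moreover have "hpoch w 1 q (Suc m) = (w - 1) * hpoch w q q m" for m
    by (induction m) (simp_all add: hpoch_Suc mult_ac)
  moreover have "hpoch w 1 q (Suc (Suc n)) = hpoch w 1 q (Suc n) * (w - q ^ Suc n)"
    by (simp add: hpoch_Suc[of w 1 q "Suc n"])
  ultimately show ?thesis by (simp only: mult_ac)
qed

text \<open>At $w = uq^k$ with $M = 2k + 1$ the zeros of the bracket lie symmetrically around $u = 1$ on the logarithmic scale, so
the factors pair up into $(u,1/u;q)_k$; for even $M$ the centre is $u = p$ and they pair into $(u,q/u;q)_k$.\<close>

lemma bracket_odd:
  assumes u: "u \<noteq> 0"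
  shows "bracket (2 * k + 1) (u * q ^ k) * qpoch q q (2 * k)
       = (1 + u) * (- u) ^ k * p ^ (3 * k * (k + 1)) * qpoch u q k * qpoch (1 / u) q k"
proof -
  have pos: "((u * q ^ Suc k)^2 - q ^ (2 * Suc k)) * hpoch (u * q ^ Suc k) q q (2 * k + 1)
      = (1 + u) * (- u) ^ Suc k * p ^ (3 * Suc k * (Suc k + 1)) * qpoch u q (Suc k) * qpoch (1 / u) q (Suc k)" for k
  proof (induction k)
    case 0
    have "p ^ 6 = q * q * q" by (simp add: q_eq power_numeral_reduce)
    then show ?case using u by (simp add: hpoch_Suc qpoch_Suc power2_eq_square field_simps)
  next
    case (Suc k)
    define w where "w = u * q ^ Suc k"
    define H where "H = hpoch w q q (2 * k + 1)"
    have uw: "u * q ^ Suc (Suc k) = q * w" by (simp add: w_def mult_ac)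
    have "((u * q ^ Suc (Suc k))^2 - q ^ (2 * Suc (Suc k))) * hpoch (u * q ^ Suc (Suc k)) q q (2 * Suc k + 1)
      = ((q * w)^2 - q ^ (2 * Suc (Suc k))) * hpoch (q * w) q q (Suc (Suc (2 * k + 1)))"
      unfolding uw by simp
    also have "\<dots> = (q^2 * q ^ (2 * k + 3)) * ((w - 1) * (w - q ^ (2 * k + 2))) * ((w^2 - q ^ (2 * Suc k)) * H)"
      unfolding hpoch_q_mult H_def[symmetric] by (simp add: power_mult_distrib power2_eq_square numeral_3_eq_3 algebra_simps)
    also have "(w^2 - q ^ (2 * Suc k)) * H = (1 + u) * (- u) ^ Suc k * p ^ (3 * Suc k * (Suc k + 1)) * qpoch u q (Suc k) * qpoch (1 / u) q (Suc k)"
      using Suc by (simp only: w_def H_def)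
    also have "(w - 1) * (w - q ^ (2 * k + 2)) = (- u) * q ^ Suc k * ((1 - u * q ^ Suc k) * (1 - 1 / u * q ^ Suc k))"
    proof -
      have "q ^ (2 * k + 2) = q ^ Suc k * q ^ Suc k"
        unfolding power_add[symmetric] by (rule arg_cong[of _ _ "\<lambda>e. q ^ e"]) simp
      then show ?thesis using u by (simp only: w_def) (simp add: field_simps)
    qed
    also have "q^2 * q ^ (2 * k + 3) * ((- u) * q ^ Suc k * ((1 - u * q ^ Suc k) * (1 - 1 / u * q ^ Suc k))) *
        ((1 + u) * (- u) ^ Suc k * p ^ (3 * Suc k * (Suc k + 1)) * qpoch u q (Suc k) * qpoch (1 / u) q (Suc k))
      = (1 + u) * (- u) ^ Suc (Suc k) * (q^2 * q ^ (2 * k + 3) * q ^ Suc k * p ^ (3 * Suc k * (Suc k + 1)))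
         * qpoch u q (Suc (Suc k)) * qpoch (1 / u) q (Suc (Suc k))"
      by (simp only: qpoch_Suc[of _ _ "Suc k"] power_Suc[of "- u" "Suc k"]) (simp only: mult_ac)
    also have "q^2 * q ^ (2 * k + 3) * q ^ Suc k * p ^ (3 * Suc k * (Suc k + 1)) = p ^ (3 * Suc (Suc k) * (Suc (Suc k) + 1))"
      unfolding q_pow(1) power_add[symmetric] by (rule arg_cong[of _ _ "\<lambda>e. p ^ e"]) (simp add: algebra_simps)
    finally show ?case .
  qed
  show ?thesis
  proof (cases k)
    case 0
    then show ?thesis by (simp add: bracket_1[unfolded One_nat_def])
  next
    case (Suc m)
    have e: "2 * Suc m + 1 = Suc (Suc (2 * m + 1))" "2 * Suc m = Suc (2 * m + 1)" by simp_all
    show ?thesis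
      unfolding Suc pos[symmetric] e(1) bracket_Suc_Suc
      using qpoch_qq_nonzero(1)[OF q(2), of "Suc (2 * m + 1)"] by (simp only: e(2)) simp
  qed
qed

lemma bracket_even:
  assumes u: "u \<noteq> 0"
  shows "bracket (2 * k + 2) (u * q ^ k) * qpoch q q (2 * k + 1)
       = (u^2 - q) * (- u) ^ k * p ^ (k * (3 * k + 5)) * qpoch u q k * qpoch (q / u) q k"
proof -
  have "((u * q ^ k)^2 - q ^ (2 * k + 1)) * hpoch (u * q ^ k) q q (2 * k)
      = (u^2 - q) * (- u) ^ k * p ^ (k * (3 * k + 5)) * qpoch u q k * qpoch (q / u) q k"
  proof (induction k)
    case (Suc k)
    define w where "w = u * q ^ k"
    define H where "H = hpoch w q q (2 * k)"
    have uw: "u * q ^ Suc k = q * w" by (simp add: w_def mult_ac)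
    have "((u * q ^ Suc k)^2 - q ^ (2 * Suc k + 1)) * hpoch (u * q ^ Suc k) q q (2 * Suc k)
      = ((q * w)^2 - q ^ (2 * Suc k + 1)) * hpoch (q * w) q q (Suc (Suc (2 * k)))"
      unfolding uw by simp
    also have "\<dots> = (q^2 * q ^ (2 * k + 2)) * ((w - 1) * (w - q ^ (2 * k + 1))) * ((w^2 - q ^ (2 * k + 1)) * H)"
      unfolding hpoch_q_mult H_def[symmetric] by (simp add: power_mult_distrib power2_eq_square algebra_simps)
    also have "(w^2 - q ^ (2 * k + 1)) * H = (u^2 - q) * (- u) ^ k * p ^ (k * (3 * k + 5)) * qpoch u q k * qpoch (q / u) q k"
      using Suc by (simp only: w_def H_def)
    also have "(w - 1) * (w - q ^ (2 * k + 1)) = (- u) * q ^ k * ((1 - u * q ^ k) * (1 - q / u * q ^ k))"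
    proof -
      have "q ^ (2 * k + 1) = q * (q ^ k * q ^ k)" by (simp add: mult_2 power_add)
      then show ?thesis using u by (simp only: w_def) (simp add: field_simps)
    qed
    also have "q^2 * q ^ (2 * k + 2) * ((- u) * q ^ k * ((1 - u * q ^ k) * (1 - q / u * q ^ k))) *
        ((u^2 - q) * (- u) ^ k * p ^ (k * (3 * k + 5)) * qpoch u q k * qpoch (q / u) q k)
      = (u^2 - q) * (- u) ^ Suc k * (q^2 * q ^ (2 * k + 2) * q ^ k * p ^ (k * (3 * k + 5)))
         * qpoch u q (Suc k) * qpoch (q / u) q (Suc k)"
      by (simp only: qpoch_Suc power_Suc[of "- u"]) (simp only: mult_ac)
    also have "q^2 * q ^ (2 * k + 2) * q ^ k * p ^ (k * (3 * k + 5)) = p ^ (Suc k * (3 * Suc k + 5))"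
      unfolding q_pow(1) power_add[symmetric] by (rule arg_cong[of _ _ "\<lambda>e. p ^ e"]) (simp add: algebra_simps)
    finally show ?case .
  qed simp
  moreover have e: "2 * k + 2 = Suc (Suc (2 * k))" by simp
  ultimately show ?thesis
    unfolding e bracket_Suc_Suc using qpoch_qq_nonzero(1)[OF q(2), of "Suc (2 * k)"] by simp
qed

text \<open>Quasi-periodicity from $y$ to $yq^k$. The accumulated constant $\lambda\kappa_1\kappa_2/(qy^2)$ is $1$ on the odd
nodes and $1/q$ on the even ones; this difference and the one between the two bracket formulas compensate, so that both series have
argument $q$.\<close>

lemma shifted_products:
  assumes y: "y \<noteq> 0" and ka: "\<kappa>1 \<noteq> 0" "\<kappa>2 \<noteq> 0" and z: "z \<noteq> 0" and lam: "lam \<noteq> 0"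
  shows "(- (lam * z * y / q)) ^ k * p ^ (k * (3 * k + 1)) * (qpoch_inf (\<kappa>1 / (y * q ^ k)) q * qpoch_inf (\<kappa>2 / (y * q ^ k)) q)
       * qtheta (z * (y * q ^ k)) q
     = (lam * \<kappa>1 * \<kappa>2 / (q * y^2)) ^ k * (qpoch (q * y / \<kappa>1) q k * qpoch (q * y / \<kappa>2) q k)
       * (qpoch_inf (\<kappa>1 / y) q * qpoch_inf (\<kappa>2 / y) q) * qtheta (z * y) q"
proof -
  define X where "X = (- (z * y)) ^ k * p ^ (k * (k - 1))"
  have X: "X \<noteq> 0" using z y p by (simp add: X_def)
  have th: "qtheta (z * (y * q ^ k)) q = qtheta (z * y) q / X"
    using qtheta_mult_q_pow[of "z * y" k] z y X by (simp add: X_def eq_divide_eq mult_ac)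
  have qk: "qpoch_inf (\<kappa> / (y * q ^ k)) q = (- (\<kappa> / y)) ^ k * qpoch (q * y / \<kappa>) q k * qpoch_inf (\<kappa> / y) q / p ^ (k * (k + 1))"
    if "\<kappa> \<noteq> 0" for \<kappa>
    using qpoch_inf_div_q_pow[of "\<kappa> / y" k] that y by simp
  have pw: "p ^ (k * (3 * k + 1)) = p ^ (k * (k + 1)) * p ^ (k * (k + 1)) * p ^ (k * (k - 1))"
    unfolding power_add[symmetric] by (rule arg_cong[of _ _ "\<lambda>e. p ^ e"]) (cases k; simp add: algebra_simps)
  have mon: "(- (lam * z * y / q)) ^ k * (- (\<kappa>1 / y)) ^ k * (- (\<kappa>2 / y)) ^ k = (lam * \<kappa>1 * \<kappa>2 / (q * y^2)) ^ k * (- (z * y)) ^ k"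
    unfolding power_mult_distrib[symmetric] using y by (simp add: power2_eq_square mult_ac)
  define P1 P3 where "P1 = p ^ (k * (k + 1))" and "P3 = p ^ (k * (k - 1))"
  have nz: "P1 \<noteq> 0" "P3 \<noteq> 0" using p by (auto simp: P1_def P3_def)
  have "(- (lam * z * y / q)) ^ k * p ^ (k * (3 * k + 1)) * (qpoch_inf (\<kappa>1 / (y * q ^ k)) q * qpoch_inf (\<kappa>2 / (y * q ^ k)) q)
       * qtheta (z * (y * q ^ k)) q
    = ((- (lam * z * y / q)) ^ k * (- (\<kappa>1 / y)) ^ k * (- (\<kappa>2 / y)) ^ k) / (- (z * y)) ^ k *
       (qpoch (q * y / \<kappa>1) q k * qpoch (q * y / \<kappa>2) q k)
       * (qpoch_inf (\<kappa>1 / y) q * qpoch_inf (\<kappa>2 / y) q) * qtheta (z * y) q * (P1 * P1 * P3 / (P1 * P1 * P3))"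
    unfolding th qk[OF ka(1)] qk[OF ka(2)] pw X_def P1_def[symmetric] P3_def[symmetric]
    by (simp only: divide_inverse inverse_mult_distrib mult_ac)
  also have "P1 * P1 * P3 / (P1 * P1 * P3) = 1" using nz by simp
  also have "((- (lam * z * y / q)) ^ k * (- (\<kappa>1 / y)) ^ k * (- (\<kappa>2 / y)) ^ k) / (- (z * y)) ^ k = (lam * \<kappa>1 * \<kappa>2 / (q * y^2)) ^ k"
    unfolding mon using z y by simp
  finally show ?thesis by simp
qed

end

section \<open>Odd and even nodes as basic hypergeometric series\<close>

lemma has_sum_odd_even:
  fixes f :: "nat \<Rightarrow> complex"
  assumes "f 0 = 0" "((\<lambda>k. f (2 * k + 1)) has_sum A) UNIV" "((\<lambda>k. f (2 * k + 2)) has_sum B) UNIV"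
  shows "(f has_sum (A + B)) UNIV"
proof -
  have 1: "(f has_sum A) {n. odd n}"
  proof -
    have "((\<lambda>k. f (2 * k + 1)) has_sum A) UNIV \<longleftrightarrow> (f has_sum A) {n. odd n}"
      by (rule has_sum_reindex_bij_witness[of _ "\<lambda>n. n div 2" "\<lambda>k. 2 * k + 1"]) auto
    then show ?thesis using assms by blast
  qed
  have 2: "(f has_sum B) {n. even n \<and> n > 0}"
  proof -
    have "((\<lambda>k. f (2 * k + 2)) has_sum B) UNIV \<longleftrightarrow> (f has_sum B) {n. even n \<and> n > 0}"
      by (rule has_sum_reindex_bij_witness[of _ "\<lambda>n. n div 2 - 1" "\<lambda>k. 2 * k + 2"]) (auto elim!: evenE)
    then show ?thesis using assms by blast
  qed
  have "(f has_sum (A + B)) ({n. odd n} \<union> {n. even n \<and> n > 0})"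
    by (intro has_sum_Un_disjoint 1 2) auto
  moreover have "(f has_sum (A + B)) ({n. odd n} \<union> {n. even n \<and> n > 0}) \<longleftrightarrow> (f has_sum (A + B)) UNIV"
  proof (rule has_sum_cong_neutral)
    fix n :: nat assume "n \<in> UNIV - ({n. odd n} \<union> {n. even n \<and> n > 0})"
    then have "n = 0" by auto
    then show "f n = 0" using assms by simp
  qed auto
  ultimately show ?thesis by blast
qed

lemma qpochs_Cons: "qpochs (a # as) q k = qpoch a q k * qpochs as q k"
  by (simp add: qpochs_def)

lemma qpochs_bounded:
  assumes "norm q < 1"
  shows "\<exists>C>0. \<forall>k. norm (qpochs as q k) \<le> C"
proof (induction as)
  case Nil
  then show ?case by (auto simp: qpochs_def intro!: exI[of _ 1])
next
  case (Cons a as)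
  then obtain C where C: "C > 0" "\<And>k. norm (qpochs as q k) \<le> C" by blast
  have "norm (qpochs (a # as) q k) \<le> exp (norm a / (1 - norm q)) * C" for k
    unfolding qpochs_Cons norm_mult using C(1)
    by (intro mult_mono norm_qpoch_le assms order_refl C(2)) auto
  then show ?case using C(1) by (intro exI[of _ "exp (norm a / (1 - norm q)) * C"]) auto
qed

lemma qpochs_recip_bounded:
  assumes "norm q < 1" "\<And>b. b \<in> set bs \<Longrightarrow> qpoch_inf b q \<noteq> 0"
  shows "\<exists>C>0. \<forall>k. norm (1 / qpochs bs q k) \<le> C"
  using assms(2)
proof (induction bs)
  case Nil
  then show ?case by (auto simp: qpochs_def intro!: exI[of _ 1])
next
  case (Cons b bs)
  have "\<exists>C>0. \<forall>k. norm (1 / qpochs bs q k) \<le> C" by (rule Cons.IH) (use Cons.prems in auto)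
  then obtain C where C: "C > 0" "\<And>k. norm (1 / qpochs bs q k) \<le> C" by blast
  have "(\<lambda>n. 1 / qpoch b q n) \<longlonglongrightarrow> 1 / qpoch_inf b q"
    using Cons.prems[of b] by (intro tendsto_intros qpoch_LIMSEQ assms(1)) simp_all
  then have "Bseq (\<lambda>n. 1 / qpoch b q n)" by (intro convergent_imp_Bseq convergentI)
  then obtain D where D: "D > 0" "\<And>k. norm (1 / qpoch b q k) \<le> D" by (auto simp: Bseq_def)
  have "norm (1 / qpochs (b # bs) q k) \<le> D * C" for k
  proof -
    have "1 / qpochs (b # bs) q k = (1 / qpoch b q k) * (1 / qpochs bs q k)" by (simp add: qpochs_Cons)
    then show ?thesis using C(1) D(1) by (simp only: norm_mult) (intro mult_mono C(2) D(2), auto)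
  qed
  then show ?case using C(1) D(1) by (intro exI[of _ "D * C"]) auto
qed

lemma qphi_has_sum:
  assumes q: "norm q < 1" and z: "norm z < 1" and bs: "\<And>b. b \<in> set bs \<Longrightarrow> qpoch_inf b q \<noteq> 0"
  shows "((\<lambda>k. qpochs as q k / qpochs (q # bs) q k * z ^ k) has_sum qphi as bs q z) UNIV"
proof -
  obtain C where C: "C > 0" "\<And>k. norm (qpochs as q k) \<le> C" using qpochs_bounded[OF q] by blast
  have "\<And>b. b \<in> set (q # bs) \<Longrightarrow> qpoch_inf b q \<noteq> 0" using bs qpoch_qq_nonzero(2)[OF q] by auto
  from qpochs_recip_bounded[OF q this]
  obtain D where D: "D > 0" "\<And>k. norm (1 / qpochs (q # bs) q k) \<le> D" by blast
  have "summable (\<lambda>k. norm (qpochs as q k / qpochs (q # bs) q k * z ^ k))"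
  proof (rule summable_comparison_test')
    show "summable (\<lambda>k. (C * D) * norm z ^ k)" using z by (intro summable_mult summable_geometric) auto
    fix k
    have "qpochs as q k / qpochs (q # bs) q k * z ^ k = qpochs as q k * (1 / qpochs (q # bs) q k) * z ^ k" by simp
    then have "norm (qpochs as q k / qpochs (q # bs) q k * z ^ k) = norm (qpochs as q k) * norm (1 / qpochs (q # bs) q k) * norm z ^ k"
      by (simp only: norm_mult norm_power)
    also have "\<dots> \<le> C * D * norm z ^ k"
      using C(1) D(1) by (intro mult_right_mono mult_mono C(2) D(2)) auto
    finally show "norm (norm (qpochs as q k / qpochs (q # bs) q k * z ^ k)) \<le> (C * D) * norm z ^ k" by simp
  qed
  note sm = this
  show ?thesis
    unfolding qphi_def by (rule norm_summable_imp_has_sum[OF sm summable_sums[OF summable_norm_cancel[OF sm]]])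
qed

context nome
begin

lemma qtheta_powi_eq_0_iff:
  assumes x: "x \<noteq> 0"
  shows "qtheta (q powi n * x) q = 0 \<longleftrightarrow> qtheta x q = 0"
proof -
  have iff: "qtheta (q powi (n + 1) * x) q = 0 \<longleftrightarrow> qtheta (q powi n * x) q = 0" for n
  proof -
    have "q powi n * x \<noteq> 0" using x q by simp
    moreover have "q powi (n + 1) * x = q * (q powi n * x)" using q by (simp add: power_int_add)
    ultimately show ?thesis using qtheta_q_mult[of "q powi n * x"] q(1) x by (auto simp: mult.assoc)
  qed
  show ?thesis
  proof (induction n rule: int_induct[of _ 0])
    case (step1 i)
    then show ?case using iff by simp
  next
    case (step2 i)
    then show ?case using iff[of "i - 1"] by simp
  qed simp
qed

lemma node_kernel_eq:
  assumes eps: "\<epsilon> \<in> {1, -1}" and M: "M \<ge> 1" and s: "\<epsilon> * (\<alpha> * p ^ M) = y * q ^ k"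
    and yinf: "qpoch_inf y q \<noteq> 0" and dinf: "qpoch (lam * y) q k \<noteq> 0"
  shows "node_kernel lam \<kappa>1 \<kappa>2 \<alpha> z M \<epsilon> = qpoch_inf (\<kappa>1 / (y * q ^ k)) q * qpoch_inf (\<kappa>2 / (y * q ^ k)) q
      * qtheta (z * (y * q ^ k)) q * (qpoch y q k / qpoch (lam * y) q k)
      * (qpoch_inf (lam * y) q / qpoch_inf y q * qpoch_inf (q * \<alpha>^2) q)"
proof -
  have "qpoch_inf (y * q ^ k) q \<noteq> 0" by (rule qpoch_nonzero_of_inf(2)[OF q(2) yinf])
  then have "cofactor \<epsilon> \<alpha> M = qpoch_inf (q * \<alpha>^2) q / qpoch_inf (y * q ^ k) q"
    using cofactor[OF eps M, of \<alpha>] s by (simp add: eq_divide_eq)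
  also have "1 / qpoch_inf (y * q ^ k) q = qpoch y q k / qpoch_inf y q"
    using qpoch_inf_split[OF q(2), of y k] yinf by (auto simp: field_simps)
  then have "qpoch_inf (q * \<alpha>^2) q / qpoch_inf (y * q ^ k) q = qpoch_inf (q * \<alpha>^2) q * (qpoch y q k / qpoch_inf y q)"
    by (simp add: divide_inverse)
  finally have cof: "cofactor \<epsilon> \<alpha> M = qpoch_inf (q * \<alpha>^2) q * (qpoch y q k / qpoch_inf y q)" .
  have lam: "qpoch_inf (lam * (y * q ^ k)) q = qpoch_inf (lam * y) q / qpoch (lam * y) q k"
    using qpoch_inf_split[OF q(2), of "lam * y" k] dinf by (simp add: field_simps)
  show ?thesis unfolding node_kernel_def s cof lam by (simp add: mult_ac)
qed

text \<open>The nodes $\epsilon\alpha p^{2k+1} = yq^k$ start at $y = \epsilon p\alpha$. The denominators $-q, \pm p$ come from the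
factor $(q;q)_{2k} = (q,-q,p,-p;q)_k$ of the bracket.\<close>

lemma odd_part:
  assumes eps: "\<epsilon> \<in> {1, -1}" and al: "\<alpha> \<noteq> 0" and lam: "lam \<noteq> 0" and z: "z \<noteq> 0"
    and ka: "\<kappa>1 \<noteq> 0" "\<kappa>2 \<noteq> 0" "\<kappa>1 * \<kappa>2 * lam = q^2 * \<alpha>^2"
    and y: "y = \<epsilon> * p * \<alpha>" and u: "u = lam * z * y / q"
    and yinf: "qpoch_inf y q \<noteq> 0" and dinf: "qpoch_inf (lam * y) q \<noteq> 0"
    and pinf: "qpoch_inf (- q) q \<noteq> 0" "qpoch_inf p q \<noteq> 0" "qpoch_inf (- p) q \<noteq> 0"
  shows "((\<lambda>k. bracket (2 * k + 1) (lam * z * (\<epsilon> * (\<alpha> * p ^ (2 * k + 1))) / q) * node_kernel lam \<kappa>1 \<kappa>2 \<alpha> z (2 * k + 1) \<epsilon>)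
     has_sum ((1 + u) * (qpoch_inf (\<kappa>1 / y) q * qpoch_inf (\<kappa>2 / y) q) * qtheta (z * y) q
        * (qpoch_inf (lam * y) q / qpoch_inf y q * qpoch_inf (q * \<alpha>^2) q)
        * qphi [y, q * y / \<kappa>1, q * y / \<kappa>2, u, 1 / u] [- q, p, - p, lam * y] q q)) UNIV"
proof -
  define C where "C = (1 + u) * (qpoch_inf (\<kappa>1 / y) q * qpoch_inf (\<kappa>2 / y) q) * qtheta (z * y) q
        * (qpoch_inf (lam * y) q / qpoch_inf y q * qpoch_inf (q * \<alpha>^2) q)"
  have y0: "y \<noteq> 0" using eps p al by (auto simp: y)
  have u0: "u \<noteq> 0" using lam z y0 q by (simp add: u)
  have "((\<lambda>k. C * (qpochs [y, q * y / \<kappa>1, q * y / \<kappa>2, u, 1 / u] q k / qpochs (q # [- q, p, - p, lam * y]) q k * q ^ k))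
     has_sum (C * qphi [y, q * y / \<kappa>1, q * y / \<kappa>2, u, 1 / u] [- q, p, - p, lam * y] q q)) UNIV"
    using dinf pinf by (intro has_sum_cmult_right qphi_has_sum q) auto
  moreover have "C * (qpochs [y, q * y / \<kappa>1, q * y / \<kappa>2, u, 1 / u] q k / qpochs (q # [- q, p, - p, lam * y]) q k * q ^ k)
     = bracket (2 * k + 1) (lam * z * (\<epsilon> * (\<alpha> * p ^ (2 * k + 1))) / q) * node_kernel lam \<kappa>1 \<kappa>2 \<alpha> z (2 * k + 1) \<epsilon>" for k
  proof -
    have s: "\<epsilon> * (\<alpha> * p ^ (2 * k + 1)) = y * q ^ k" by (simp add: y q_pow(1))
    have dk: "qpoch (lam * y) q k \<noteq> 0" by (rule qpoch_nonzero_of_inf(1)[OF q(2) dinf])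
    have w: "lam * z * (y * q ^ k) / q = u * q ^ k" by (simp add: u)
    have br: "bracket (2 * k + 1) (u * q ^ k) = (1 + u) * (- u) ^ k * p ^ (3 * k * (k + 1)) * qpoch u q k * qpoch (1 / u) q k / qpoch q q (2 * k)"
      using bracket_odd[OF u0, of k] qpoch_qq_nonzero(1)[OF q(2), of "2 * k"] by (simp add: eq_divide_eq)
    have kn: "node_kernel lam \<kappa>1 \<kappa>2 \<alpha> z (2 * k + 1) \<epsilon> = qpoch_inf (\<kappa>1 / (y * q ^ k)) q * qpoch_inf (\<kappa>2 / (y * q ^ k)) q
      * qtheta (z * (y * q ^ k)) q * (qpoch y q k / qpoch (lam * y) q k)
      * (qpoch_inf (lam * y) q / qpoch_inf y q * qpoch_inf (q * \<alpha>^2) q)"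
      by (rule node_kernel_eq[OF eps _ s yinf dk]) simp
    have "y^2 = q * \<alpha>^2" using eps by (auto simp: y q_eq power_mult_distrib)
    then have "lam * \<kappa>1 * \<kappa>2 / (q * y^2) = 1"
      using ka(3) al q by (simp add: power2_eq_square mult_ac)
    with shifted_products[OF y0 ka(1,2) z lam, of k]
    have sp: "(- u) ^ k * p ^ (k * (3 * k + 1)) * (qpoch_inf (\<kappa>1 / (y * q ^ k)) q * qpoch_inf (\<kappa>2 / (y * q ^ k)) q)
       * qtheta (z * (y * q ^ k)) q
     = (qpoch (q * y / \<kappa>1) q k * qpoch (q * y / \<kappa>2) q k)
       * (qpoch_inf (\<kappa>1 / y) q * qpoch_inf (\<kappa>2 / y) q) * qtheta (z * y) q"
      by (simp add: u)
    have pw: "p ^ (3 * k * (k + 1)) = p ^ (k * (3 * k + 1)) * q ^ k"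
      unfolding q_pow(1) power_add[symmetric] by (rule arg_cong[of _ _ "\<lambda>e. p ^ e"]) (simp add: algebra_simps)
    have "bracket (2 * k + 1) (u * q ^ k) * node_kernel lam \<kappa>1 \<kappa>2 \<alpha> z (2 * k + 1) \<epsilon>
      = (1 + u) * ((- u) ^ k * p ^ (k * (3 * k + 1)) * (qpoch_inf (\<kappa>1 / (y * q ^ k)) q * qpoch_inf (\<kappa>2 / (y * q ^ k)) q)
       * qtheta (z * (y * q ^ k)) q) * q ^ k * qpoch u q k * qpoch (1 / u) q k / qpoch q q (2 * k)
       * (qpoch y q k / qpoch (lam * y) q k) * (qpoch_inf (lam * y) q / qpoch_inf y q * qpoch_inf (q * \<alpha>^2) q)"
      unfolding br kn pw by (simp only: divide_inverse mult_ac)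
    also have "\<dots> = C * (qpochs [y, q * y / \<kappa>1, q * y / \<kappa>2, u, 1 / u] q k / qpochs (q # [- q, p, - p, lam * y]) q k * q ^ k)"
      unfolding sp C_def qpoch_double_even qpochs_def
      by (simp only: list.map prod_list.Cons prod_list.Nil mult_1_right mult_1_left inverse_1 divide_inverse inverse_mult_distrib mult_ac)
    finally show ?thesis unfolding s w by simp
  qed
  ultimately show ?thesis by (simp only: C_def)
qed

text \<open>The nodes $\epsilon\alpha p^{2k+2} = yq^k$ start at $y = \epsilon q\alpha$; now the bracket contributes $(q;q)_{2k+1}$,
whence the denominators $-q, \pm p^3$.\<close>

lemma even_part:
  assumes eps: "\<epsilon> \<in> {1, -1}" and al: "\<alpha> \<noteq> 0" and lam: "lam \<noteq> 0" and z: "z \<noteq> 0"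
    and ka: "\<kappa>1 \<noteq> 0" "\<kappa>2 \<noteq> 0" "\<kappa>1 * \<kappa>2 * lam = q^2 * \<alpha>^2"
    and y: "y = \<epsilon> * q * \<alpha>" and u: "u = lam * z * y / q"
    and yinf: "qpoch_inf y q \<noteq> 0" and dinf: "qpoch_inf (lam * y) q \<noteq> 0"
    and pinf: "qpoch_inf (- q) q \<noteq> 0" "qpoch_inf (p ^ 3) q \<noteq> 0" "qpoch_inf (- (p ^ 3)) q \<noteq> 0"
  shows "((\<lambda>k. bracket (2 * k + 2) (lam * z * (\<epsilon> * (\<alpha> * p ^ (2 * k + 2))) / q) * node_kernel lam \<kappa>1 \<kappa>2 \<alpha> z (2 * k + 2) \<epsilon>)
     has_sum ((u^2 - q) / (1 - q) * (qpoch_inf (\<kappa>1 / y) q * qpoch_inf (\<kappa>2 / y) q) * qtheta (z * y) q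
        * (qpoch_inf (lam * y) q / qpoch_inf y q * qpoch_inf (q * \<alpha>^2) q)
        * qphi [y, q * y / \<kappa>1, q * y / \<kappa>2, u, q / u] [- q, p ^ 3, - (p ^ 3), lam * y] q q)) UNIV"
proof -
  define C where "C = (u^2 - q) / (1 - q) * (qpoch_inf (\<kappa>1 / y) q * qpoch_inf (\<kappa>2 / y) q) * qtheta (z * y) q
        * (qpoch_inf (lam * y) q / qpoch_inf y q * qpoch_inf (q * \<alpha>^2) q)"
  have y0: "y \<noteq> 0" using eps q al by (auto simp: y)
  have u0: "u \<noteq> 0" using lam z y0 q by (simp add: u)
  have "((\<lambda>k. C * (qpochs [y, q * y / \<kappa>1, q * y / \<kappa>2, u, q / u] q k / qpochs (q # [- q, p ^ 3, - (p ^ 3), lam * y]) q k * q ^ k))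
     has_sum (C * qphi [y, q * y / \<kappa>1, q * y / \<kappa>2, u, q / u] [- q, p ^ 3, - (p ^ 3), lam * y] q q)) UNIV"
    using dinf pinf by (intro has_sum_cmult_right qphi_has_sum q) auto
  moreover have "C * (qpochs [y, q * y / \<kappa>1, q * y / \<kappa>2, u, q / u] q k / qpochs (q # [- q, p ^ 3, - (p ^ 3), lam * y]) q k * q ^ k)
     = bracket (2 * k + 2) (lam * z * (\<epsilon> * (\<alpha> * p ^ (2 * k + 2))) / q) * node_kernel lam \<kappa>1 \<kappa>2 \<alpha> z (2 * k + 2) \<epsilon>" for k
  proof -
    have s: "\<epsilon> * (\<alpha> * p ^ (2 * k + 2)) = y * q ^ k" by (simp add: y q_pow(1)) (simp add: q_eq power2_eq_square mult_ac)
    have dk: "qpoch (lam * y) q k \<noteq> 0" by (rule qpoch_nonzero_of_inf(1)[OF q(2) dinf])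
    have w: "lam * z * (y * q ^ k) / q = u * q ^ k" by (simp add: u)
    have br: "bracket (2 * k + 2) (u * q ^ k) = (u^2 - q) * (- u) ^ k * p ^ (k * (3 * k + 5)) * qpoch u q k * qpoch (q / u) q k / qpoch q q (2 * k + 1)"
      by (rule nonzero_eq_divide_eq[THEN iffD2, OF qpoch_qq_nonzero(1)[OF q(2)] bracket_even[OF u0]])
    have kn: "node_kernel lam \<kappa>1 \<kappa>2 \<alpha> z (2 * k + 2) \<epsilon> = qpoch_inf (\<kappa>1 / (y * q ^ k)) q * qpoch_inf (\<kappa>2 / (y * q ^ k)) q
      * qtheta (z * (y * q ^ k)) q * (qpoch y q k / qpoch (lam * y) q k)
      * (qpoch_inf (lam * y) q / qpoch_inf y q * qpoch_inf (q * \<alpha>^2) q)"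
      by (rule node_kernel_eq[OF eps _ s yinf dk]) simp
    have "y^2 = q^2 * \<alpha>^2" using eps by (auto simp: y power_mult_distrib)
    then have "lam * \<kappa>1 * \<kappa>2 / (q * y^2) = 1 / q"
      using ka(3) al q by (simp add: power2_eq_square mult_ac)
    with shifted_products[OF y0 ka(1,2) z lam, of k]
    have "(- u) ^ k * p ^ (k * (3 * k + 1)) * (qpoch_inf (\<kappa>1 / (y * q ^ k)) q * qpoch_inf (\<kappa>2 / (y * q ^ k)) q)
       * qtheta (z * (y * q ^ k)) q
     = (1 / q) ^ k * (qpoch (q * y / \<kappa>1) q k * qpoch (q * y / \<kappa>2) q k)
       * (qpoch_inf (\<kappa>1 / y) q * qpoch_inf (\<kappa>2 / y) q) * qtheta (z * y) q"
      by (simp only: u)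
    then have sp: "q ^ k * ((- u) ^ k * p ^ (k * (3 * k + 1)) * (qpoch_inf (\<kappa>1 / (y * q ^ k)) q * qpoch_inf (\<kappa>2 / (y * q ^ k)) q)
       * qtheta (z * (y * q ^ k)) q)
     = (qpoch (q * y / \<kappa>1) q k * qpoch (q * y / \<kappa>2) q k)
       * (qpoch_inf (\<kappa>1 / y) q * qpoch_inf (\<kappa>2 / y) q) * qtheta (z * y) q"
      using q by (simp add: power_one_over)
    have pw: "p ^ (k * (3 * k + 5)) = p ^ (k * (3 * k + 1)) * q ^ k * q ^ k"
      unfolding q_pow(1) power_add[symmetric] by (rule arg_cong[of _ _ "\<lambda>e. p ^ e"]) (simp add: algebra_simps)
    have "bracket (2 * k + 2) (u * q ^ k) * node_kernel lam \<kappa>1 \<kappa>2 \<alpha> z (2 * k + 2) \<epsilon>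
      = (u^2 - q) * (q ^ k * ((- u) ^ k * p ^ (k * (3 * k + 1)) * (qpoch_inf (\<kappa>1 / (y * q ^ k)) q * qpoch_inf (\<kappa>2 / (y * q ^ k)) q)
       * qtheta (z * (y * q ^ k)) q)) * q ^ k * qpoch u q k * qpoch (q / u) q k / qpoch q q (2 * k + 1)
       * (qpoch y q k / qpoch (lam * y) q k) * (qpoch_inf (lam * y) q / qpoch_inf y q * qpoch_inf (q * \<alpha>^2) q)"
      unfolding br kn pw by (simp only: divide_inverse mult_ac)
    also have "\<dots> = C * (qpochs [y, q * y / \<kappa>1, q * y / \<kappa>2, u, q / u] q k / qpochs (q # [- q, p ^ 3, - (p ^ 3), lam * y]) q k * q ^ k)"
      unfolding sp C_def qpoch_double_odd qpochs_def
      by (simp only: list.map prod_list.Cons prod_list.Nil mult_1_right mult_1_left inverse_1 divide_inverse inverse_mult_distrib mult_ac)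
    finally show ?thesis unfolding s w by simp
  qed
  ultimately show ?thesis by (simp only: C_def)
qed

section \<open>The theta quotient representation of the very-well-poised series\<close>

lemma vwp_quotient:
  assumes "qpoch s q k \<noteq> 0" "qpoch (- s) q k \<noteq> 0"
  shows "qpoch (s^2) q k * qpoch (q * s) q k * qpoch (- (q * s)) q k / (qpoch s q k * qpoch (- s) q k) = vwp (s^2) k"
proof (cases k)
  case 0
  then show ?thesis by (simp add: qpoch_def vwp_def)
next
  case (Suc j)
  define X where "X = qpoch (q * s) q j"
  define Y where "Y = qpoch (- (q * s)) q j"
  define V where "V = qpoch (s^2 * q) q j"
  define t where "t = q ^ j"
  have e: "qpoch s q k = (1 - s) * X" "qpoch (- s) q k = (1 + s) * Y"
    "qpoch (s^2) q k = (1 - s^2) * V"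
    unfolding Suc qpoch_Suc_left X_def Y_def V_def by (simp_all add: mult.commute)
  have e': "qpoch (q * s) q k = X * (1 - q * s * t)" "qpoch (- (q * s)) q k = Y * (1 + q * s * t)"
    unfolding Suc qpoch_Suc X_def Y_def t_def by simp_all
  have v: "vwp (s^2) k = (1 - s^2 * (q * t)^2) * V"
    unfolding vwp_def Suc V_def t_def by (simp add: power_mult power2_eq_square power_mult_distrib mult_ac flip: power_add)
  have "(1 - s^2) * V * (X * (1 - q * s * t)) * (Y * (1 + q * s * t))
      = (1 - s^2 * (q * t)^2) * V * (((1 - s) * X) * ((1 + s) * Y))"
    by algebra
  then show ?thesis using assms unfolding e e' v by (simp add: divide_eq_eq)
qed

lemma W54_has_sum:
  assumes s: "qpoch_inf s q \<noteq> 0" "qpoch_inf (- s) q \<noteq> 0"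
    and k: "qpoch_inf (q * s^2 / b) q \<noteq> 0" "qpoch_inf (q * s^2 / c) q \<noteq> 0"
    and z: "norm z < 1"
  shows "((\<lambda>k. z ^ k / qpoch q q k * vwp (s^2) k
     * (qpoch b q k * qpoch c q k / (qpoch (q * s^2 / b) q k * qpoch (q * s^2 / c) q k))) has_sum W54 (s^2) s b c q z) UNIV"
proof -
  have "((\<lambda>k. qpochs [s^2, q * s, - (q * s), b, c] q k / qpochs (q # [s, - s, q * s^2 / b, q * s^2 / c]) q k * z ^ k)
      has_sum W54 (s^2) s b c q z) UNIV"
    unfolding W54_def using s k by (intro qphi_has_sum q z) auto
  moreover have "qpochs [s^2, q * s, - (q * s), b, c] q k / qpochs (q # [s, - s, q * s^2 / b, q * s^2 / c]) q k * z ^ k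
     = z ^ k / qpoch q q k * vwp (s^2) k
     * (qpoch b q k * qpoch c q k / (qpoch (q * s^2 / b) q k * qpoch (q * s^2 / c) q k))" for k
    unfolding vwp_quotient[OF qpoch_nonzero_of_inf(1)[OF q(2) s(1)] qpoch_nonzero_of_inf(1)[OF q(2) s(2)], symmetric] qpochs_def
    by (simp only: list.map prod_list.Cons prod_list.Nil mult_1_right mult_1_left inverse_1 divide_inverse inverse_mult_distrib mult_ac)
  ultimately show ?thesis by simp
qed

text \<open>With $u = \epsilon bcz/(p\alpha)$, the square $u^2$ does not depend on the sign: the factor $1 + u$ from the bracket and
the factor $1 - u$ from $(u;q)_\infty$ combine to a constant common to both signs, the same one that appears for the even
nodes.\<close>

lemma P_term_sum:
  assumes eps: "\<epsilon> \<in> {1, -1}" and s: "s \<noteq> 0" and b: "b \<noteq> 0" and c: "c \<noteq> 0" and z: "z \<noteq> 0"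
    and d: "qpoch_inf (\<epsilon> * p * b * c / s) q \<noteq> 0"
    and pinf: "qpoch_inf (- q) q \<noteq> 0" "qpoch_inf p q \<noteq> 0" "qpoch_inf (- p) q \<noteq> 0"
    and den: "qpochs_inf [p, - p, \<epsilon> * (p * s), \<epsilon> * (p * s) / (b * c), \<epsilon> * b * c * z / (p * s)] q \<noteq> 0"
  shows "((\<lambda>k. bracket (2 * k + 1) (b * c / s^2 * z * (\<epsilon> * (s * p ^ (2 * k + 1))) / q)
       * node_kernel (b * c / s^2) (q * s^2 / b) (q * s^2 / c) s z (2 * k + 1) \<epsilon>)
     has_sum (qpoch_inf (q * s^2) q * (1 - b^2 * c^2 * z^2 / (q * s^2)) / qpoch_inf (- q) q
        * (qtheta (\<epsilon> * p * z * s) q * qtheta (\<epsilon> * p * s / (b * c)) q * P_term q p s b c z \<epsilon>))) UNIV"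
proof -
  define y where "y = \<epsilon> * p * s"
  define lam where "lam = b * c / s^2"
  define \<kappa>1 where "\<kappa>1 = q * s^2 / b"
  define \<kappa>2 where "\<kappa>2 = q * s^2 / c"
  define u where "u = lam * z * y / q"
  define d where "d = lam * y"
  define \<phi> where "\<phi> = qphi [y, q * y / \<kappa>1, q * y / \<kappa>2, u, 1 / u] [- q, p, - p, d] q q"
  have nz: "\<epsilon> \<noteq> 0" "\<epsilon> * \<epsilon> = 1" "p \<noteq> 0" "q \<noteq> 0" using eps p q by auto
  note simps = y_def lam_def \<kappa>1_def \<kappa>2_def u_def d_def
  have y: "y \<noteq> 0" and lam: "lam \<noteq> 0" and ka: "\<kappa>1 \<noteq> 0" "\<kappa>2 \<noteq> 0" "\<kappa>1 * \<kappa>2 * lam = q^2 * s^2" and d0: "d \<noteq> 0"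
    using nz s b c by (auto simp: simps field_simps power2_eq_square)
  have par1: "\<epsilon> * (p * s) = y" by (simp add: y_def)
  have par: "\<epsilon> * p * b * c / s = d" "\<epsilon> * (p * s) / b = \<kappa>1 / y" "\<epsilon> * (p * s) / c = \<kappa>2 / y"
    "\<epsilon> * (p * s) / (b * c) = q / d" "\<epsilon> * b * c * z / (p * s) = u" "\<epsilon> * b * c * z * (p / s) = u * q"
    "\<epsilon> * p * b / s = q * y / \<kappa>1" "\<epsilon> * p * c / s = q * y / \<kappa>2" "\<epsilon> * (p * s) / (b * c * z) = 1 / u"
    "\<epsilon> * p * z * s = z * y" "\<epsilon> * p * s / (b * c) = q / d"
    using eps nz s b c z by (auto simp: simps q_eq field_simps power2_eq_square)
  have u2: "b^2 * c^2 * z^2 / (q * s^2) = u^2"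
    using eps nz s by (auto simp: simps q_eq field_simps power2_eq_square)
  have den': "qpoch_inf y q \<noteq> 0" "qpoch_inf (q / d) q \<noteq> 0" "qpoch_inf u q \<noteq> 0"
    using den unfolding par unfolding par1 by (auto simp: qpochs_inf_def)
  have dinf: "qpoch_inf d q \<noteq> 0" by (rule d[unfolded par(1)])
  have usplit: "qpoch_inf u q = (1 - u) * qpoch_inf (u * q) q" by (rule qpoch_inf_Suc[OF q(2)])
  have uu: "1 - u \<noteq> 0" "qpoch_inf (u * q) q \<noteq> 0" using den'(3) usplit by auto
  have pp: "1 / qpoch_inf (- q) q = qpoch_inf p q * qpoch_inf (- p) q"
    using qpoch_signs pinf by (simp add: divide_eq_eq)
  have P: "P_term q p s b c z \<epsilon> = qpoch_inf (\<kappa>1 / y) q * qpoch_inf (\<kappa>2 / y) q * qpoch_inf (u * q) q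
     / (qpoch_inf p q * qpoch_inf (- p) q * qpoch_inf y q * qpoch_inf (q / d) q * qpoch_inf u q) * \<phi>"
    unfolding P_term_def par unfolding par1 \<phi>_def by (simp add: qpochs_inf_def mult_ac)
  have th: "qtheta (q / d) q = qpoch_inf d q * qpoch_inf (q / d) q"
    using qtheta_q_div[OF d0] by (simp add: qtheta_eq)
  have "qpoch_inf (q * s^2) q * (1 - u^2) / qpoch_inf (- q) q * (qtheta (z * y) q * qtheta (q / d) q * P_term q p s b c z \<epsilon>)
    = qpoch_inf (q * s^2) q * (1 - u^2) * (qpoch_inf p q * qpoch_inf (- p) q) * (qtheta (z * y) q * qtheta (q / d) q * P_term q p s b c z \<epsilon>)"
    by (simp only: pp[symmetric]) simp
  also have "\<dots> = (1 + u) * (qpoch_inf (\<kappa>1 / y) q * qpoch_inf (\<kappa>2 / y) q) * qtheta (z * y) q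
        * (qpoch_inf d q / qpoch_inf y q * qpoch_inf (q * s^2) q) * \<phi>"
    unfolding P th usplit using uu den' pinf by (simp add: divide_simps) (simp add: power2_eq_square algebra_simps)
  finally have C: "qpoch_inf (q * s^2) q * (1 - u^2) / qpoch_inf (- q) q * (qtheta (z * y) q * qtheta (q / d) q * P_term q p s b c z \<epsilon>) = \<dots>" .
  show ?thesis unfolding par u2 C lam_def[symmetric] \<kappa>1_def[symmetric] \<kappa>2_def[symmetric] \<phi>_def unfolding d_def
    by (rule odd_part[OF eps s lam z ka y_def u_def den'(1) dinf[unfolded d_def] pinf])
qed

text \<open>Here the constant arises from $(u^2 - q)/(1 - q)$ and $(1/p,-1/p;q)_\infty = (1 - 1/q)(p,-p;q)_\infty$.\<close>

lemma Q_term_sum: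
  assumes eps: "\<epsilon> \<in> {1, -1}" and s: "s \<noteq> 0" and b: "b \<noteq> 0" and c: "c \<noteq> 0" and z: "z \<noteq> 0"
    and d: "qpoch_inf (\<epsilon> * q * b * c / s) q \<noteq> 0"
    and pinf: "qpoch_inf (- q) q \<noteq> 0" "qpoch_inf (p ^ 3) q \<noteq> 0" "qpoch_inf (- (p ^ 3)) q \<noteq> 0"
    and den: "qpochs_inf [1 / p, - (1 / p), \<epsilon> * q * s, \<epsilon> * s / (b * c), \<epsilon> * b * c * z / s] q \<noteq> 0"
  shows "((\<lambda>k. bracket (2 * k + 2) (b * c / s^2 * z * (\<epsilon> * (s * p ^ (2 * k + 2))) / q)
       * node_kernel (b * c / s^2) (q * s^2 / b) (q * s^2 / c) s z (2 * k + 2) \<epsilon>)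
     has_sum (qpoch_inf (q * s^2) q * (1 - b^2 * c^2 * z^2 / (q * s^2)) / qpoch_inf (- q) q
        * (qtheta (\<epsilon> * q * z * s) q * qtheta (\<epsilon> * s / (b * c)) q * Q_term q p s b c z \<epsilon>))) UNIV"
proof -
  define y where "y = \<epsilon> * q * s"
  define lam where "lam = b * c / s^2"
  define \<kappa>1 where "\<kappa>1 = q * s^2 / b"
  define \<kappa>2 where "\<kappa>2 = q * s^2 / c"
  define u where "u = lam * z * y / q"
  define d where "d = lam * y"
  define \<phi> where "\<phi> = qphi [y, q * y / \<kappa>1, q * y / \<kappa>2, u, q / u] [- q, p ^ 3, - (p ^ 3), d] q q"
  have nz: "\<epsilon> \<noteq> 0" "\<epsilon> * \<epsilon> = 1" "p \<noteq> 0" "q \<noteq> 0" using eps p q by auto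
  note simps = y_def lam_def \<kappa>1_def \<kappa>2_def u_def d_def
  have y: "y \<noteq> 0" and lam: "lam \<noteq> 0" and ka: "\<kappa>1 \<noteq> 0" "\<kappa>2 \<noteq> 0" "\<kappa>1 * \<kappa>2 * lam = q^2 * s^2" and d0: "d \<noteq> 0"
    using nz s b c by (auto simp: simps field_simps power2_eq_square)
  have par: "\<epsilon> * q * s = y" "\<epsilon> * q * b * c / s = d" "\<epsilon> * s / b = \<kappa>1 / y" "\<epsilon> * s / c = \<kappa>2 / y"
    "\<epsilon> * s / (b * c) = q / d" "\<epsilon> * b * c * z / s = u"
    "\<epsilon> * q * b / s = q * y / \<kappa>1" "\<epsilon> * q * c / s = q * y / \<kappa>2"
    "\<epsilon> * q * z * s = z * y"
    using eps nz s b c z by (auto simp: simps field_simps power2_eq_square)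
  have par2: "y / (b * c * z) = q / u"
    using eps nz s b c z by (auto simp: simps field_simps power2_eq_square)
  have u2: "b^2 * c^2 * z^2 / (q * s^2) = u^2 / q"
    using eps nz s by (auto simp: simps field_simps power2_eq_square)
  have den': "qpoch_inf y q \<noteq> 0" "qpoch_inf (q / d) q \<noteq> 0" "qpoch_inf u q \<noteq> 0"
     "qpoch_inf (1 / p) q \<noteq> 0" "qpoch_inf (- (1 / p)) q \<noteq> 0"
    using den unfolding par by (auto simp: qpochs_inf_def)
  have dinf: "qpoch_inf d q \<noteq> 0" by (rule d[unfolded par(2)])
  have q1: "1 - q \<noteq> 0" using q(2) by auto
  have e1: "qpoch_inf (1 / p) q = (1 - 1 / p) * qpoch_inf p q"
    using qpoch_inf_Suc[OF q(2), of "1 / p"] nz by (simp add: q_eq power2_eq_square)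
  have e2: "qpoch_inf (- (1 / p)) q = (1 + 1 / p) * qpoch_inf (- p) q"
    using qpoch_inf_Suc[OF q(2), of "- (1 / p)"] nz by (simp add: q_eq power2_eq_square)
  have "(1 - 1 / p) * (1 + 1 / p) = - (1 - q) / q" using nz by (simp add: q_eq field_simps power2_eq_square)
  then have e3: "qpoch_inf (1 / p) q * qpoch_inf (- (1 / p)) q = - (1 - q) / q * (qpoch_inf p q * qpoch_inf (- p) q)"
    unfolding e1 e2 by (metis mult.assoc mult.left_commute)
  have "qpoch_inf p q * qpoch_inf (- p) q = 1 / qpoch_inf (- q) q"
    using qpoch_signs pinf by (simp add: eq_divide_eq)
  note R = this
  have pp: "(1 - u^2 / q) / qpoch_inf (- q) q = (u^2 - q) / (1 - q) * (qpoch_inf (1 / p) q * qpoch_inf (- (1 / p)) q)"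
    unfolding e3 R using nz q1 pinf(1) by (simp add: field_simps)
  have Q: "Q_term q p s b c z \<epsilon> = qpoch_inf (\<kappa>1 / y) q * qpoch_inf (\<kappa>2 / y) q
     / (qpoch_inf (1 / p) q * qpoch_inf (- (1 / p)) q * qpoch_inf y q * qpoch_inf (q / d) q) * \<phi>"
    unfolding Q_term_def par par2 \<phi>_def using den'(3) by (simp add: qpochs_inf_def mult_ac)
  have th: "qtheta (q / d) q = qpoch_inf d q * qpoch_inf (q / d) q"
    using qtheta_q_div[OF d0] by (simp add: qtheta_eq)
  have "qpoch_inf (q * s^2) q * (1 - u^2 / q) / qpoch_inf (- q) q * (qtheta (z * y) q * qtheta (q / d) q * Q_term q p s b c z \<epsilon>)
    = qpoch_inf (q * s^2) q * ((1 - u^2 / q) / qpoch_inf (- q) q) * (qtheta (z * y) q * qtheta (q / d) q * Q_term q p s b c z \<epsilon>)"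
    by simp
  also have "\<dots> = (u^2 - q) / (1 - q) * (qpoch_inf (\<kappa>1 / y) q * qpoch_inf (\<kappa>2 / y) q) * qtheta (z * y) q
        * (qpoch_inf d q / qpoch_inf y q * qpoch_inf (q * s^2) q) * \<phi>"
    unfolding Q th pp using den' by (simp add: divide_simps)
  finally have C: "qpoch_inf (q * s^2) q * (1 - u^2 / q) / qpoch_inf (- q) q * (qtheta (z * y) q * qtheta (q / d) q * Q_term q p s b c z \<epsilon>) = \<dots>" .
  show ?thesis unfolding par u2 C lam_def[symmetric] \<kappa>1_def[symmetric] \<kappa>2_def[symmetric] \<phi>_def unfolding d_def
    by (rule even_part[OF eps s lam z ka y_def u_def den'(1) dinf[unfolded d_def] pinf])
qed

lemma W54_theta_identity:
  assumes nz: "z \<noteq> 0" "b \<noteq> 0" "c \<noteq> 0" "s \<noteq> 0" and z: "norm z < 1"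
    and W: "set [s, - s, q * s^2 / b, q * s^2 / c] \<inter> forbidden q = {}"
    and P: "\<And>\<epsilon>. \<epsilon> \<in> {1, - 1} \<Longrightarrow> set [- q, p, - p, \<epsilon> * p * b * c / s] \<inter> forbidden q = {}"
    and Q: "\<And>\<epsilon>. \<epsilon> \<in> {1, - 1} \<Longrightarrow> set [- q, p ^ 3, - (p ^ 3), \<epsilon> * q * b * c / s] \<inter> forbidden q = {}"
    and Pd: "\<And>\<epsilon>. \<epsilon> \<in> {1, - 1} \<Longrightarrow>
      qpochs_inf [p, - p, \<epsilon> * (p * s), \<epsilon> * (p * s) / (b * c), \<epsilon> * b * c * z / (p * s)] q \<noteq> 0"
    and Qd: "\<And>\<epsilon>. \<epsilon> \<in> {1, - 1} \<Longrightarrow>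
      qpochs_inf [1 / p, - (1 / p), \<epsilon> * q * s, \<epsilon> * s / (b * c), \<epsilon> * b * c * z / s] q \<noteq> 0"
  shows "W54 (s^2) s b c q z * (2 * (qtheta z q * qtheta (q * s^2 / (b * c)) q)
        * qpochs_inf [- q, b^2 * c^2 * z^2 / s^2, q * s^2 / b, q * s^2 / c] q)
     = qpochs_inf [q * s^2, b^2 * c^2 * z^2 / (q * s^2), q * s^2 / (b * c)] q
       * (\<Sum>\<epsilon>\<in>{1, - 1}.
            qtheta (\<epsilon> * p * z * s) q * qtheta (\<epsilon> * p * s / (b * c)) q * P_term q p s b c z \<epsilon>
          + qtheta (\<epsilon> * q * z * s) q * qtheta (\<epsilon> * s / (b * c)) q * Q_term q p s b c z \<epsilon>)"
proof -
  define lam where "lam = b * c / s^2"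
  define \<kappa>1 where "\<kappa>1 = q * s^2 / b"
  define \<kappa>2 where "\<kappa>2 = q * s^2 / c"
  define w where "w = b^2 * c^2 * z^2 / (q * s^2)"
  define t where "t \<epsilon> = qtheta (\<epsilon> * p * z * s) q * qtheta (\<epsilon> * p * s / (b * c)) q * P_term q p s b c z \<epsilon>
          + qtheta (\<epsilon> * q * z * s) q * qtheta (\<epsilon> * s / (b * c)) q * Q_term q p s b c z \<epsilon>" for \<epsilon>
  define f where "f \<epsilon> M = bracket M (lam * z * (\<epsilon> * (s * p ^ M)) / q) * node_kernel lam \<kappa>1 \<kappa>2 s z M \<epsilon>" for \<epsilon> M
  define K where "K = qpoch_inf (q * s^2) q * (1 - w) / qpoch_inf (- q) q"
  have lam: "lam \<noteq> 0" and ka: "\<kappa>1 \<noteq> 0" "\<kappa>2 \<noteq> 0" "\<kappa>1 * \<kappa>2 * lam = q^2 * s^2"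
    using nz q by (auto simp: lam_def \<kappa>1_def \<kappa>2_def field_simps power2_eq_square)
  have inf: "qpoch_inf s q \<noteq> 0" "qpoch_inf (- s) q \<noteq> 0" "qpoch_inf \<kappa>1 q \<noteq> 0" "qpoch_inf \<kappa>2 q \<noteq> 0"
    using W by (auto simp: \<kappa>1_def \<kappa>2_def intro!: not_forbidden(1)[OF q(2)])
  have inf': "qpoch_inf (- q) q \<noteq> 0" "qpoch_inf p q \<noteq> 0" "qpoch_inf (- p) q \<noteq> 0"
     "qpoch_inf (p ^ 3) q \<noteq> 0" "qpoch_inf (- (p ^ 3)) q \<noteq> 0"
    using P[of 1] Q[of 1] by (auto intro!: not_forbidden(1)[OF q(2)])
  have f: "(f \<epsilon> has_sum (K * t \<epsilon>)) UNIV" if eps: "\<epsilon> \<in> {1, -1}" for \<epsilon>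
  proof -
    have d: "qpoch_inf (\<epsilon> * p * b * c / s) q \<noteq> 0" "qpoch_inf (\<epsilon> * q * b * c / s) q \<noteq> 0"
      using P[OF eps] Q[OF eps] by (auto intro!: not_forbidden(1)[OF q(2)])
    have "f \<epsilon> 0 = 0" by (simp add: f_def bracket_0)
    from has_sum_odd_even[of "f \<epsilon>", OF this
        P_term_sum[OF eps nz(4,2,3,1) d(1) inf'(1-3) Pd[OF eps], folded lam_def \<kappa>1_def \<kappa>2_def w_def, folded f_def K_def]
        Q_term_sum[OF eps nz(4,2,3,1) d(2) inf'(1,4,5) Qd[OF eps], folded lam_def \<kappa>1_def \<kappa>2_def w_def, folded f_def K_def]]
    show ?thesis by (simp only: t_def distrib_left)
  qed
  obtain S where S1: "((\<lambda>M. (1/2) * (\<Sum>\<epsilon>\<in>{1,-1}. f \<epsilon> M)) has_sum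
        (qtheta z q * (qpoch_inf lam q * qpoch_inf \<kappa>1 q * qpoch_inf \<kappa>2 q) * S)) UNIV"
    and S2: "((\<lambda>k. z ^ k / qpoch q q k * vwp (s^2) k
        * (qpoch (q * s^2 / \<kappa>1) q k * qpoch (lam * \<kappa>1 / q) q k / (qpoch \<kappa>1 q k * qpoch \<kappa>2 q k))) has_sum S) UNIV"
    using node_expansion[OF nz(4) lam ka inf(3,4) nz(1) z] unfolding f_def by blast
  have "q * s^2 / \<kappa>1 = b" "lam * \<kappa>1 / q = c"
    using nz q by (auto simp: lam_def \<kappa>1_def)
  with S2 have "((\<lambda>k. z ^ k / qpoch q q k * vwp (s^2) k
        * (qpoch b q k * qpoch c q k / (qpoch \<kappa>1 q k * qpoch \<kappa>2 q k))) has_sum S) UNIV"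
    by simp
  moreover note W54_has_sum[OF inf(1,2) inf(3,4)[unfolded \<kappa>1_def \<kappa>2_def] z, folded \<kappa>1_def \<kappa>2_def]
  ultimately have S: "S = W54 (s^2) s b c q z" by (rule has_sum_unique)
  have "((\<lambda>M. (1/2) * (\<Sum>\<epsilon>\<in>{1,-1}. f \<epsilon> M)) has_sum ((1/2) * (K * t 1 + K * t (-1)))) UNIV"
    unfolding sum_signs by (intro has_sum_cmult_right has_sum_add f) auto
  with S1 have "qtheta z q * (qpoch_inf lam q * qpoch_inf \<kappa>1 q * qpoch_inf \<kappa>2 q) * S = (1/2) * (K * t 1 + K * t (-1))"
    by (rule has_sum_unique)
  then have main: "2 * (qtheta z q * (qpoch_inf lam q * qpoch_inf \<kappa>1 q * qpoch_inf \<kappa>2 q)) * S = K * (\<Sum>\<epsilon>\<in>{1,-1}. t \<epsilon>)"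
    unfolding sum_signs by (simp add: field_simps)
  have K: "K * qpoch_inf (- q) q = qpoch_inf (q * s^2) q * (1 - w)" using inf' by (simp add: K_def)
  have ql: "q * s^2 / (b * c) = q / lam" using nz by (simp add: lam_def)
  have th: "qtheta (q / lam) q = qpoch_inf lam q * qpoch_inf (q / lam) q"
    using qtheta_q_div[OF lam] by (simp add: qtheta_eq)
  have "b^2 * c^2 * z^2 / s^2 = w * q" using q by (simp add: w_def)
  then have lst: "qpochs_inf [- q, b^2 * c^2 * z^2 / s^2, \<kappa>1, \<kappa>2] q
      = qpoch_inf (- q) q * qpoch_inf (w * q) q * qpoch_inf \<kappa>1 q * qpoch_inf \<kappa>2 q"
    by (simp add: qpochs_inf_def)
  have lst': "qpochs_inf [q * s^2, w, q / lam] q = qpoch_inf (q * s^2) q * ((1 - w) * qpoch_inf (w * q) q) * qpoch_inf (q / lam) q"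
    using qpoch_inf_Suc[OF q(2), of w] by (simp add: qpochs_inf_def)
  have "S * (2 * (qtheta z q * qtheta (q / lam) q) * (qpoch_inf (- q) q * qpoch_inf (w * q) q * qpoch_inf \<kappa>1 q * qpoch_inf \<kappa>2 q))
     = (2 * (qtheta z q * (qpoch_inf lam q * qpoch_inf \<kappa>1 q * qpoch_inf \<kappa>2 q)) * S) * (qpoch_inf (q / lam) q * qpoch_inf (- q) q * qpoch_inf (w * q) q)"
    unfolding th by (simp only: mult_ac)
  also have "\<dots> = (K * qpoch_inf (- q) q) * qpoch_inf (w * q) q * qpoch_inf (q / lam) q * (\<Sum>\<epsilon>\<in>{1,-1}. t \<epsilon>)"
    unfolding main by (simp only: mult_ac)
  also have "\<dots> = qpoch_inf (q * s^2) q * ((1 - w) * qpoch_inf (w * q) q) * qpoch_inf (q / lam) q * (\<Sum>\<epsilon>\<in>{1,-1}. t \<epsilon>)"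
    unfolding K by (simp only: mult_ac)
  finally show ?thesis unfolding ql \<kappa>1_def[symmetric] \<kappa>2_def[symmetric] w_def[symmetric] lst lst' S t_def .
qed

text \<open>Inverting both arguments multiplies a pair of theta functions by $1/(xy)$, again a function of the product.\<close>

lemma qtheta_pair_shift_inverse:
  assumes nz: "x \<noteq> 0" "y \<noteq> 0" "x' \<noteq> 0" "y' \<noteq> 0" and xy: "x * y = x' * y'"
  shows "qtheta (q powi n * (1 / x)) q * qtheta (q powi n * (1 / y)) q * (qtheta x' q * qtheta y' q)
       = qtheta x q * qtheta y q * (qtheta (q powi n * (1 / x')) q * qtheta (q powi n * (1 / y')) q)"
proof -
  have inv: "1 / x \<noteq> 0" "1 / y \<noteq> 0" "1 / x' \<noteq> 0" "1 / y' \<noteq> 0" "1 / x * (1 / y) = 1 / x' * (1 / y')"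
    using nz xy by simp_all
  have "qtheta (1 / x) q * qtheta (1 / y) q = qtheta x q * qtheta y q / (x * y)"
    "qtheta (1 / x') q * qtheta (1 / y') q = qtheta x' q * qtheta y' q / (x * y)"
    using nz by (simp_all add: qtheta_inverse xy)
  with qtheta_pair_shift[OF inv, of n] show ?thesis using nz by simp
qed

end

text \<open>The numerators $A_\epsilon, B_\epsilon$ and the denominator $T$ may be replaced by any others with the same quotients;
the hypotheses express this without division.\<close>

lemma replace_theta_weights:
  fixes W :: complex
  assumes "W * (2 * T * D) = pre * (\<Sum>\<epsilon>\<in>E. A \<epsilon> * P \<epsilon> + B \<epsilon> * Q \<epsilon>)"
    and "\<And>\<epsilon>. \<epsilon> \<in> E \<Longrightarrow> T' * A \<epsilon> = T * A' \<epsilon>" "\<And>\<epsilon>. \<epsilon> \<in> E \<Longrightarrow> T' * B \<epsilon> = T * B' \<epsilon>"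
    and "T \<noteq> 0" "T' \<noteq> 0" "D \<noteq> 0"
  shows "W = pre / (2 * T' * D) * (\<Sum>\<epsilon>\<in>E. A' \<epsilon> * P \<epsilon> + B' \<epsilon> * Q \<epsilon>)"
proof -
  have "T * (W * (2 * T' * D)) = T' * (W * (2 * T * D))" by simp
  also have "\<dots> = pre * (\<Sum>\<epsilon>\<in>E. (T' * A \<epsilon>) * P \<epsilon> + (T' * B \<epsilon>) * Q \<epsilon>)"
    unfolding assms(1) by (simp add: sum_distrib_left algebra_simps)
  also have "\<dots> = pre * (\<Sum>\<epsilon>\<in>E. T * (A' \<epsilon> * P \<epsilon> + B' \<epsilon> * Q \<epsilon>))"
    by (intro arg_cong2[of _ _ _ _ "(*)"] refl sum.cong) (simp_all add: assms(2,3) algebra_simps)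
  also have "\<dots> = T * (pre * (\<Sum>\<epsilon>\<in>E. A' \<epsilon> * P \<epsilon> + B' \<epsilon> * Q \<epsilon>))"
    by (simp add: sum_distrib_left mult_ac)
  finally have "W * (2 * T' * D) = pre * (\<Sum>\<epsilon>\<in>E. A' \<epsilon> * P \<epsilon> + B' \<epsilon> * Q \<epsilon>)"
    using assms(4) by simp
  then show ?thesis using assms(5,6) by (simp add: eq_divide_eq)
qed

theorem theorem5p3:
  fixes n :: int and q z a b c sq sa :: complex
  assumes nonzero: "q \<noteq> 0" "z \<noteq> 0" "a \<noteq> 0" "b \<noteq> 0" "c \<noteq> 0"
    and norms: "norm q < 1" "norm z < 1"
    and roots: "sq ^ 2 = q" "sa ^ 2 = a"
    and W_params: "set [sa, - sa, q * a / b, q * a / c] \<inter> forbidden q = {}"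
    and P_params: "\<And>\<epsilon>. \<epsilon> \<in> {1, - 1} \<Longrightarrow>
      set [- q, sq, - sq, \<epsilon> * sq * b * c / sa] \<inter> forbidden q = {}"
    and Q_params: "\<And>\<epsilon>. \<epsilon> \<in> {1, - 1} \<Longrightarrow>
      set [- q, sq ^ 3, - (sq ^ 3), \<epsilon> * q * b * c / sa] \<inter> forbidden q = {}"
    and P_denom: "\<And>\<epsilon>. \<epsilon> \<in> {1, - 1} \<Longrightarrow>
      qpochs_inf [sq, - sq, \<epsilon> * (sq * sa), \<epsilon> * (sq * sa) / (b * c),
                  \<epsilon> * b * c * z / (sq * sa)] q \<noteq> 0"
    and Q_denom: "\<And>\<epsilon>. \<epsilon> \<in> {1, - 1} \<Longrightarrow>
      qpochs_inf [1 / sq, - (1 / sq), \<epsilon> * q * sa, \<epsilon> * sa / (b * c),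
                  \<epsilon> * b * c * z / sa] q \<noteq> 0"
    and prefactor_denom:
      "qpochs_inf [- q, b^2 * c^2 * z^2 / a, q * a / b, q * a / c] q \<noteq> 0"
    and theta_denom1: "qthetas [q powi n * z, q powi (n + 1) * (a / (b * c))] q \<noteq> 0"
    and theta_denom2: "qthetas [q powi (n - 1) * (b * c / a), q powi n / z] q \<noteq> 0"
  shows
    "W54 a sa b c q z =
       qpochs_inf [q * a, b^2 * c^2 * z^2 / (q * a), q * a / (b * c)] q
       / (2 * qthetas [q powi n * z, q powi (n + 1) * (a / (b * c))] q
            * qpochs_inf [- q, b^2 * c^2 * z^2 / a, q * a / b, q * a / c] q)
       * (\<Sum>\<epsilon>\<in>{1, - 1}.
            qthetas [\<epsilon> * sq powi (2 * n + 1) * z * sa,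
                     \<epsilon> * sq powi (2 * n + 1) * sa / (b * c)] q * P_term q sq sa b c z \<epsilon>
          + qthetas [\<epsilon> * q powi (n + 1) * z * sa,
                     \<epsilon> * q powi n * sa / (b * c)] q * Q_term q sq sa b c z \<epsilon>)
     \<and>
     W54 a sa b c q z =
       qpochs_inf [q * a, b^2 * c^2 * z^2 / (q * a), q * a / (b * c)] q
       / (2 * qthetas [q powi (n - 1) * (b * c / a), q powi n / z] q
            * qpochs_inf [- q, b^2 * c^2 * z^2 / a, q * a / b, q * a / c] q)
       * (\<Sum>\<epsilon>\<in>{1, - 1}.
            qthetas [\<epsilon> * sq powi (2 * n - 1) * b * c / sa,
                     \<epsilon> * sq powi (2 * n - 1) / (sa * z)] q * P_term q sq sa b c z \<epsilon>
          + qthetas [\<epsilon> * q powi n * b * c / sa,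
                     \<epsilon> * q powi (n - 1) / (sa * z)] q * Q_term q sq sa b c z \<epsilon>)"
proof -
  have sq0: "sq \<noteq> 0" and sa0: "sa \<noteq> 0" using nonzero roots by auto
  have "norm sq ^ 2 < 1" using norms(1) roots(1) by (simp flip: norm_power)
  then have "norm sq < 1" by (simp add: power_less_one_iff)
  then interpret nome sq q using sq0 roots by unfold_locales auto
  define D where "D = qpochs_inf [- q, b^2 * c^2 * z^2 / a, q * a / b, q * a / c] q"
  define pre where "pre = qpochs_inf [q * a, b^2 * c^2 * z^2 / (q * a), q * a / (b * c)] q"
  define w where "w = q * a / (b * c)"
  have w0: "w \<noteq> 0" using nonzero by (simp add: w_def)
  have base: "W54 a sa b c q z * (2 * (qtheta z q * qtheta w q) * D)
     = pre * (\<Sum>\<epsilon>\<in>{1, - 1}.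
            qtheta (\<epsilon> * sq * z * sa) q * qtheta (\<epsilon> * sq * sa / (b * c)) q * P_term q sq sa b c z \<epsilon>
          + qtheta (\<epsilon> * q * z * sa) q * qtheta (\<epsilon> * sa / (b * c)) q * Q_term q sq sa b c z \<epsilon>)"
    unfolding w_def D_def pre_def
    using W54_theta_identity[where s = sa and b = b and c = c and z = z, unfolded roots(2),
        OF nonzero(2,4,5) sa0 norms(2) W_params P_params Q_params P_denom Q_denom] by blast
  have pw: "sq powi (2 * n + 1) = q powi n * sq" "q powi (n + 1) = q powi n * q"
     "sq powi (2 * n - 1) = q powi n / sq" "q powi (n - 1) = q powi n / q"
    using sq0 q(1) by (simp_all add: power_int_add power_int_diff q_powi roots(1))
  have prod: "z * w = (\<epsilon> * sq * z * sa) * (\<epsilon> * sq * sa / (b * c))"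
      "z * w = (\<epsilon> * q * z * sa) * (\<epsilon> * sa / (b * c))" if "\<epsilon> \<in> {1, -1}" for \<epsilon>
    using that nonzero by (auto simp: w_def simp flip: roots simp: power2_eq_square)
  have nz: "\<epsilon> * sq * z * sa \<noteq> 0" "\<epsilon> * sq * sa / (b * c) \<noteq> 0" "\<epsilon> * q * z * sa \<noteq> 0" "\<epsilon> * sa / (b * c) \<noteq> 0"
    if "\<epsilon> \<in> {1, -1}" for \<epsilon> using that nonzero sq0 sa0 by auto
  have D0: "D \<noteq> 0" unfolding D_def by (rule prefactor_denom)
  have T1: "qthetas [q powi n * z, q powi (n + 1) * (a / (b * c))] q = qtheta (q powi n * z) q * qtheta (q powi n * w) q"
    by (simp add: qthetas_def pw w_def mult.assoc)
  have T2: "qthetas [q powi (n - 1) * (b * c / a), q powi n / z] q = qtheta (q powi n * (1 / z)) q * qtheta (q powi n * (1 / w)) q"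
    by (simp add: qthetas_def pw w_def mult.commute)
  have T10: "qtheta (q powi n * z) q * qtheta (q powi n * w) q \<noteq> 0" using theta_denom1 unfolding T1 .
  have T20: "qtheta (q powi n * (1 / z)) q * qtheta (q powi n * (1 / w)) q \<noteq> 0" using theta_denom2 unfolding T2 .
  have T0: "qtheta z q * qtheta w q \<noteq> 0"
    using T10 qtheta_powi_eq_0_iff[of z n] qtheta_powi_eq_0_iff[of w n] nonzero w0 by auto
  have A1: "qthetas [\<epsilon> * sq powi (2 * n + 1) * z * sa, \<epsilon> * sq powi (2 * n + 1) * sa / (b * c)] q
     = qtheta (q powi n * (\<epsilon> * sq * z * sa)) q * qtheta (q powi n * (\<epsilon> * sq * sa / (b * c))) q"
    "qthetas [\<epsilon> * q powi (n + 1) * z * sa, \<epsilon> * q powi n * sa / (b * c)] q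
     = qtheta (q powi n * (\<epsilon> * q * z * sa)) q * qtheta (q powi n * (\<epsilon> * sa / (b * c))) q" for \<epsilon>
    unfolding qthetas_def pw by (simp_all add: mult_ac)
  have A2: "qthetas [\<epsilon> * sq powi (2 * n - 1) * b * c / sa, \<epsilon> * sq powi (2 * n - 1) / (sa * z)] q
     = qtheta (q powi n * (1 / (\<epsilon> * sq * z * sa))) q * qtheta (q powi n * (1 / (\<epsilon> * sq * sa / (b * c)))) q"
    "qthetas [\<epsilon> * q powi n * b * c / sa, \<epsilon> * q powi (n - 1) / (sa * z)] q
     = qtheta (q powi n * (1 / (\<epsilon> * q * z * sa))) q * qtheta (q powi n * (1 / (\<epsilon> * sa / (b * c)))) q"
    if "\<epsilon> \<in> {1, -1}" for \<epsilon>
    using that unfolding qthetas_def pw by (auto simp: mult_ac)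
  have first: "W54 a sa b c q z = pre / (2 * (qtheta (q powi n * z) q * qtheta (q powi n * w) q) * D)
       * (\<Sum>\<epsilon>\<in>{1, - 1}.
            qthetas [\<epsilon> * sq powi (2 * n + 1) * z * sa, \<epsilon> * sq powi (2 * n + 1) * sa / (b * c)] q * P_term q sq sa b c z \<epsilon>
          + qthetas [\<epsilon> * q powi (n + 1) * z * sa, \<epsilon> * q powi n * sa / (b * c)] q * Q_term q sq sa b c z \<epsilon>)"
  proof (rule replace_theta_weights[OF base _ _ T0 T10 D0])
    fix \<epsilon> :: complex assume e: "\<epsilon> \<in> {1, - 1}"
    note pair = qtheta_pair_shift[OF nonzero(2) w0, where n = n]
    show "qtheta (q powi n * z) q * qtheta (q powi n * w) q * (qtheta (\<epsilon> * sq * z * sa) q * qtheta (\<epsilon> * sq * sa / (b * c)) q)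
      = qtheta z q * qtheta w q * qthetas [\<epsilon> * sq powi (2 * n + 1) * z * sa, \<epsilon> * sq powi (2 * n + 1) * sa / (b * c)] q"
      unfolding A1 by (rule pair[OF nz(1,2)[OF e] prod(1)[OF e]])
    show "qtheta (q powi n * z) q * qtheta (q powi n * w) q * (qtheta (\<epsilon> * q * z * sa) q * qtheta (\<epsilon> * sa / (b * c)) q)
      = qtheta z q * qtheta w q * qthetas [\<epsilon> * q powi (n + 1) * z * sa, \<epsilon> * q powi n * sa / (b * c)] q"
      unfolding A1 by (rule pair[OF nz(3,4)[OF e] prod(2)[OF e]])
  qed
  have second: "W54 a sa b c q z = pre / (2 * (qtheta (q powi n * (1 / z)) q * qtheta (q powi n * (1 / w)) q) * D)
       * (\<Sum>\<epsilon>\<in>{1, - 1}.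
            qthetas [\<epsilon> * sq powi (2 * n - 1) * b * c / sa, \<epsilon> * sq powi (2 * n - 1) / (sa * z)] q * P_term q sq sa b c z \<epsilon>
          + qthetas [\<epsilon> * q powi n * b * c / sa, \<epsilon> * q powi (n - 1) / (sa * z)] q * Q_term q sq sa b c z \<epsilon>)"
  proof (rule replace_theta_weights[OF base _ _ T0 T20 D0])
    fix \<epsilon> :: complex assume e: "\<epsilon> \<in> {1, - 1}"
    note pair = qtheta_pair_shift_inverse[OF nonzero(2) w0, where n = n]
    show "qtheta (q powi n * (1 / z)) q * qtheta (q powi n * (1 / w)) q * (qtheta (\<epsilon> * sq * z * sa) q * qtheta (\<epsilon> * sq * sa / (b * c)) q)
      = qtheta z q * qtheta w q * qthetas [\<epsilon> * sq powi (2 * n - 1) * b * c / sa, \<epsilon> * sq powi (2 * n - 1) / (sa * z)] q"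
      unfolding A2(1)[OF e] by (rule pair[OF nz(1,2)[OF e] prod(1)[OF e]])
    show "qtheta (q powi n * (1 / z)) q * qtheta (q powi n * (1 / w)) q * (qtheta (\<epsilon> * q * z * sa) q * qtheta (\<epsilon> * sa / (b * c)) q)
      = qtheta z q * qtheta w q * qthetas [\<epsilon> * q powi n * b * c / sa, \<epsilon> * q powi (n - 1) / (sa * z)] q"
      unfolding A2(2)[OF e] by (rule pair[OF nz(3,4)[OF e] prod(2)[OF e]])
  qed
  show ?thesis using first second unfolding T1 T2 pre_def D_def by blast
qed

end
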